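(* Let $G(V,E)$ be a planar trivalent graph and $\Gamma$ be a plane graph of $G$. Let $\Gamma_\triangle$ be the vertex graph associated to the all $0$-smoothing state of $(\Gamma^\flat,E)$. Define the vertex polynomial of $G$ to be $\langle G\rangle_v:=\langle\Gamma_\triangle\rangle_v$. Then the vertex polynomial is independent of the plane graph used to define it, i.e. the polynomial is an invariant of $G$. Furthermore, $$[G]=\left(\tfrac12\right)^{\frac12|V|}\langle G\rangle_v(1),$$ where $|V|$ is the number of vertices of $G$.
   Context: Graphs are finite multigraphs; loops, multiple edges and vertexless "circle" edges are allowed. A graph is trivalent if every vertex has degree $3$ (loops counted twice), and planar if it embeds in $S^2$. A plane graph of $G$ is (the image $\Gamma\subset S^2$ of) an embedding $G\to S^2$. A perfect matching of $G$ is a set $M$ of non-loop edges such that every vertex is an endpoint of exactly one edge of $M$. A perfect matching graph of $G$ is a plane graph of $G$ together with a perfect matching $M$ of $G$. Smoothings. For a non-loop edge $e$ of a trivalent plane graph with end vertices $u,v$, go counterclockwise around $u$ starting from $e$ and let $x_1,x_2$ be the other two half-edges; similarly $y_1,y_2$ at $v$. The $0$-smoothing of $e$ replaces a small neighborhood of $e$ by two disjoint arcs parallel to $e$ joining $x_1$ to $y_2$ and $x_2$ to $y_1$; the $1$-smoothing replaces it by two arcs crossing once transversely, joining $x_1$ to $y_1$ and $x_2$ to $y_2$. Smoothing every edge of a perfect matching yields a state: a collection of (possibly immersed) circles in $S^2$. Penrose formula. $[G]$ denotes the Penrose formula of $G$: the number obtained from any perfect matching graph of $G$ by the bracket in which each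 perfect matching edge is replaced by its $0$-smoothing minus its $1$-smoothing, each (immersed) circle has value $3$, and the bracket is multiplicative under disjoint union. That is, for a perfect matching $M=\{e_1,\dots,e_n\}$, $[G]=\sum_{\alpha\in\{0,1\}^n}(-1)^{|\alpha|}3^{k_\alpha}$, where $|\alpha|$ is the number of $1$'s in $\alpha$ and $k_\alpha$ is the number of circles in the state obtained by $\alpha_i$-smoothing each $e_i$. This number counts the Tait colorings (proper $3$-edge colorings) of $G$. Blow-up. $\Gamma^\flat$ is the trivalent plane graph obtained by replacing every vertex of $\Gamma$ by a small circle: the circle around a vertex meets the three half-edges at it in three new vertices, with empty interior, so its three arcs become new edges. The original edges $E$ of $\Gamma$ are taken as the perfect matching of $\Gamma^\flat$. Vertex bracket. $\Gamma_\triangle$ is the all $0$-smoothing state of $(\Gamma^\flat,E)$ (every $e\in E$ replaced by two parallel strands) with a triangle placed in the region of each original vertex $v\in V$, where three strands are adjacent. The vertex bracket $\langle\Gamma_\triangle\rangle_v$ resolves each triangle: it equals the bracket of the picture with no change at $v$, minus $q^3$ times the bracket of the picture in which, at $v$, the pair of parallel strands along each of the three half-edges at $v$ is given one crossing; each circle has value $q+q^{-1}$, and the bracket is multiplicative under disjoint union. Two crossings on the same edge (one from each end) are equivalent to no crossing. Thus $\langle\Gamma_\triangle\rangle_v(q)=\sum_{T\subseteq V}(-q^3)^{|T|}(q+q^{-1})^{k(T)}$, where $k(T)$ is the number of circles in the state in which $e\in E$ receives the $1$-smoothing if exactly one of the two ends (half-edges) of $e$ lies at a vertex of $T$, and the $0$-smoothing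 otherwise.
   Formalization: The evaluation formula for [G] is stated only for graphs without vertexless circle edges, since it fails for a single circle edge, where |V|=0 and [G]=3 but the vertex polynomial at 1 is a power of 2; the invariance is stated with circle edges allowed. *)

theory Defs
  imports "HOL-Analysis.Analysis" "HOL-Library.Poly_Mapping"
begin

section \<open>Multigraphs\<close>

text \<open>
  Every edge with end vertices carries an arbitrary reference direction, which only serves to
  distinguish its two half-edges \<open>(e, False)\<close> (at \<open>source e\<close>) and \<open>(e, True)\<close> (at \<open>target e\<close>).
  The edge set of the graph is \<open>edges \<union> circles\<close>, where \<open>circles\<close> are the vertexless circle edges.
\<close>

record ('v, 'e) mgraph =
  verts :: "'v set"
  edges :: "'e set"
  circles :: "'e set"
  source :: "'e \<Rightarrow> 'v"
  target :: "'e \<Rightarrow> 'v"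

definition finite_mgraph :: "('v, 'e) mgraph \<Rightarrow> bool" where
  "finite_mgraph G \<longleftrightarrow>
     finite (verts G) \<and> finite (edges G) \<and> finite (circles G) \<and> edges G \<inter> circles G = {} \<and>
     source G ` edges G \<subseteq> verts G \<and> target G ` edges G \<subseteq> verts G"

fun vert_of :: "('v, 'e) mgraph \<Rightarrow> 'e \<times> bool \<Rightarrow> 'v" where
  "vert_of G (e, b) = (if b then target G e else source G e)"

definition half_edges_at :: "('v, 'e) mgraph \<Rightarrow> 'v \<Rightarrow> ('e \<times> bool) set" where
  "half_edges_at G v = {h \<in> edges G \<times> UNIV. vert_of G h = v}"

definition trivalent :: "('v, 'e) mgraph \<Rightarrow> bool" where
  "trivalent G \<longleftrightarrow> (\<forall>v\<in>verts G. card (half_edges_at G v) = 3)"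

definition ends :: "('v, 'e) mgraph \<Rightarrow> 'e \<Rightarrow> 'v set" where
  "ends G e = (if e \<in> edges G then {source G e, target G e} else {})"

definition perfect_matching :: "('v, 'e) mgraph \<Rightarrow> 'e set \<Rightarrow> bool" where
  "perfect_matching G M \<longleftrightarrow>
     M \<subseteq> edges G \<and> (\<forall>e\<in>M. source G e \<noteq> target G e) \<and>
     (\<forall>v\<in>verts G. \<exists>!e. e \<in> M \<and> v \<in> ends G e)"


section \<open>Plane graphs\<close>

record ('v, 'e) drawing =
  pos :: "'v \<Rightarrow> real^3"
  curve :: "'e \<Rightarrow> real \<Rightarrow> real^3"

text \<open>
  A topological embedding into the unit sphere.  A \<open>simple_path\<close> may be closed, as needed for loops
  and circle edges; for other edges injectivity of \<open>pos\<close> makes it an arc.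
\<close>

definition plane_graph :: "('v, 'e) mgraph \<Rightarrow> ('v, 'e) drawing \<Rightarrow> bool" where
  "plane_graph G \<Gamma> \<longleftrightarrow>
     inj_on (pos \<Gamma>) (verts G) \<and> pos \<Gamma> ` verts G \<subseteq> sphere 0 1 \<and>
     (\<forall>e\<in>edges G \<union> circles G. simple_path (curve \<Gamma> e) \<and> path_image (curve \<Gamma> e) \<subseteq> sphere 0 1) \<and>
     (\<forall>e\<in>edges G. pathstart (curve \<Gamma> e) = pos \<Gamma> (source G e) \<and>
                   pathfinish (curve \<Gamma> e) = pos \<Gamma> (target G e)) \<and>
     (\<forall>e\<in>circles G. pathstart (curve \<Gamma> e) = pathfinish (curve \<Gamma> e)) \<and>
     (\<forall>e\<in>edges G \<union> circles G.
        path_image (curve \<Gamma> e) \<inter> pos \<Gamma> ` verts G \<subseteq> pos \<Gamma> ` ends G e) \<and>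
     (\<forall>e\<in>edges G \<union> circles G. \<forall>e'\<in>edges G \<union> circles G. e \<noteq> e' \<longrightarrow>
        path_image (curve \<Gamma> e) \<inter> path_image (curve \<Gamma> e') \<subseteq> pos \<Gamma> ` verts G)"

definition planar :: "('v, 'e) mgraph \<Rightarrow> bool" where
  "planar G \<longleftrightarrow> (\<exists>\<Gamma>. plane_graph G \<Gamma>)"

fun strand :: "('v, 'e) drawing \<Rightarrow> 'e \<times> bool \<Rightarrow> real \<Rightarrow> real^3" where
  "strand \<Gamma> (e, b) = (if b then reversepath (curve \<Gamma> e) else curve \<Gamma> e)"

text \<open>The point where a path first meets the sphere of radius \<open>r\<close> around its initial point.\<close>

definition first_exit :: "(real \<Rightarrow> real^3) \<Rightarrow> real \<Rightarrow> real^3" where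
  "first_exit p r = p (Inf {t \<in> {0..1}. dist (p t) (p 0) = r})"

text \<open>
  The points of the unit sphere at distance \<open>r\<close> from \<open>u\<close> form a circle around the axis \<open>u\<close>; three
  points \<open>p\<^sub>1, p\<^sub>2, p\<^sub>3\<close> of it are distinct and in counterclockwise order, seen from outside the sphere,
  iff \<open>((p\<^sub>2 - p\<^sub>1) \<times> (p\<^sub>3 - p\<^sub>1)) \<bullet> u > 0\<close>.  Curves are merely continuous, so there are no tangent
  directions: the cyclic order of the half-edges at \<open>u\<close> is read off on all small circles around \<open>u\<close>.
\<close>

definition counterclockwise ::
  "('v, 'e) mgraph \<Rightarrow> ('v, 'e) drawing \<Rightarrow> 'e \<times> bool \<Rightarrow> 'e \<times> bool \<Rightarrow> 'e \<times> bool \<Rightarrow> bool" where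
  "counterclockwise G \<Gamma> h1 h2 h3 \<longleftrightarrow>
     (\<forall>\<^sub>F r in at_right 0.
        let p1 = first_exit (strand \<Gamma> h1) r;
            p2 = first_exit (strand \<Gamma> h2) r;
            p3 = first_exit (strand \<Gamma> h3) r
        in cross3 (p2 - p1) (p3 - p1) \<bullet> pos \<Gamma> (vert_of G h1) > 0)"

text \<open>The next half-edge counterclockwise around the same vertex of a trivalent plane graph.\<close>

definition rotation :: "('v, 'e) mgraph \<Rightarrow> ('v, 'e) drawing \<Rightarrow> 'e \<times> bool \<Rightarrow> 'e \<times> bool" where
  "rotation G \<Gamma> h =
     (THE h'. \<exists>h''. half_edges_at G (vert_of G h) = {h, h', h''} \<and> counterclockwise G \<Gamma> h h' h'')"


section \<open>Smoothings\<close>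

text \<open>
  States depend on a plane graph only through the counterclockwise successor \<open>\<rho>\<close> on half-edges.
  \<open>M\<close> is the set of edges to be smoothed and \<open>A\<close> the set of those that receive the 1-smoothing.
  A circle of the state alternates between half-edges joined along an edge outside \<open>M\<close> and
  half-edges joined by an arc of a smoothing.  With \<open>u\<close>, \<open>v\<close> the two ends of \<open>e\<close>, the half-edges
  \<open>x\<^sub>1, x\<^sub>2\<close> are \<open>\<rho> (e, False), \<rho> (\<rho> (e, False))\<close>, and \<open>y\<^sub>1, y\<^sub>2\<close> are \<open>\<rho> (e, True), \<rho> (\<rho> (e, True))\<close>.
\<close>

definition smoothing0 :: "('e \<times> bool \<Rightarrow> 'e \<times> bool) \<Rightarrow> 'e \<Rightarrow> (('e \<times> bool) \<times> ('e \<times> bool)) set" where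
  "smoothing0 \<rho> e =
     {(\<rho> (e, False), \<rho> (\<rho> (e, True))), (\<rho> (\<rho> (e, False)), \<rho> (e, True))}"

definition smoothing1 :: "('e \<times> bool \<Rightarrow> 'e \<times> bool) \<Rightarrow> 'e \<Rightarrow> (('e \<times> bool) \<times> ('e \<times> bool)) set" where
  "smoothing1 \<rho> e =
     {(\<rho> (e, False), \<rho> (e, True)), (\<rho> (\<rho> (e, False)), \<rho> (\<rho> (e, True)))}"

definition joins ::
  "('v, 'e) mgraph \<Rightarrow> ('e \<times> bool \<Rightarrow> 'e \<times> bool) \<Rightarrow> 'e set \<Rightarrow> 'e set
     \<Rightarrow> (('e \<times> bool) \<times> ('e \<times> bool)) set" where
  "joins G \<rho> M A =
     {((e, False), (e, True)) | e. e \<in> edges G - M} \<union>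
     (\<Union>e\<in>edges G \<inter> M. if e \<in> A then smoothing1 \<rho> e else smoothing0 \<rho> e)"

text \<open>
  The number of circles of a state.  A circle edge in \<open>M\<close> is replaced by two parallel circles, like
  any edge that is replaced by two parallel strands; any other circle edge stays one circle.
\<close>

definition state_circles ::
  "('v, 'e) mgraph \<Rightarrow> ('e \<times> bool \<Rightarrow> 'e \<times> bool) \<Rightarrow> 'e set \<Rightarrow> 'e set \<Rightarrow> nat" where
  "state_circles G \<rho> M A =
     card (((edges G - M) \<times> UNIV) // (joins G \<rho> M A \<union> (joins G \<rho> M A)\<inverse>)\<^sup>*) +
     card (circles G - M) + 2 * card (circles G \<inter> M)"


section \<open>The Penrose formula\<close>

definition penrose_bracket :: "('v, 'e) mgraph \<Rightarrow> ('v, 'e) drawing \<Rightarrow> 'e set \<Rightarrow> int" where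
  "penrose_bracket G \<Gamma> M =
     (\<Sum>A\<in>Pow M. (-1) ^ card A * 3 ^ state_circles G (rotation G \<Gamma>) M A)"

text \<open>
  The bracket of any perfect matching graph of \<open>G\<close>.  If \<open>G\<close> has no perfect matching, then it has no
  Tait coloring either (each color class would be one), and the value is 0.
\<close>

definition penrose_formula :: "('v, 'e) mgraph \<Rightarrow> int" where
  "penrose_formula G =
     (if \<exists>M. perfect_matching G M
      then case SOME (\<Gamma>, M). plane_graph G \<Gamma> \<and> perfect_matching G M of
             (\<Gamma>, M) \<Rightarrow> penrose_bracket G \<Gamma> M
      else 0)"


section \<open>Blow-up and vertex bracket\<close>

text \<open>
  The new vertices are the half-edges of \<open>G\<close>.  An original edge \<open>e\<close> becomes \<open>Inl e\<close>, and
  \<open>Inr h\<close> is the arc, running counterclockwise around the original vertex, from \<open>h\<close> to its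
  successor \<open>\<rho> h\<close>.
\<close>

definition blow_up ::
  "('v, 'e) mgraph \<Rightarrow> ('e \<times> bool \<Rightarrow> 'e \<times> bool) \<Rightarrow> ('e \<times> bool, 'e + 'e \<times> bool) mgraph" where
  "blow_up G \<rho> =
     \<lparr> verts = edges G \<times> UNIV,
       edges = Inl ` edges G \<union> Inr ` (edges G \<times> UNIV),
       circles = Inl ` circles G,
       source = case_sum (\<lambda>e. (e, False)) (\<lambda>h. h),
       target = case_sum (\<lambda>e. (e, True)) \<rho> \<rparr>"

text \<open>
  Counterclockwise around the new vertex \<open>h\<close>: first the original half-edge, pointing away from the
  original vertex, then the arc towards \<open>\<rho> h\<close>, then the arc coming from the predecessor of \<open>h\<close>,
  which is \<open>\<rho> (\<rho> h)\<close> as \<open>G\<close> is trivalent.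
\<close>

fun blow_up_rotation ::
  "('e \<times> bool \<Rightarrow> 'e \<times> bool) \<Rightarrow> ('e + 'e \<times> bool) \<times> bool \<Rightarrow> ('e + 'e \<times> bool) \<times> bool" where
  "blow_up_rotation \<rho> (Inl e, b) = (Inr (e, b), False)"
| "blow_up_rotation \<rho> (Inr h, False) = (Inr (\<rho> (\<rho> h)), True)"
| "blow_up_rotation \<rho> (Inr h, True) = (Inl (fst (\<rho> h)), snd (\<rho> h))"

definition crossed_edges :: "('v, 'e) mgraph \<Rightarrow> 'v set \<Rightarrow> 'e set" where
  "crossed_edges G T = {e \<in> edges G. (source G e \<in> T) \<noteq> (target G e \<in> T)}"

text \<open>
  Integer Laurent polynomials in \<open>q\<close> are the finitely supported maps from exponents to coefficients,
  with the convolution product.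
\<close>

type_synonym laurent = "int \<Rightarrow>\<^sub>0 int"

definition q_var :: laurent where
  "q_var = Poly_Mapping.single 1 1"

definition q_inv :: laurent where
  "q_inv = Poly_Mapping.single (- 1) 1"

definition laurent_eval :: "laurent \<Rightarrow> real \<Rightarrow> real" where
  "laurent_eval p x = (\<Sum>n\<in>Poly_Mapping.keys p. of_int (Poly_Mapping.lookup p n) * x powi n)"

definition vertex_bracket :: "('v, 'e) mgraph \<Rightarrow> ('v, 'e) drawing \<Rightarrow> laurent" where
  "vertex_bracket G \<Gamma> =
     (let \<rho> = rotation G \<Gamma> in
      \<Sum>T\<in>Pow (verts G).
        (- (q_var ^ 3)) ^ card T *
        (q_var + q_inv) ^ state_circles (blow_up G \<rho>) (blow_up_rotation \<rho>)
                        (Inl ` (edges G \<union> circles G)) (Inl ` crossed_edges G T))"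

definition vertex_polynomial :: "('v, 'e) mgraph \<Rightarrow> laurent" where
  "vertex_polynomial G = vertex_bracket G (SOME \<Gamma>. plane_graph G \<Gamma>)"

end

theory Submission
  imports Defs "HOL-Complex_Analysis.Complex_Analysis" "HOL-Homology.Invariance_of_Domain"
begin

text \<open>
  The only topological input is that every even subgraph \<open>x\<close> of a plane cubic graph is the boundary
  of a two-colouring of the corners (the parity of the winding number of \<open>x\<close>).  Then colouring the
  circles of the state with crossed edges \<open>A\<close> by two colours amounts to choosing an even subgraph \<open>x\<close>
  and a vertex set \<open>s\<close> with coboundary \<open>A \<inter> x\<close>.  This count does not involve the embedding, hence
  neither do the numbers of circles and the vertex polynomial.  For \<open>q = 1\<close> every circle has value 2,
  so the vertex bracket is \<open>\<Sum>\<^sub>T (-1)\<^bsup>|T|\<^esup> |{(x, s). \<delta> s = \<delta> T \<inter> x}|\<close>.  Toggling a vertex outside of \<open>x\<close> shows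
  that only 2-factors \<open>x\<close> contribute, and \<open>T = s + t\<close> splits the contribution of \<open>x\<close> into a sum over
  the \<open>s\<close> that are constant on the edges of the complementary perfect matching, which is
  \<open>2\<^bsup>|V|/2\<^esup>\<close>, and a sum over the \<open>t\<close> that are constant on the cycles of \<open>x\<close>, which counts the ways to
  split \<open>x\<close> into two perfect matchings.  Altogether this is \<open>2\<^bsup>|V|/2\<^esup>\<close> times the number of Tait
  colorings, and by Penrose's argument, in which the corner colouring shows that the product of the
  vertex signs is \<open>(-1)\<^bsup>|V|/2\<^esup>\<close>, the latter is the Penrose bracket of every perfect matching graph.

  The curves are merely continuous, so the topological input needs some care.  After stereographic
  projection, an edge \<open>f\<close> from \<open>a\<close> to \<open>b\<close> has a continuous square root of \<open>(p - a) (p - b)\<close> on its complement,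
  and the product of these roots over \<open>x\<close>, divided by the product of all \<open>p - v\<close> over the vertices
  \<open>v\<close> of \<open>x\<close>, is a locally constant sign.  How it changes across an edge is read off at the end
  vertices from continuous logarithms of \<open>\<beta> t - \<alpha> s\<close> for pairs of arcs \<open>\<alpha>, \<beta>\<close>; the same logarithms
  show that the cyclic order of the first exits is the same on all small circles.
\<close>

section \<open>Functions constant on classes and circles of states\<close>

text \<open>Loops and parallel edges shape the bookkeeping. Local conditions are stated for
  half-edges, so that a loop counts twice in a parity, lies in no perfect matching and admits no
  Tait coloring. In the plane, parallel edges meet again at their far end and the two strands of a
  loop lie on one curve; therefore arcs at a vertex are always compared with one of them cut down to
  its first third. Circle edges explain the restriction \<open>circles G = {}\<close> in the
  evaluation: a circle edge multiplies the Penrose bracket by 3 but the vertex bracket at 1 by 4, as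
  it is doubled in the blow-up. The power of 2 in the evaluation comes from the perfect matching
  alone. The character sum over a 2-factor brings in powers of 2 as well, but a 2-factor has as many
  edges as vertices and they cancel.\<close>

text \<open>A function that respects the generating pairs \<open>J\<close> respects the equivalence
  relation they generate, so it is a function on the classes. Two colors recover the number of
  circles of a blow-up state, three colors give the terms of the Penrose bracket, in both cases
  without any description of the circles.\<close>

lemma card_functions_constant_on_classes:
  assumes "finite S" and J: "J \<subseteq> S \<times> S"
  shows "card {f \<in> S \<rightarrow>\<^sub>E C. \<forall>(a, b)\<in>J. f a = f b} = card C ^ card (S // (J \<union> J\<inverse>)\<^sup>*)"
proof -
  define R where "R = (J \<union> J\<inverse>)\<^sup>*"
  have symR: "sym R" unfolding R_def by (intro sym_rtrancl sym_Un_converse)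
  have R_trans: "(a, b) \<in> R \<Longrightarrow> (b, c) \<in> R \<Longrightarrow> (a, c) \<in> R" for a b c
    unfolding R_def by (rule rtrancl_trans)
  have eq_class: "R `` {a} = R `` {b}" if "(a, b) \<in> R" for a b
    using that symR R_trans by (blast dest: symD)
  have R_S: "b \<in> S" if "(a, b) \<in> R" "a \<in> S" for a b
    using that(1) unfolding R_def
    by (induction rule: rtrancl_induct) (use that(2) J in auto)
  define \<Phi> where "\<Phi> g = (\<lambda>a\<in>S. g (R `` {a}))" for g :: "'a set \<Rightarrow> 'b"
  let ?F = "{f \<in> S \<rightarrow>\<^sub>E C. \<forall>(a, b)\<in>J. f a = f b}"
  have "bij_betw \<Phi> (S // R \<rightarrow>\<^sub>E C) ?F"
    unfolding bij_betw_def
  proof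
    show "inj_on \<Phi> (S // R \<rightarrow>\<^sub>E C)"
    proof (rule inj_onI)
      fix g g' assume g: "g \<in> S // R \<rightarrow>\<^sub>E C" "g' \<in> S // R \<rightarrow>\<^sub>E C" and eq: "\<Phi> g = \<Phi> g'"
      have "g (R `` {a}) = g' (R `` {a})" if "a \<in> S" for a
        using fun_cong[OF eq, of a] that by (simp add: \<Phi>_def)
      then show "g = g'" by (intro PiE_ext[OF g]) (auto simp: quotient_def)
    qed
    show "\<Phi> ` (S // R \<rightarrow>\<^sub>E C) = ?F"
    proof (intro equalityI subsetI)
      fix f assume "f \<in> \<Phi> ` (S // R \<rightarrow>\<^sub>E C)"
      then obtain g where g: "g \<in> S // R \<rightarrow>\<^sub>E C" "f = \<Phi> g" by auto
      have "R `` {a} = R `` {b}" if "(a, b) \<in> J" for a b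
        by (rule eq_class) (use that in \<open>auto simp: R_def\<close>)
      then show "f \<in> ?F" using g J by (auto simp: \<Phi>_def quotient_def)
    next
      fix f assume f: "f \<in> ?F"
      have const: "f b = f a" if "(a, b) \<in> R" for a b
        using that unfolding R_def
        by (induction rule: rtrancl_induct) (use f in auto)
      define g where "g = (\<lambda>X\<in>S // R. f (SOME a. a \<in> X))"
      have some: "f (SOME b. b \<in> R `` {a}) = f a" for a
      proof -
        have "a \<in> R `` {a}" by (auto simp: R_def)
        then have "(SOME b. b \<in> R `` {a}) \<in> R `` {a}" by (rule someI)
        then show ?thesis using const by blast
      qed
      have "g \<in> S // R \<rightarrow>\<^sub>E C"
        using f some by (auto simp: g_def quotient_def)
      moreover have "\<Phi> g = f"
        using f some by (auto simp: g_def \<Phi>_def quotient_def fun_eq_iff PiE_def extensional_def)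
      ultimately show "f \<in> \<Phi> ` (S // R \<rightarrow>\<^sub>E C)" by blast
    qed
  qed
  then have "card ?F = card (S // R \<rightarrow>\<^sub>E C)" by (simp add: bij_betw_same_card)
  also have "\<dots> = card C ^ card (S // R)"
    using \<open>finite S\<close> by (simp add: card_funcsetE quotient_def)
  finally show ?thesis unfolding R_def .
qed

section \<open>Rotation systems, even subgraphs and face colorings\<close>

text \<open>The mod 2 cycles of the graph. Half-edges are counted rather than edges, so a loop adds
  2 at its vertex and is an even subgraph by itself.\<close>

definition even_subgraph :: "('v, 'e) mgraph \<Rightarrow> 'e set \<Rightarrow> bool" where
  "even_subgraph G x \<longleftrightarrow>
     x \<subseteq> edges G \<and> (\<forall>v\<in>verts G. even (card {h \<in> half_edges_at G v. fst h \<in> x}))"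

text \<open>A half-edge \<open>h\<close> also stands for the corner between \<open>h\<close> and \<open>\<rho> h\<close>.\<close>

definition face_coloring ::
  "('v, 'e) mgraph \<Rightarrow> ('e \<times> bool \<Rightarrow> 'e \<times> bool) \<Rightarrow> 'e set \<Rightarrow> ('e \<times> bool \<Rightarrow> bool) \<Rightarrow> bool" where
  "face_coloring G \<rho> x f \<longleftrightarrow>
     (\<forall>h\<in>edges G \<times> UNIV. (f h \<noteq> f (\<rho> (\<rho> h))) = (fst h \<in> x)) \<and>
     (\<forall>e\<in>edges G. f (e, False) = f (\<rho> (\<rho> (e, True))) \<and> f (e, True) = f (\<rho> (\<rho> (e, False))))"

text \<open>What remains of a drawing when only the counterclockwise order at each vertex is kept.
  As \<open>\<rho>\<close> has order three, \<open>\<rho> (\<rho> h)\<close> is the predecessor of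
  \<open>h\<close>.\<close>

locale cubic_rotation =
  fixes G :: "('v, 'e) mgraph" and \<rho> :: "'e \<times> bool \<Rightarrow> 'e \<times> bool"
  assumes finite_mgraph: "finite_mgraph G"
    and trivalent: "trivalent G"
    and half_edges_at_vert_of:
      "h \<in> edges G \<times> UNIV \<Longrightarrow> half_edges_at G (vert_of G h) = {h, \<rho> h, \<rho> (\<rho> h)}"
    and rotation_cubed: "h \<in> edges G \<times> UNIV \<Longrightarrow> \<rho> (\<rho> (\<rho> h)) = h"
begin

abbreviation "H \<equiv> edges G \<times> (UNIV :: bool set)"

lemma finite_verts: "finite (verts G)" and finite_edges: "finite (edges G)"
  using finite_mgraph by (auto simp: finite_mgraph_def)

lemma vert_of_in_verts: "h \<in> H \<Longrightarrow> vert_of G h \<in> verts G"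
  using finite_mgraph by (cases h) (auto simp: finite_mgraph_def)

lemma rotation_in: assumes "h \<in> H" shows "\<rho> h \<in> H" "\<rho> (\<rho> h) \<in> H"
  using half_edges_at_vert_of[OF assms] by (auto simp: half_edges_at_def)

lemma fst_rotation_in: assumes "h \<in> H" shows "fst (\<rho> h) \<in> edges G" "fst (\<rho> (\<rho> h)) \<in> edges G"
  using rotation_in[OF assms] by (simp_all add: mem_Times_iff)

lemma vert_of_rotation: assumes "h \<in> H"
  shows "vert_of G (\<rho> h) = vert_of G h" "vert_of G (\<rho> (\<rho> h)) = vert_of G h"
  using half_edges_at_vert_of[OF assms] by (auto simp: half_edges_at_def)

lemma rotation_distinct:
  assumes "h \<in> H" shows "h \<noteq> \<rho> h" "h \<noteq> \<rho> (\<rho> h)" "\<rho> h \<noteq> \<rho> (\<rho> h)"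
proof -
  have "card {h, \<rho> h, \<rho> (\<rho> h)} = 3"
    using trivalent vert_of_in_verts[OF assms] half_edges_at_vert_of[OF assms]
    by (metis trivalent_def)
  then show "h \<noteq> \<rho> h" "h \<noteq> \<rho> (\<rho> h)" "\<rho> h \<noteq> \<rho> (\<rho> h)"
    by (auto simp: card_insert_if split: if_splits)
qed

lemma half_edge_at_exists: assumes "v \<in> verts G" obtains h where "h \<in> H" "vert_of G h = v"
proof -
  have "card (half_edges_at G v) = 3" using trivalent assms by (simp add: trivalent_def)
  then have "half_edges_at G v \<noteq> {}" by auto
  then show ?thesis using that by (auto simp: half_edges_at_def)
qed

lemma same_vert_cases:
  assumes "h \<in> H" "k \<in> H" "vert_of G k = vert_of G h"
  shows "k = h \<or> k = \<rho> h \<or> k = \<rho> (\<rho> h)"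
  using half_edges_at_vert_of[OF assms(1)] assms(2,3) by (auto simp: half_edges_at_def)

text \<open>Three half-edges meet at a vertex, so evenness is the vanishing of a sum of three bits,
  written here as an exclusive or.\<close>

lemma even_subgraph_iff:
  "even_subgraph G x \<longleftrightarrow>
     x \<subseteq> edges G \<and> (\<forall>h\<in>H. (fst h \<in> x) = ((fst (\<rho> h) \<in> x) \<noteq> (fst (\<rho> (\<rho> h)) \<in> x)))"
proof -
  have *: "even (card {k \<in> half_edges_at G (vert_of G h). fst k \<in> x}) \<longleftrightarrow>
        (fst h \<in> x) = ((fst (\<rho> h) \<in> x) \<noteq> (fst (\<rho> (\<rho> h)) \<in> x))" if h: "h \<in> H" for h
  proof -
    have "{k \<in> half_edges_at G (vert_of G h). fst k \<in> x} =
       (if fst h \<in> x then {h} else {}) \<union> (if fst (\<rho> h) \<in> x then {\<rho> h} else {}) \<union>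
       (if fst (\<rho> (\<rho> h)) \<in> x then {\<rho> (\<rho> h)} else {})"
      unfolding half_edges_at_vert_of[OF h] by (auto; metis fst_conv)
    then show ?thesis using rotation_distinct[OF h] by (auto simp: card_insert_if)
  qed
  have "(\<forall>v\<in>verts G. even (card {h \<in> half_edges_at G v. fst h \<in> x})) \<longleftrightarrow>
    (\<forall>h\<in>H. even (card {k \<in> half_edges_at G (vert_of G h). fst k \<in> x}))"
  proof (rule iffI; rule ballI)
    fix v assume "\<forall>h\<in>H. even (card {k \<in> half_edges_at G (vert_of G h). fst k \<in> x})"
      and v: "v \<in> verts G"
    moreover obtain h where "h \<in> H" "vert_of G h = v" using half_edge_at_exists[OF v] .
    ultimately show "even (card {h \<in> half_edges_at G v. fst h \<in> x})" by blast
  qed (use vert_of_in_verts in blast)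
  then show ?thesis
    unfolding even_subgraph_def by (simp only: * cong: ball_cong)
qed

definition blow_up_classes where
  "blow_up_classes A = ((edges (blow_up G \<rho>) - Inl ` (edges G \<union> circles G)) \<times> UNIV) //
      (joins (blow_up G \<rho>) (blow_up_rotation \<rho>) (Inl ` (edges G \<union> circles G)) (Inl ` A) \<union>
      (joins (blow_up G \<rho>) (blow_up_rotation \<rho>) (Inl ` (edges G \<union> circles G)) (Inl ` A))\<inverse>)\<^sup>*"

lemma state_circles_blow_up:
  "state_circles (blow_up G \<rho>) (blow_up_rotation \<rho>) (Inl ` (edges G \<union> circles G)) (Inl ` A) =
     card (blow_up_classes A) + 2 * card (circles G)"
proof -
  have "circles (blow_up G \<rho>) - Inl ` (edges G \<union> circles G) = {}"
    "circles (blow_up G \<rho>) \<inter> Inl ` (edges G \<union> circles G) = Inl ` circles G"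
    by (auto simp: blow_up_def)
  then show ?thesis
    unfolding state_circles_def blow_up_classes_def by (simp only:) (simp add: card_image)
qed

end

definition cut_pairs :: "('v, 'e) mgraph \<Rightarrow> 'e set \<Rightarrow> ('e set \<times> 'v set) set" where
  "cut_pairs G A = {(x, s). even_subgraph G x \<and> s \<subseteq> verts G \<and> crossed_edges G s = A \<inter> x}"

text \<open>The assumption says that the closed surface built from the rotation system has trivial
  first homology mod 2, hence is a union of spheres.\<close>

locale planar_rotation = cubic_rotation G \<rho>
  for G :: "('v, 'e) mgraph" and \<rho> +
  assumes face_coloring_exists: "even_subgraph G x \<Longrightarrow> \<exists>f. face_coloring G \<rho> x f"
begin

text \<open>At the new vertex \<open>h\<close> the arc \<open>Inr h\<close> starts and the arc
  \<open>Inr (\<rho> (\<rho> h))\<close> ends. So for an original edge \<open>e\<close> the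
  half-edges \<open>x\<^sub>1, x\<^sub>2\<close> of the smoothing are
  \<open>(Inr (e, False), False)\<close> and
  \<open>(Inr (\<rho> (\<rho> (e, False))), True)\<close>.\<close>

lemma joins_blow_up:
  "joins (blow_up G \<rho>) (blow_up_rotation \<rho>) (Inl ` (edges G \<union> circles G)) (Inl ` A) =
     {((Inr h, False), (Inr h, True)) | h. h \<in> H} \<union>
     (\<Union>e\<in>edges G. if e \<in> A
        then {((Inr (e, False), False), (Inr (e, True), False)),
              ((Inr (\<rho> (\<rho> (e, False))), True), (Inr (\<rho> (\<rho> (e, True))), True))}
        else {((Inr (e, False), False), (Inr (\<rho> (\<rho> (e, True))), True)),
              ((Inr (\<rho> (\<rho> (e, False))), True), (Inr (e, True), False))})"
proof -
  have 1: "edges (blow_up G \<rho>) - Inl ` (edges G \<union> circles G) = Inr ` H"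
    by (auto simp: blow_up_def)
  have 2: "edges (blow_up G \<rho>) \<inter> Inl ` (edges G \<union> circles G) = Inl ` edges G"
    by (auto simp: blow_up_def)
  show ?thesis
    unfolding joins_def 1 2 smoothing0_def smoothing1_def
    by (auto simp: inj_image_mem_iff)
qed

text \<open>A colored state gives every corner a color. The edges whose two strands differ in color
  form an even subgraph \<open>x\<close>, because the color changes around a vertex cancel. Compared
  with a fixed face coloring of \<open>x\<close>, the coloring is equal or opposite at all three
  corners of a vertex at once; \<open>s\<close> collects the vertices where it is opposite. At an
  uncrossed edge the face coloring obeys the joins itself, so \<open>s\<close> does not separate the
  ends. At a crossed edge it violates them exactly if the edge is in \<open>x\<close>, and then
  \<open>s\<close> must separate the ends.\<close>

lemma two_power_blow_up_classes:
  assumes "A \<subseteq> edges G"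
  shows "2 ^ card (blow_up_classes A) = card (cut_pairs G A)"
proof -
  \<comment> \<open>Face colorings are not unique; fixing one for each \<open>x\<close> makes
    \<open>s\<close> well defined.\<close>
  define F where "F x = (SOME f. face_coloring G \<rho> x f)" for x
  have F: "face_coloring G \<rho> x (F x)" if "even_subgraph G x" for x
    unfolding F_def using someI_ex[OF face_coloring_exists[OF that]] .
  have F1: "F x h \<longleftrightarrow> (F x (\<rho> (\<rho> h)) \<noteq> (fst h \<in> x))" if "even_subgraph G x" "h \<in> H" for x h
    using F[OF that(1)] that(2) by (auto simp: face_coloring_def)
  have F2: "F x (e, False) = F x (\<rho> (\<rho> (e, True)))" "F x (e, True) = F x (\<rho> (\<rho> (e, False)))"
    if "even_subgraph G x" "e \<in> edges G" for x e
    using F[OF that(1)] that(2) by (auto simp: face_coloring_def)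
  define J where
    "J = joins (blow_up G \<rho>) (blow_up_rotation \<rho>) (Inl ` (edges G \<union> circles G)) (Inl ` A)"
  define S :: "(('e + 'e \<times> bool) \<times> bool) set" where "S = (Inr ` H) \<times> UNIV"
  have S: "(edges (blow_up G \<rho>) - Inl ` (edges G \<union> circles G)) \<times> UNIV = S"
    by (auto simp: blow_up_def S_def)
  have "J \<subseteq> S \<times> S"
    unfolding J_def joins_blow_up S_def by (auto simp: rotation_in split: if_splits)
  moreover have "finite S" using finite_edges by (simp add: S_def)
  ultimately have card1: "card {f \<in> S \<rightarrow>\<^sub>E (UNIV::bool set). \<forall>(a, b)\<in>J. f a = f b} =
      2 ^ card (blow_up_classes A)"
    using card_functions_constant_on_classes[of S J "UNIV :: bool set"]
    by (simp add: blow_up_classes_def S J_def)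
  \<comment> \<open>The two half-edges of an arc are always joined, so a coloring of the half-edges
    of the state amounts to a coloring of the corners.\<close>
  define Q where "Q = {f \<in> H \<rightarrow>\<^sub>E (UNIV::bool set). \<forall>e\<in>edges G.
     (if e \<in> A then f (e, False) = f (e, True) \<and> f (\<rho> (\<rho> (e, False))) = f (\<rho> (\<rho> (e, True)))
      else f (e, False) = f (\<rho> (\<rho> (e, True))) \<and> f (\<rho> (\<rho> (e, False))) = f (e, True))}"
  have Jiff: "(\<forall>(a, b)\<in>J. f a = f b) \<longleftrightarrow> (\<forall>h\<in>H. f (Inr h, False) = f (Inr h, True)) \<and>
     (\<forall>e\<in>edges G.
     (if e \<in> A then f (Inr (e, False), False) = f (Inr (e, True), False) \<and>
          f (Inr (\<rho> (\<rho> (e, False))), True) = f (Inr (\<rho> (\<rho> (e, True))), True)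
      else f (Inr (e, False), False) = f (Inr (\<rho> (\<rho> (e, True))), True) \<and>
          f (Inr (\<rho> (\<rho> (e, False))), True) = f (Inr (e, True), False)))" for f :: "_ \<Rightarrow> bool"
  proof -
    let ?P = "\<lambda>(a, b). f a = f b"
    define J1 :: "((('e + 'e \<times> bool) \<times> bool) \<times> (('e + 'e \<times> bool) \<times> bool)) set"
      where "J1 = {((Inr h, False), (Inr h, True)) | h. h \<in> H}"
    define J2 :: "'e \<Rightarrow> ((('e + 'e \<times> bool) \<times> bool) \<times> (('e + 'e \<times> bool) \<times> bool)) set"
      where "J2 e = (if e \<in> A
        then {((Inr (e, False), False), (Inr (e, True), False)),
              ((Inr (\<rho> (\<rho> (e, False))), True), (Inr (\<rho> (\<rho> (e, True))), True))}
        else {((Inr (e, False), False), (Inr (\<rho> (\<rho> (e, True))), True)),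
              ((Inr (\<rho> (\<rho> (e, False))), True), (Inr (e, True), False))})" for e
    have "J = J1 \<union> (\<Union>e\<in>edges G. J2 e)"
      unfolding J_def joins_blow_up J1_def J2_def ..
    then have "Ball J ?P \<longleftrightarrow> Ball J1 ?P \<and> (\<forall>e\<in>edges G. Ball (J2 e) ?P)"
      by blast
    moreover have "Ball J1 ?P \<longleftrightarrow> (\<forall>h\<in>H. f (Inr h, False) = f (Inr h, True))"
      unfolding J1_def by fastforce
    moreover have "Ball (J2 e) ?P \<longleftrightarrow>
     (if e \<in> A then f (Inr (e, False), False) = f (Inr (e, True), False) \<and>
          f (Inr (\<rho> (\<rho> (e, False))), True) = f (Inr (\<rho> (\<rho> (e, True))), True)
      else f (Inr (e, False), False) = f (Inr (\<rho> (\<rho> (e, True))), True) \<and>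
          f (Inr (\<rho> (\<rho> (e, False))), True) = f (Inr (e, True), False))" for e
      by (simp add: J2_def)
    ultimately show ?thesis by simp
  qed
  have "bij_betw (\<lambda>f. \<lambda>(i, b)\<in>S. f (projr i)) Q
      {f \<in> S \<rightarrow>\<^sub>E (UNIV::bool set). \<forall>(a, b)\<in>J. f a = f b}"
  proof (rule bij_betw_byWitness[where f' = "\<lambda>g. \<lambda>h\<in>H. g (Inr h, False)"])
    show "\<forall>f\<in>Q. (\<lambda>h\<in>H. (\<lambda>(i, b)\<in>S. f (projr i)) (Inr h, False)) = f"
      by (auto simp: Q_def S_def fun_eq_iff PiE_def extensional_def restrict_def)
    have HS: "(Inr h, b) \<in> S \<longleftrightarrow> h \<in> H" for h b by (auto simp: S_def)
    show "\<forall>g\<in>{f \<in> S \<rightarrow>\<^sub>E (UNIV :: bool set). \<forall>(a, b)\<in>J. f a = f b}.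
        (\<lambda>(i, b)\<in>S. (\<lambda>h\<in>H. g (Inr h, False)) (projr i)) = g"
    proof
      fix g assume g: "g \<in> {f \<in> S \<rightarrow>\<^sub>E (UNIV :: bool set). \<forall>(a, b)\<in>J. f a = f b}"
      then have gJ: "\<forall>h\<in>H. g (Inr h, False) = g (Inr h, True)" using Jiff[of g] by blast
      show "(\<lambda>(i, b)\<in>S. (\<lambda>h\<in>H. g (Inr h, False)) (projr i)) = g"
      proof
        fix y
        show "(\<lambda>(i, b)\<in>S. (\<lambda>h\<in>H. g (Inr h, False)) (projr i)) y = g y"
        proof (cases "y \<in> S")
          case True
          then obtain h b where "y = (Inr h, b)" "h \<in> H" by (auto simp: S_def)
          then show ?thesis using True gJ by (cases b) auto
        next
          case False
          moreover have "g y = undefined" using g False PiE_arb[of g S "\<lambda>_. UNIV" y] by blast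
          ultimately show ?thesis by simp
        qed
      qed
    qed
    show "(\<lambda>f. \<lambda>(i, b)\<in>S. f (projr i)) ` Q \<subseteq> {f \<in> S \<rightarrow>\<^sub>E (UNIV :: bool set). \<forall>(a, b)\<in>J. f a = f b}"
    proof (rule image_subsetI)
      fix f assume "f \<in> Q"
      then show "(\<lambda>(i, b)\<in>S. f (projr i)) \<in> {f \<in> S \<rightarrow>\<^sub>E (UNIV :: bool set). \<forall>(a, b)\<in>J. f a = f b}"
        by (simp add: Q_def Jiff HS rotation_in fst_rotation_in)
    qed
    show "(\<lambda>g. \<lambda>h\<in>H. g (Inr h, False)) ` {f \<in> S \<rightarrow>\<^sub>E (UNIV :: bool set). \<forall>(a, b)\<in>J. f a = f b} \<subseteq> Q"
    proof (rule image_subsetI)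
      fix g assume g: "g \<in> {f \<in> S \<rightarrow>\<^sub>E (UNIV :: bool set). \<forall>(a, b)\<in>J. f a = f b}"
      then have *: "\<forall>(a, b)\<in>J. g a = g b" by blast
      have g1: "g (Inr h, True) = g (Inr h, False)" if "h \<in> H" for h
        using conjunct1[OF Jiff[of g, THEN iffD1, OF *], THEN bspec, OF that] by (rule sym)
      note g2 = conjunct2[OF Jiff[of g, THEN iffD1, OF *], THEN bspec]
      let ?f = "\<lambda>h\<in>H. g (Inr h, False)"
      have "if e \<in> A then ?f (e, False) = ?f (e, True) \<and> ?f (\<rho> (\<rho> (e, False))) = ?f (\<rho> (\<rho> (e, True)))
        else ?f (e, False) = ?f (\<rho> (\<rho> (e, True))) \<and> ?f (\<rho> (\<rho> (e, False))) = ?f (e, True)"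
        if e: "e \<in> edges G" for e
      proof -
        have e': "(e, b) \<in> H" for b using e by simp
        have f: "?f h = g (Inr h, False)" if "h \<in> H" for h
          using that by (rule restrict_apply')
        show ?thesis
          unfolding f[OF e'] f[OF rotation_in(2)[OF e']]
          using g2[OF e] unfolding g1[OF rotation_in(2)[OF e']] .
      qed
      moreover have "?f \<in> H \<rightarrow>\<^sub>E UNIV" by simp
      ultimately show "?f \<in> Q"
        unfolding Q_def by (intro CollectI conjI ballI)
    qed
  qed
  then have card2: "card Q = 2 ^ card (blow_up_classes A)"
    using card1 by (simp add: bij_betw_same_card)
  define \<Psi> where "\<Psi> = (\<lambda>(x, s). \<lambda>h\<in>H. F x h \<noteq> (vert_of G h \<in> s))"
  have crossed: "crossed_edges G s = A \<inter> x \<longleftrightarrow>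
     (\<forall>e\<in>edges G. ((source G e \<in> s) \<noteq> (target G e \<in> s)) = (e \<in> A \<and> e \<in> x))"
    for s x using assms by (auto simp: crossed_edges_def)
  have "bij_betw \<Psi> (cut_pairs G A) Q"
    unfolding bij_betw_def
  proof
    show "inj_on \<Psi> (cut_pairs G A)"
    proof (rule inj_onI, clarify)
      fix x s x' s' assume xs: "(x, s) \<in> cut_pairs G A" "(x', s') \<in> cut_pairs G A"
        and \<Psi>: "\<Psi> (x, s) = \<Psi> (x', s')"
      have eq: "(F x h \<noteq> (vert_of G h \<in> s)) = (F x' h \<noteq> (vert_of G h \<in> s'))" if "h \<in> H" for h
        using that fun_cong[OF \<Psi>, of h] by (simp add: \<Psi>_def del: split_paired_All)
      have ev: "even_subgraph G x" "even_subgraph G x'" "s \<subseteq> verts G" "s' \<subseteq> verts G"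
        using xs by (auto simp: cut_pairs_def)
      have "fst h \<in> x \<longleftrightarrow> fst h \<in> x'" if "h \<in> H" for h
        using F1[OF ev(1) that] F1[OF ev(2) that] eq[OF that] eq[OF rotation_in(2)[OF that]]
          vert_of_rotation[OF that] by auto
      then have "e \<in> x \<longleftrightarrow> e \<in> x'" if "e \<in> edges G" for e using that by fastforce
      then have "x = x'" using ev(1,2) by (auto simp: even_subgraph_def)
      moreover have "v \<in> s \<longleftrightarrow> v \<in> s'" if v: "v \<in> verts G" for v
      proof -
        obtain h where "h \<in> H" "vert_of G h = v" using half_edge_at_exists[OF v] .
        then show ?thesis using eq[of h] \<open>x = x'\<close> by auto
      qed
      ultimately show "x = x' \<and> s = s'" using ev(3,4) by auto
    qed
    show "\<Psi> ` cut_pairs G A = Q"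
    proof (intro equalityI subsetI)
      fix f assume "f \<in> \<Psi> ` cut_pairs G A"
      then obtain x s where xs: "(x, s) \<in> cut_pairs G A" and f: "f = \<Psi> (x, s)" by auto
      then have ev: "even_subgraph G x" and s: "\<forall>e\<in>edges G.
         ((source G e \<in> s) \<noteq> (target G e \<in> s)) = (e \<in> A \<and> e \<in> x)"
        using crossed by (auto simp: cut_pairs_def)
      have fh: "f h = (F x h \<noteq> (vert_of G h \<in> s))" if "h \<in> H" for h
        using that by (simp add: f \<Psi>_def)
      have "f \<in> H \<rightarrow>\<^sub>E UNIV" by (simp add: f \<Psi>_def)
      moreover have "if e \<in> A then f (e, False) = f (e, True) \<and> f (\<rho> (\<rho> (e, False))) = f (\<rho> (\<rho> (e, True)))
      else f (e, False) = f (\<rho> (\<rho> (e, True))) \<and> f (\<rho> (\<rho> (e, False))) = f (e, True)" if e: "e \<in> edges G" for e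
      proof -
        have e': "(e, b) \<in> H" for b using e by simp
        show ?thesis
          using fh[OF e'] fh[OF rotation_in(2)[OF e']] vert_of_rotation(2)[OF e'] s e
            F1[OF ev e'] F2[OF ev e] by auto
      qed
      ultimately show "f \<in> Q" by (simp add: Q_def)
    next
      fix f assume f: "f \<in> Q"
      have fe: "if e \<in> A then f (e, False) = f (e, True) \<and> f (\<rho> (\<rho> (e, False))) = f (\<rho> (\<rho> (e, True)))
      else f (e, False) = f (\<rho> (\<rho> (e, True))) \<and> f (\<rho> (\<rho> (e, False))) = f (e, True)" if e: "e \<in> edges G" for e
        using f that unfolding Q_def by blast
      \<comment> \<open>Only the start of \<open>e\<close> is inspected; the joins along
        \<open>e\<close> give the same answer at its other end.\<close>
      define x where "x = {e \<in> edges G. f (e, False) \<noteq> f (\<rho> (\<rho> (e, False)))}"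
      have x: "fst h \<in> x \<longleftrightarrow> f h \<noteq> f (\<rho> (\<rho> h))" if h: "h \<in> H" for h
      proof -
        obtain e b where hb: "h = (e, b)" by (cases h)
        then have "e \<in> edges G" using h by simp
        then show ?thesis using fe[of e] hb by (cases b) (auto simp: x_def split: if_splits)
      qed
      have ev: "even_subgraph G x"
        unfolding even_subgraph_iff
      proof (intro conjI ballI)
        show "x \<subseteq> edges G" by (auto simp: x_def)
      next
        fix h assume h: "h \<in> H"
        show "(fst h \<in> x) = ((fst (\<rho> h) \<in> x) \<noteq> (fst (\<rho> (\<rho> h)) \<in> x))"
          using x[OF h] x[OF rotation_in(1)[OF h]] x[OF rotation_in(2)[OF h]]
            rotation_cubed[OF h] rotation_cubed[OF rotation_in(1)[OF h]] by auto
      qed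
      define s where "s = {v \<in> verts G. \<exists>h\<in>H. vert_of G h = v \<and> f h \<noteq> F x h}"
      \<comment> \<open>Passing \<open>h\<close>, both \<open>f\<close> and \<open>F x\<close>
        change exactly if \<open>fst h\<close> is in \<open>x\<close>, so their agreement does not
        change.\<close>
      have rot: "(f h = F x h) = (f (\<rho> (\<rho> h)) = F x (\<rho> (\<rho> h)))" if "h \<in> H" for h
        using x[OF that] F1[OF ev that] by auto
      have rot': "(f h = F x h) = (f (\<rho> h) = F x (\<rho> h))" if "h \<in> H" for h
        using rot[OF that] rot[OF rotation_in(2)[OF that]] rotation_cubed[OF rotation_in(1)[OF that]]
        by (simp add: rotation_cubed that)
      have s: "vert_of G h \<in> s \<longleftrightarrow> f h \<noteq> F x h" if h: "h \<in> H" for h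
      proof -
        have "f k = F x k \<longleftrightarrow> f h = F x h" if "k \<in> H" "vert_of G k = vert_of G h" for k
          using same_vert_cases[OF h that] rot[OF h] rot'[OF h] by auto
        then show ?thesis using h vert_of_in_verts[OF h] unfolding s_def by blast
      qed
      have "((source G e \<in> s) \<noteq> (target G e \<in> s)) = (e \<in> A \<and> e \<in> x)" if e: "e \<in> edges G" for e
      proof -
        have e': "(e, b) \<in> H" for b using e by simp
        show ?thesis
          using s[OF e', of False] s[OF e', of True] fe[OF e] x[OF e', of False] x[OF e', of True]
            F2[OF ev e] F1[OF ev e', of False] F1[OF ev e', of True]
          by (auto split: if_splits)
      qed
      then have "(x, s) \<in> cut_pairs G A"
        using ev crossed by (auto simp: cut_pairs_def s_def)
      moreover have "f = \<Psi> (x, s)"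
      proof
        fix h
        show "f h = \<Psi> (x, s) h"
        proof (cases "h \<in> H")
          case True
          then show ?thesis using s[OF True] by (auto simp: \<Psi>_def)
        next
          case False
          moreover have "f h = undefined"
            using f False PiE_arb[of f H "\<lambda>_. UNIV" h] by (simp add: Q_def)
          ultimately show ?thesis by (simp add: \<Psi>_def)
        qed
      qed
      ultimately show "f \<in> \<Psi> ` cut_pairs G A" by blast
    qed
  qed
  then show ?thesis using card2 by (simp add: bij_betw_same_card)
qed

end

section \<open>Tait colorings and the Penrose bracket\<close>

text \<open>Half-edges and not edges are compared: the two half-edges of a loop share their color,
  so a graph with a loop has no coloring.\<close>

definition tait_colorings :: "('v, 'e) mgraph \<Rightarrow> ('e \<Rightarrow> nat) set" where
  "tait_colorings G =
     {c \<in> edges G \<rightarrow>\<^sub>E {0, 1, 2}. \<forall>v\<in>verts G. inj_on (c \<circ> fst) (half_edges_at G v)}"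

lemma tait_color_range: "c \<in> tait_colorings G \<Longrightarrow> e \<in> edges G \<Longrightarrow> c e \<in> {0, 1, 2}"
  unfolding tait_colorings_def by (blast dest: PiE_mem)

text \<open>With \<open>prod_of_bool\<close> this writes the sign and the color conditions of a
  state as one product over the matching edges, the form in which \<open>prod_add\<close> sums over
  all smoothings.\<close>

lemma prod_neg_of_bool:
  "finite A \<Longrightarrow> (\<Prod>e\<in>A. - of_bool (P e) :: int) = (-1) ^ card A * of_bool (\<forall>e\<in>A. P e)"
  by (induction A rule: finite_induct) auto

lemma prod_of_bool:
  "finite A \<Longrightarrow> (\<Prod>e\<in>A. of_bool (P e) :: 'a :: comm_semiring_1) = of_bool (\<forall>e\<in>A. P e)"
  by (induction A rule: finite_induct) auto

lemma prod_sign: "finite V \<Longrightarrow> T \<subseteq> V \<Longrightarrow> (\<Prod>v\<in>V. if v \<in> T then - 1 else 1 :: int) = (-1) ^ card T"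
  by (simp add: prod.If_cases Int_absorb1)

text \<open>Toggling \<open>v\<close> is a sign-reversing involution, so the terms cancel in
  pairs.\<close>

lemma sum_Pow_sign_eq_0:
  fixes f :: "'a set \<Rightarrow> int"
  assumes "finite V" "v \<in> V" "\<And>T. T \<subseteq> V - {v} \<Longrightarrow> f (insert v T) = f T"
  shows "(\<Sum>T\<in>Pow V. (-1) ^ card T * f T) = 0"
proof -
  define W where "W = V - {v}"
  have V: "V = insert v W" "v \<notin> W" "finite W" using assms by (auto simp: W_def)
  have disj: "Pow W \<inter> insert v ` Pow W = {}" using V(2) by auto
  have inj: "inj_on (insert v) (Pow W)" using V(2) by (auto simp: inj_on_def)
  have "(\<Sum>T\<in>insert v ` Pow W. (-1) ^ card T * f T) = (\<Sum>T\<in>Pow W. (-1) ^ card (insert v T) * f (insert v T))"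
    by (simp add: sum.reindex[OF inj])
  also have "\<dots> = (\<Sum>T\<in>Pow W. - ((-1) ^ card T * f T))"
  proof (rule sum.cong)
    fix T assume T: "T \<in> Pow W"
    then have "finite T" "v \<notin> T" using V by (auto intro: finite_subset)
    then show "(-1) ^ card (insert v T) * f (insert v T) = - ((-1) ^ card T * f T)"
      using assms(3)[of T] T by (simp add: W_def)
  qed simp
  finally have "(\<Sum>T\<in>insert v ` Pow W. (-1) ^ card T * f T) = - (\<Sum>T\<in>Pow W. (-1) ^ card T * f T)"
    by (simp add: sum_negf)
  then show ?thesis
    unfolding V(1) Pow_insert using V(3) disj by (subst sum.union_disjoint) auto
qed

section \<open>Perfect matchings, Tait colorings and vertex signs\<close>

context cubic_rotation
begin

text \<open>The half-edge form of \<open>perfect_matching\<close>: uniqueness of the half-edge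
  excludes loops by itself, and the condition can be read off from the rotation.\<close>

definition one_factor :: "'e set \<Rightarrow> bool" where
  "one_factor X \<longleftrightarrow> X \<subseteq> edges G \<and> (\<forall>v\<in>verts G. \<exists>!h. h \<in> H \<and> vert_of G h = v \<and> fst h \<in> X)"

lemma one_factor_iff:
  "one_factor X \<longleftrightarrow> X \<subseteq> edges G \<and>
     (\<forall>h\<in>H. (fst h \<in> X \<or> fst (\<rho> h) \<in> X \<or> fst (\<rho> (\<rho> h)) \<in> X) \<and>
            (fst h \<in> X \<longrightarrow> fst (\<rho> h) \<notin> X \<and> fst (\<rho> (\<rho> h)) \<notin> X))"
  (is "_ \<longleftrightarrow> _ \<and> ?R")
proof -
  have "(\<forall>v\<in>verts G. \<exists>!h. h \<in> H \<and> vert_of G h = v \<and> fst h \<in> X) \<longleftrightarrow> ?R"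
  proof
    assume L: "\<forall>v\<in>verts G. \<exists>!h. h \<in> H \<and> vert_of G h = v \<and> fst h \<in> X"
    show ?R
    proof
      fix h assume h: "h \<in> H"
      note ex = L[rule_format, OF vert_of_in_verts[OF h]]
      obtain k where k: "k \<in> H" "vert_of G k = vert_of G h" "fst k \<in> X" using ex by blast
      have uniq: "k1 = k2" if "k1 \<in> H" "vert_of G k1 = vert_of G h" "fst k1 \<in> X"
        "k2 \<in> H" "vert_of G k2 = vert_of G h" "fst k2 \<in> X" for k1 k2
        using ex that by blast
      have "fst h \<in> X \<or> fst (\<rho> h) \<in> X \<or> fst (\<rho> (\<rho> h)) \<in> X"
        using same_vert_cases[OF h k(1,2)] k(3) by auto
      moreover have "fst (\<rho> h) \<notin> X \<and> fst (\<rho> (\<rho> h)) \<notin> X" if "fst h \<in> X"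
        using uniq[OF h refl that rotation_in(1)[OF h] vert_of_rotation(1)[OF h]]
          uniq[OF h refl that rotation_in(2)[OF h] vert_of_rotation(2)[OF h]]
          rotation_distinct[OF h] by blast
      ultimately show "(fst h \<in> X \<or> fst (\<rho> h) \<in> X \<or> fst (\<rho> (\<rho> h)) \<in> X) \<and>
            (fst h \<in> X \<longrightarrow> fst (\<rho> h) \<notin> X \<and> fst (\<rho> (\<rho> h)) \<notin> X)" by blast
    qed
  next
    assume R: ?R
    show "\<forall>v\<in>verts G. \<exists>!h. h \<in> H \<and> vert_of G h = v \<and> fst h \<in> X"
    proof
      fix v assume "v \<in> verts G"
      then obtain h where h: "h \<in> H" "vert_of G h = v" using half_edge_at_exists by blast
      have "\<exists>k\<in>H. vert_of G k = v \<and> fst k \<in> X"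
      proof -
        have "fst h \<in> X \<or> fst (\<rho> h) \<in> X \<or> fst (\<rho> (\<rho> h)) \<in> X" using R h(1) by blast
        moreover have "vert_of G (\<rho> h) = v" "vert_of G (\<rho> (\<rho> h)) = v"
          using vert_of_rotation[OF h(1)] h(2) by auto
        ultimately show ?thesis using h rotation_in[OF h(1)] by metis
      qed
      moreover have "k' = k" if k: "k \<in> H" "vert_of G k = v" "fst k \<in> X"
        "k' \<in> H" "vert_of G k' = v" "fst k' \<in> X" for k k'
      proof -
        have "fst (\<rho> k) \<notin> X \<and> fst (\<rho> (\<rho> k)) \<notin> X" using R k(1,3) by blast
        then show ?thesis using same_vert_cases[OF k(1) k(4)] k(2,5,6) by metis
      qed
      ultimately show "\<exists>!h. h \<in> H \<and> vert_of G h = v \<and> fst h \<in> X" by blast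
    qed
  qed
  then show ?thesis by (simp only: one_factor_def)
qed

lemma perfect_matching_one_factor: "perfect_matching G M \<Longrightarrow> one_factor M"
  unfolding one_factor_def
proof (intro conjI ballI)
  assume M: "perfect_matching G M"
  then show sub: "M \<subseteq> edges G" by (simp add: perfect_matching_def)
  fix v assume v: "v \<in> verts G"
  then obtain e where e: "e \<in> M" "v \<in> ends G e"
    and uniq: "\<And>e'. e' \<in> M \<Longrightarrow> v \<in> ends G e' \<Longrightarrow> e' = e"
    using M unfolding perfect_matching_def by blast
  have ends: "ends G e' = {source G e', target G e'}" if "e' \<in> M" for e'
    using that sub by (auto simp: ends_def)
  have loop: "source G e \<noteq> target G e" using M e(1) by (simp add: perfect_matching_def)
  define b where "b = (v = target G e)"
  have vb: "vert_of G (e, b) = v" using e ends[OF e(1)] by (auto simp: b_def)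
  show "\<exists>!h. h \<in> H \<and> vert_of G h = v \<and> fst h \<in> M"
  proof (rule ex1I[of _ "(e, b)"])
    show "(e, b) \<in> H \<and> vert_of G (e, b) = v \<and> fst (e, b) \<in> M" using vb e sub by auto
    fix h assume h: "h \<in> H \<and> vert_of G h = v \<and> fst h \<in> M"
    obtain e' b' where hb: "h = (e', b')" by (cases h)
    then have "v \<in> ends G e'" using h ends[of e'] by (auto split: if_splits)
    then have "e' = e" using uniq h hb by auto
    then show "h = (e, b)" using h hb loop by (auto simp: b_def split: if_splits)
  qed
qed

lemma one_factor_perfect_matching: "one_factor M \<Longrightarrow> perfect_matching G M"
  unfolding perfect_matching_def
proof (intro conjI ballI)
  assume M: "one_factor M"
  then show sub: "M \<subseteq> edges G" by (simp add: one_factor_def)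
  have uniq: "h = k" if "h \<in> H" "k \<in> H" "vert_of G h = vert_of G k" "fst h \<in> M" "fst k \<in> M" for h k
  proof -
    have "\<exists>!l. l \<in> H \<and> vert_of G l = vert_of G k \<and> fst l \<in> M"
      using M vert_of_in_verts[OF that(2)] by (simp add: one_factor_def)
    then show ?thesis using that by blast
  qed
  show "source G e \<noteq> target G e" if "e \<in> M" for e
    using uniq[of "(e, False)" "(e, True)"] that sub by auto
  fix v assume "v \<in> verts G"
  then obtain h where h: "h \<in> H" "vert_of G h = v" "fst h \<in> M"
    using M unfolding one_factor_def by blast
  show "\<exists>!e. e \<in> M \<and> v \<in> ends G e"
  proof (rule ex1I[of _ "fst h"])
    show "fst h \<in> M \<and> v \<in> ends G (fst h)"
      using h sub by (cases h) (auto simp: ends_def)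
    fix e assume e: "e \<in> M \<and> v \<in> ends G e"
    then have "vert_of G (e, False) = v \<or> vert_of G (e, True) = v"
      using sub by (auto simp: ends_def split: if_splits)
    then obtain b where "vert_of G (e, b) = v" by blast
    then show "e = fst h" using uniq[of "(e, b)" h] h e sub by auto
  qed
qed

lemma one_factor_bij: assumes "one_factor X" shows "bij_betw (vert_of G) (X \<times> UNIV) (verts G)"
  unfolding bij_betw_def
proof
  have XH: "h \<in> X \<times> UNIV \<longleftrightarrow> h \<in> H \<and> fst h \<in> X" for h
    using assms by (auto simp: one_factor_def)
  have ex: "\<exists>!h. h \<in> H \<and> vert_of G h = v \<and> fst h \<in> X" if "v \<in> verts G" for v
    using assms that by (simp add: one_factor_def)
  show "inj_on (vert_of G) (X \<times> UNIV)"
  proof (rule inj_onI)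
    fix h k assume hk: "h \<in> X \<times> UNIV" "k \<in> X \<times> UNIV" "vert_of G h = vert_of G k"
    then have hk': "h \<in> H" "fst h \<in> X" "k \<in> H" "fst k \<in> X" by (simp_all add: XH)
    then show "h = k" using ex[OF vert_of_in_verts[OF hk'(3)]] hk(3) by blast
  qed
  show "vert_of G ` (X \<times> UNIV) = verts G"
  proof (intro equalityI subsetI)
    fix v assume "v \<in> verts G"
    then obtain h where "h \<in> H" "vert_of G h = v" "fst h \<in> X" using ex by blast
    then show "v \<in> vert_of G ` (X \<times> UNIV)" using XH by blast
  qed (use XH vert_of_in_verts in blast)
qed

text \<open>The half-edges of a perfect matching enumerate the vertices, so a product over vertices
  can be distributed over the edges of any perfect matching. Passing from one matching to another in
  this way is the core of \<open>prod_vertex_sign\<close>.\<close>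

lemma prod_one_factor:
  assumes "one_factor X"
  shows "(\<Prod>v\<in>verts G. F v :: int) = (\<Prod>e\<in>X. F (source G e) * F (target G e))"
proof -
  have "(\<Prod>v\<in>verts G. F v) = (\<Prod>h\<in>X \<times> UNIV. F (vert_of G h))"
    using prod.reindex_bij_betw[OF one_factor_bij[OF assms], of F] by simp
  also have "\<dots> = (\<Prod>e\<in>X. \<Prod>b\<in>UNIV. F (vert_of G (e, b)))"
    by (simp add: prod.cartesian_product case_prod_beta' del: vert_of.simps)
  finally show ?thesis by (simp add: UNIV_bool mult.commute)
qed

lemma card_one_factor: assumes "one_factor X" shows "card (verts G) = 2 * card X"
  using bij_betw_same_card[OF one_factor_bij[OF assms]] by (simp add: card_cartesian_product)

lemma tait_colorings_iff:
  "c \<in> tait_colorings G \<longleftrightarrow> c \<in> edges G \<rightarrow>\<^sub>E {0, 1, 2} \<and>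
     (\<forall>h\<in>H. c (fst h) \<noteq> c (fst (\<rho> h)) \<and> c (fst h) \<noteq> c (fst (\<rho> (\<rho> h))) \<and>
            c (fst (\<rho> h)) \<noteq> c (fst (\<rho> (\<rho> h))))"
proof -
  have *: "inj_on (c \<circ> fst) (half_edges_at G (vert_of G h)) \<longleftrightarrow> c (fst h) \<noteq> c (fst (\<rho> h)) \<and>
      c (fst h) \<noteq> c (fst (\<rho> (\<rho> h))) \<and> c (fst (\<rho> h)) \<noteq> c (fst (\<rho> (\<rho> h)))" if "h \<in> H" for h
    unfolding half_edges_at_vert_of[OF that] using rotation_distinct[OF that]
    by (simp add: inj_on_def) metis
  have "(\<forall>v\<in>verts G. inj_on (c \<circ> fst) (half_edges_at G v)) \<longleftrightarrow>
    (\<forall>h\<in>H. inj_on (c \<circ> fst) (half_edges_at G (vert_of G h)))"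
    using vert_of_in_verts half_edge_at_exists by metis
  then show ?thesis unfolding tait_colorings_def by (simp only: mem_Collect_eq * cong: ball_cong)
qed

lemma tait_color_class_one_factor:
  assumes c: "c \<in> tait_colorings G" and "i \<in> {0, 1, 2}"
  shows "one_factor {e \<in> edges G. c e = i}"
proof -
  have col: "c e \<in> {0, 1, 2}" if "e \<in> edges G" for e
    using tait_color_range[OF c that] .
  show ?thesis
    unfolding one_factor_iff
  proof (intro conjI ballI)
    fix h assume h: "h \<in> H"
    have d: "c (fst h) \<noteq> c (fst (\<rho> h))" "c (fst h) \<noteq> c (fst (\<rho> (\<rho> h)))" "c (fst (\<rho> h)) \<noteq> c (fst (\<rho> (\<rho> h)))"
      using c h unfolding tait_colorings_iff by blast+
    have in_edges: "fst h \<in> edges G" "fst (\<rho> h) \<in> edges G" "fst (\<rho> (\<rho> h)) \<in> edges G"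
      using h fst_rotation_in[OF h] by (auto simp: mem_Times_iff)
    show "fst h \<in> {e \<in> edges G. c e = i} \<or> fst (\<rho> h) \<in> {e \<in> edges G. c e = i} \<or>
        fst (\<rho> (\<rho> h)) \<in> {e \<in> edges G. c e = i}"
      using in_edges col[OF in_edges(1)] col[OF in_edges(2)] col[OF in_edges(3)] d assms(2) by auto
    show "fst h \<in> {e \<in> edges G. c e = i} \<longrightarrow> fst (\<rho> h) \<notin> {e \<in> edges G. c e = i} \<and>
        fst (\<rho> (\<rho> h)) \<notin> {e \<in> edges G. c e = i}"
      using d by auto
  qed auto
qed

lemma even_subgraph_complement: "one_factor M \<Longrightarrow> even_subgraph G (edges G - M)"
  unfolding even_subgraph_iff
proof (intro conjI ballI)
  fix h assume M: "one_factor M" and h: "h \<in> H"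
  have "fst h \<in> edges G" "fst (\<rho> h) \<in> edges G" "fst (\<rho> (\<rho> h)) \<in> edges G"
    using h fst_rotation_in[OF h] by (auto simp: mem_Times_iff)
  moreover have "(fst k \<in> M \<or> fst (\<rho> k) \<in> M \<or> fst (\<rho> (\<rho> k)) \<in> M) \<and>
            (fst k \<in> M \<longrightarrow> fst (\<rho> k) \<notin> M \<and> fst (\<rho> (\<rho> k)) \<notin> M)" if "k \<in> H" for k
    using M that unfolding one_factor_iff by blast
  note this[OF h] this[OF rotation_in(1)[OF h]]
  ultimately show "(fst h \<in> edges G - M) = ((fst (\<rho> h) \<in> edges G - M) \<noteq> (fst (\<rho> (\<rho> h)) \<in> edges G - M))"
    using rotation_cubed[OF h] by auto
qed auto

text \<open>Penrose's sign: 1 if the colors 0, 1, 2 follow each other counterclockwise, -1 if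
  clockwise. It is attached to a half-edge, but for a Tait coloring it depends only on the vertex
  (\<open>vertex_sign_vert\<close>).\<close>

definition vertex_sign :: "('e \<Rightarrow> nat) \<Rightarrow> 'e \<times> bool \<Rightarrow> int" where
  "vertex_sign c h = (if c (fst (\<rho> h)) = (c (fst h) + 1) mod 3 then 1 else - 1)"

lemma tait_colors_at:
  assumes c: "c \<in> tait_colorings G" and h: "h \<in> H"
  obtains i where "i \<in> {0, 1, 2}" "c (fst h) = i" "vertex_sign c h = 1"
      "c (fst (\<rho> h)) = (i + 1) mod 3" "c (fst (\<rho> (\<rho> h))) = (i + 2) mod 3"
  | i where "i \<in> {0, 1, 2}" "c (fst h) = i" "vertex_sign c h = - 1"
      "c (fst (\<rho> h)) = (i + 2) mod 3" "c (fst (\<rho> (\<rho> h))) = (i + 1) mod 3"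
proof -
  have d: "c (fst h) \<noteq> c (fst (\<rho> h))" "c (fst h) \<noteq> c (fst (\<rho> (\<rho> h)))" "c (fst (\<rho> h)) \<noteq> c (fst (\<rho> (\<rho> h)))"
    using c h unfolding tait_colorings_iff by blast+
  have in_edges: "fst h \<in> edges G" "fst (\<rho> h) \<in> edges G" "fst (\<rho> (\<rho> h)) \<in> edges G"
    using h fst_rotation_in[OF h] by (auto simp: mem_Times_iff)
  have col: "c e \<in> {0, 1, 2}" if "e \<in> edges G" for e
    using tait_color_range[OF c that] .
  note cc = col[OF in_edges(1)] col[OF in_edges(2)] col[OF in_edges(3)]
  define i j k where "i = c (fst h)" "j = c (fst (\<rho> h))" "k = c (fst (\<rho> (\<rho> h)))"
  have ijk: "i \<in> {0, 1, 2}" "j \<in> {0, 1, 2}" "k \<in> {0, 1, 2}" "i \<noteq> j" "i \<noteq> k" "j \<noteq> k"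
    using d cc by (simp_all add: i_j_k_def)
  have "\<forall>i\<in>{0, 1, 2::nat}. \<forall>j\<in>{0, 1, 2}. \<forall>k\<in>{0, 1, 2}. i \<noteq> j \<longrightarrow> i \<noteq> k \<longrightarrow> j \<noteq> k \<longrightarrow>
     (if j = (i + 1) mod 3 then k = (i + 2) mod 3 else j = (i + 2) mod 3 \<and> k = (i + 1) mod 3)"
    by simp
  then have jk: "if j = (i + 1) mod 3 then k = (i + 2) mod 3
      else j = (i + 2) mod 3 \<and> k = (i + 1) mod 3" using ijk by blast
  show thesis
  proof (cases "j = (i + 1) mod 3")
    case True
    show thesis
      by (rule that(1)[of i]) (use True jk ijk(1) in \<open>simp_all add: vertex_sign_def i_j_k_def\<close>)
  next
    case False
    show thesis
      by (rule that(2)[of i]) (use False jk ijk(1) in \<open>simp_all add: vertex_sign_def i_j_k_def\<close>)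
  qed
qed

lemma vertex_sign_vert:
  assumes c: "c \<in> tait_colorings G"
  obtains \<epsilon> where "\<And>h. h \<in> H \<Longrightarrow> vertex_sign c h = \<epsilon> (vert_of G h)"
proof -
  have rot: "vertex_sign c (\<rho> h) = vertex_sign c h" if h: "h \<in> H" for h
  proof (cases rule: tait_colors_at[OF c h])
    case (1 i) then show ?thesis by (auto simp: vertex_sign_def)
  next
    case (2 i) then show ?thesis by (auto simp: vertex_sign_def)
  qed
  have "vertex_sign c (SOME k. k \<in> H \<and> vert_of G k = vert_of G h) = vertex_sign c h" if h: "h \<in> H" for h
  proof -
    define k where "k = (SOME k. k \<in> H \<and> vert_of G k = vert_of G h)"
    have "k \<in> H \<and> vert_of G k = vert_of G h" unfolding k_def by (rule someI[of _ h]) (use h in simp)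
    then have "k = h \<or> k = \<rho> h \<or> k = \<rho> (\<rho> h)" using same_vert_cases[OF h] by blast
    then show ?thesis using rot[OF h] rot[OF rotation_in(1)[OF h]] by (auto simp: k_def[symmetric])
  qed
  then show thesis by (intro that[of "\<lambda>v. vertex_sign c (SOME k. k \<in> H \<and> vert_of G k = v)"]) simp
qed

end

context planar_rotation
begin

text \<open>By \<open>eq\<close> the product is the same for all perfect matchings, so it may be
  computed for the edges of color 0. Take a face coloring of the cycles colored 0 and 1; it has a
  single value on both sides of the color-2 half-edge at each vertex. The color-2 half-edges at the
  two ends of a color-0 edge are on the same side of it iff the vertex signs differ, and its two
  sides have different face colors, so each factor is a product of two face signs. Regrouped along
  the edges of color 2, where both ends see the same face color, everything cancels.\<close>

lemma prod_vertex_sign: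
  assumes c: "c \<in> tait_colorings G" and M: "one_factor M"
  shows "(\<Prod>e\<in>M. - (vertex_sign c (e, False) * vertex_sign c (e, True))) = 1"
proof -
  obtain \<epsilon> where \<epsilon>: "\<And>h. h \<in> H \<Longrightarrow> vertex_sign c h = \<epsilon> (vert_of G h)"
    using vertex_sign_vert[OF c] by blast
  have eq: "(\<Prod>e\<in>X. - (vertex_sign c (e, False) * vertex_sign c (e, True))) =
      (-1) ^ (card (verts G) div 2) * (\<Prod>v\<in>verts G. \<epsilon> v)" if X: "one_factor X" for X
  proof -
    have sub: "X \<subseteq> edges G" using X by (simp add: one_factor_def)
    have "(\<Prod>e\<in>X. - (vertex_sign c (e, False) * vertex_sign c (e, True))) =
        (\<Prod>e\<in>X. (- 1) * (\<epsilon> (source G e) * \<epsilon> (target G e)))"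
      by (rule prod.cong) (use \<epsilon> sub in auto)
    also have "\<dots> = (\<Prod>e\<in>X. - 1) * (\<Prod>v\<in>verts G. \<epsilon> v)"
      unfolding prod_one_factor[OF X] by (rule prod.distrib)
    finally show ?thesis by (simp add: card_one_factor[OF X])
  qed
  define K where "K i = {e \<in> edges G. c e = i}" for i
  have K: "one_factor (K i)" if "i \<in> {0, 1, 2}" for i
    unfolding K_def using tait_color_class_one_factor[OF c that] .
  have col: "c e \<in> {0, 1, 2}" if "e \<in> edges G" for e
    using tait_color_range[OF c that] .
  obtain f where f: "face_coloring G \<rho> (edges G - K 2) f"
    using face_coloring_exists[OF even_subgraph_complement[OF K[of 2]]] by auto
  have f1: "f h = f (\<rho> (\<rho> h)) \<longleftrightarrow> c (fst h) = 2" if "h \<in> H" for h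
  proof -
    have "(f h \<noteq> f (\<rho> (\<rho> h))) = (fst h \<in> edges G - K 2)"
      using f that unfolding face_coloring_def by blast
    then show ?thesis using that by (auto simp: K_def)
  qed
  have f2: "f (e, False) = f (\<rho> (\<rho> (e, True)))" "f (e, True) = f (\<rho> (\<rho> (e, False)))" if "e \<in> edges G" for e
    using f that by (auto simp: face_coloring_def)
  define g where "g h = (if f h then - 1 else 1 :: int)" for h
  define k where "k v = (THE h. h \<in> H \<and> vert_of G h = v \<and> fst h \<in> K 2)" for v
  have k: "k (vert_of G h) = h" if "h \<in> H" "c (fst h) = 2" for h
    unfolding k_def
  proof (rule the1_equality)
    show "\<exists>!k. k \<in> H \<and> vert_of G k = vert_of G h \<and> fst k \<in> K 2"
      using K[of 2] vert_of_in_verts[OF that(1)] by (simp add: one_factor_def)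
    show "h \<in> H \<and> vert_of G h = vert_of G h \<and> fst h \<in> K 2"
      using that by (auto simp: K_def)
  qed
  \<comment> \<open>Seen from the vertex, the color-2 half-edge is to the right of the color-0
    half-edge \<open>h\<close> for sign 1, where the adjacent corner is
    \<open>\<rho> (\<rho> h)\<close>, and to the left for sign -1, where it is
    \<open>h\<close>.\<close>
  have gk: "g (k (vert_of G h)) = (if vertex_sign c h = 1 then g (\<rho> (\<rho> h)) else g h)"
    if h: "h \<in> H" and c0: "c (fst h) = 0" for h
  proof (cases rule: tait_colors_at[OF c h])
    case (1 i)
    then have "c (fst (\<rho> (\<rho> h))) = 2" using c0 by simp
    then show ?thesis using k[OF rotation_in(2)[OF h]] vert_of_rotation[OF h] 1 by simp
  next
    case (2 i)
    then have c2: "c (fst (\<rho> h)) = 2" using c0 by simp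
    then have "f (\<rho> h) = f h" using f1[OF rotation_in(1)[OF h]] rotation_cubed[OF h] by simp
    then show ?thesis using k[OF rotation_in(1)[OF h] c2] vert_of_rotation[OF h] 2 by (simp add: g_def)
  qed
  have vs: "vertex_sign c h = 1 \<or> vertex_sign c h = - 1" for h by (simp add: vertex_sign_def)
  have "(\<Prod>e\<in>K 0. - (vertex_sign c (e, False) * vertex_sign c (e, True))) =
     (\<Prod>e\<in>K 0. g (k (source G e)) * g (k (target G e)))"
  proof (rule prod.cong)
    fix e assume "e \<in> K 0"
    then have e: "e \<in> edges G" "c e = 0" by (auto simp: K_def)
    have e': "(e, b) \<in> H" for b using e by simp
    show "- (vertex_sign c (e, False) * vertex_sign c (e, True)) = g (k (source G e)) * g (k (target G e))"
      using gk[OF e', of False] gk[OF e', of True] f1[OF e', of False] f1[OF e', of True] f2[OF e(1)] e(2)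
        vs[of "(e, False)"] vs[of "(e, True)"] by (auto simp: g_def split: if_splits)
  qed simp
  also have "\<dots> = (\<Prod>v\<in>verts G. g (k v))" by (rule prod_one_factor[OF K, symmetric]) simp
  also have "\<dots> = (\<Prod>e\<in>K 2. g (k (source G e)) * g (k (target G e)))"
    by (rule prod_one_factor[OF K]) simp
  also have "\<dots> = 1"
  proof (rule prod.neutral, rule ballI)
    fix e assume "e \<in> K 2"
    then have e: "e \<in> edges G" "c e = 2" by (auto simp: K_def)
    have e': "(e, b) \<in> H" for b using e by simp
    have "k (source G e) = (e, False)" "k (target G e) = (e, True)"
      using k[OF e', of False] k[OF e', of True] e(2) by auto
    moreover have "f (e, False) = f (e, True)" using f1[OF e', of False] f2[OF e(1)] e(2) by auto
    ultimately show "g (k (source G e)) * g (k (target G e)) = 1" by (simp add: g_def)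
  qed
  finally show ?thesis using eq[OF M] eq[OF K[of 0]] by simp
qed

text \<open>The three-colorings of the circles of a state are edge colorings off \<open>M\<close>
  satisfying \<open>Z0\<close> or \<open>Z1\<close> at each matching edge, according to its
  smoothing. After exchanging the sums, the signed sum over the smoothings factors into the terms
  \<open>Z0\<close> minus \<open>Z1\<close>. A term is nonzero only if exactly one of the two holds.
  Then two different colors meet at the edge, the third color can be put on it, and the term is
  minus the product of the signs of its ends.\<close>

lemma penrose_state_sum:
  assumes M: "perfect_matching G M"
  shows "(\<Sum>A\<in>Pow M. (-1) ^ card A * 3 ^ state_circles G \<rho> M A) =
     int (card (tait_colorings G)) * 3 ^ card (circles G)"
proof -
  have M': "one_factor M" using perfect_matching_one_factor[OF M] .
  then have sub: "M \<subseteq> edges G" by (simp add: one_factor_def)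
  have finM: "finite M" using finite_subset[OF sub finite_edges] .
  have Mrot: "fst (\<rho> h) \<notin> M" "fst (\<rho> (\<rho> h)) \<notin> M" if "h \<in> H" "fst h \<in> M" for h
    using M' that unfolding one_factor_iff by blast+
  define S where "S = (edges G - M) \<times> (UNIV :: bool set)"
  have Sin: "\<rho> (e, b) \<in> S" "\<rho> (\<rho> (e, b)) \<in> S" if "e \<in> M" for e b
    using Mrot[of "(e, b)"] rotation_in[of "(e, b)"] that sub by (auto simp: S_def mem_Times_iff)
  define Z0 where "Z0 \<phi> e \<longleftrightarrow> \<phi> (fst (\<rho> (e, False))) = \<phi> (fst (\<rho> (\<rho> (e, True)))) \<and>
      \<phi> (fst (\<rho> (\<rho> (e, False)))) = \<phi> (fst (\<rho> (e, True)))" for \<phi> :: "_ \<Rightarrow> nat" and e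
  define Z1 where "Z1 \<phi> e \<longleftrightarrow> \<phi> (fst (\<rho> (e, False))) = \<phi> (fst (\<rho> (e, True))) \<and>
      \<phi> (fst (\<rho> (\<rho> (e, False)))) = \<phi> (fst (\<rho> (\<rho> (e, True))))" for \<phi> :: "_ \<Rightarrow> nat" and e
  define P where "P = (edges G - M) \<rightarrow>\<^sub>E {0, 1, 2::nat}"
  have finP: "finite P" unfolding P_def using finite_edges by (intro finite_PiE) auto
  define ok where "ok A \<phi> \<longleftrightarrow> (\<forall>e\<in>A. Z1 \<phi> e) \<and> (\<forall>e\<in>M - A. Z0 \<phi> e)" for A \<phi>
  have count: "(3::int) ^ state_circles G \<rho> M A = 3 ^ card (circles G) * (\<Sum>\<phi>\<in>P. of_bool (ok A \<phi>))"
    if A: "A \<subseteq> M" for A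
  proof -
    define J where "J = joins G \<rho> M A"
    have EM: "edges G \<inter> M = M" using sub by blast
    have JS: "J \<subseteq> S \<times> S"
      unfolding J_def joins_def EM smoothing0_def smoothing1_def
    proof (rule Un_least)
      show "{((e, False), (e, True)) | e. e \<in> edges G - M} \<subseteq> S \<times> S" by (auto simp: S_def)
    qed (use Sin in \<open>auto split: if_splits\<close>)
    have "finite S" using finite_edges by (simp add: S_def)
    note cls = card_functions_constant_on_classes[OF this JS, of "{0, 1, 2::nat}"]
    define P' where "P' = {f \<in> S \<rightarrow>\<^sub>E {0, 1, 2::nat}. \<forall>(a, b)\<in>J. f a = f b}"
    have Jiff: "(\<forall>(a, b)\<in>J. f a = f b) \<longleftrightarrow> (\<forall>e\<in>edges G - M. f (e, False) = f (e, True)) \<and>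
       (\<forall>e\<in>M. if e \<in> A then f (\<rho> (e, False)) = f (\<rho> (e, True)) \<and> f (\<rho> (\<rho> (e, False))) = f (\<rho> (\<rho> (e, True)))
         else f (\<rho> (e, False)) = f (\<rho> (\<rho> (e, True))) \<and> f (\<rho> (\<rho> (e, False))) = f (\<rho> (e, True)))"
      for f :: "_ \<Rightarrow> nat"
    proof -
      let ?P = "\<lambda>(a, b). f a = f b"
      define J1 where "J1 = (\<lambda>e. ((e, False), (e, True))) ` (edges G - M)"
      define J2 where "J2 e = (if e \<in> A then smoothing1 \<rho> e else smoothing0 \<rho> e)" for e
      have "J = J1 \<union> (\<Union>e\<in>M. J2 e)"
        unfolding J_def joins_def EM J1_def J2_def setcompr_eq_image Collect_mem_eq ..
      then have "Ball J ?P \<longleftrightarrow> Ball J1 ?P \<and> (\<forall>e\<in>M. Ball (J2 e) ?P)" by blast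
      moreover have "Ball J1 ?P \<longleftrightarrow> (\<forall>e\<in>edges G - M. f (e, False) = f (e, True))"
        unfolding J1_def by simp
      moreover have "Ball (J2 e) ?P \<longleftrightarrow>
        (if e \<in> A then f (\<rho> (e, False)) = f (\<rho> (e, True)) \<and> f (\<rho> (\<rho> (e, False))) = f (\<rho> (\<rho> (e, True)))
         else f (\<rho> (e, False)) = f (\<rho> (\<rho> (e, True))) \<and> f (\<rho> (\<rho> (e, False))) = f (\<rho> (e, True)))" for e
        by (simp add: J2_def smoothing0_def smoothing1_def)
      ultimately show ?thesis by simp
    qed
    have "bij_betw (\<lambda>\<phi>. \<lambda>h\<in>S. \<phi> (fst h)) {\<phi> \<in> P. ok A \<phi>} P'"
    proof (rule bij_betw_byWitness[where f' = "\<lambda>f. \<lambda>e\<in>edges G - M. f (e, False)"])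
      show "\<forall>\<phi>\<in>{\<phi> \<in> P. ok A \<phi>}. (\<lambda>e\<in>edges G - M. (\<lambda>h\<in>S. \<phi> (fst h)) (e, False)) = \<phi>"
      proof
        fix \<phi> assume \<phi>: "\<phi> \<in> {\<phi> \<in> P. ok A \<phi>}"
        show "(\<lambda>e\<in>edges G - M. (\<lambda>h\<in>S. \<phi> (fst h)) (e, False)) = \<phi>"
        proof
          fix e
          show "(\<lambda>e\<in>edges G - M. (\<lambda>h\<in>S. \<phi> (fst h)) (e, False)) e = \<phi> e"
            using \<phi> PiE_arb[of \<phi> "edges G - M" "\<lambda>_. {0, 1, 2}" e]
            by (cases "e \<in> edges G - M") (auto simp: P_def S_def)
        qed
      qed
      show "\<forall>f\<in>P'. (\<lambda>h\<in>S. (\<lambda>e\<in>edges G - M. f (e, False)) (fst h)) = f"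
      proof
        fix f assume f: "f \<in> P'"
        then have fJ: "\<forall>e\<in>edges G - M. f (e, False) = f (e, True)" and fE: "f \<in> S \<rightarrow>\<^sub>E {0, 1, 2}"
          using Jiff[of f] unfolding P'_def by blast+
        show "(\<lambda>h\<in>S. (\<lambda>e\<in>edges G - M. f (e, False)) (fst h)) = f"
        proof
          fix h
          show "(\<lambda>h\<in>S. (\<lambda>e\<in>edges G - M. f (e, False)) (fst h)) h = f h"
          proof (cases "h \<in> S")
            case True
            then show ?thesis using fJ by (cases h; cases "snd h") (auto simp: S_def)
          next
            case False
            then show ?thesis using PiE_arb[OF fE False] by simp
          qed
        qed
      qed
      show "(\<lambda>\<phi>. \<lambda>h\<in>S. \<phi> (fst h)) ` {\<phi> \<in> P. ok A \<phi>} \<subseteq> P'"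
      proof (rule image_subsetI)
        fix \<phi> assume \<phi>: "\<phi> \<in> {\<phi> \<in> P. ok A \<phi>}"
        define f where "f = (\<lambda>h\<in>S. \<phi> (fst h))"
        have fS: "f h = \<phi> (fst h)" if "h \<in> S" for h using that by (simp add: f_def)
        have "\<phi> e \<in> {0, 1, 2}" if "e \<in> edges G - M" for e
          using \<phi> that unfolding P_def by (blast dest: PiE_mem)
        then have "f \<in> S \<rightarrow>\<^sub>E {0, 1, 2}"
          unfolding f_def by (simp add: S_def mem_Times_iff)
        moreover have "f (e, False) = f (e, True)" if "e \<in> edges G - M" for e
          using that by (simp add: f_def S_def)
        moreover have "if e \<in> A then f (\<rho> (e, False)) = f (\<rho> (e, True)) \<and> f (\<rho> (\<rho> (e, False))) = f (\<rho> (\<rho> (e, True)))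
         else f (\<rho> (e, False)) = f (\<rho> (\<rho> (e, True))) \<and> f (\<rho> (\<rho> (e, False))) = f (\<rho> (e, True))" if e: "e \<in> M" for e
          unfolding fS[OF Sin(1)[OF e]] fS[OF Sin(2)[OF e]] using \<phi> e unfolding ok_def Z0_def Z1_def by auto
        ultimately show "(\<lambda>h\<in>S. \<phi> (fst h)) \<in> P'" unfolding f_def[symmetric] P'_def Jiff by blast
      qed
      show "(\<lambda>f. \<lambda>e\<in>edges G - M. f (e, False)) ` P' \<subseteq> {\<phi> \<in> P. ok A \<phi>}"
      proof (rule image_subsetI)
        fix f assume "f \<in> P'"
        then have f1: "\<forall>e\<in>edges G - M. f (e, False) = f (e, True)"
          and f2: "\<forall>e\<in>M. if e \<in> A then f (\<rho> (e, False)) = f (\<rho> (e, True)) \<and> f (\<rho> (\<rho> (e, False))) = f (\<rho> (\<rho> (e, True)))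
           else f (\<rho> (e, False)) = f (\<rho> (\<rho> (e, True))) \<and> f (\<rho> (\<rho> (e, False))) = f (\<rho> (e, True))"
          and fE: "f \<in> S \<rightarrow>\<^sub>E {0, 1, 2}"
          using Jiff[of f] unfolding P'_def by blast+
        define \<phi> where "\<phi> = (\<lambda>e\<in>edges G - M. f (e, False))"
        have \<phi>f: "\<phi> (fst h) = f h" if "h \<in> S" for h
          using that f1 by (cases h; cases "snd h") (auto simp: \<phi>_def S_def)
        have "if e \<in> A then Z1 \<phi> e else Z0 \<phi> e" if e: "e \<in> M" for e
          unfolding Z0_def Z1_def \<phi>f[OF Sin(1)[OF e]] \<phi>f[OF Sin(2)[OF e]] using f2 e by blast
        then have "ok A \<phi>" unfolding ok_def using A by (metis DiffE subsetD)
        moreover have "f (e, False) \<in> {0, 1, 2}" if "e \<in> edges G - M" for e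
          using PiE_mem[OF fE, of "(e, False)"] that by (simp add: S_def)
        then have "\<phi> \<in> P" unfolding \<phi>_def P_def by simp
        ultimately show "(\<lambda>e\<in>edges G - M. f (e, False)) \<in> {\<phi> \<in> P. ok A \<phi>}"
          unfolding \<phi>_def by blast
      qed
    qed
    then have "card {\<phi> \<in> P. ok A \<phi>} = card P'" by (rule bij_betw_same_card)
    moreover have "(\<Sum>\<phi>\<in>P. of_bool (ok A \<phi>)) = int (card {\<phi> \<in> P. ok A \<phi>})"
      using finP by (simp add: Collect_conj_eq)
    ultimately have "int (card P') = (\<Sum>\<phi>\<in>P. of_bool (ok A \<phi>))" by simp
    moreover have "circles G \<inter> M = {}" "circles G - M = circles G"
      using sub finite_mgraph by (auto simp: finite_mgraph_def)
    moreover have "card P' = 3 ^ card (S // (J \<union> J\<inverse>)\<^sup>*)" unfolding P'_def cls by (simp add: numeral_3_eq_3)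
    ultimately show ?thesis
      unfolding state_circles_def by (simp add: power_add S_def J_def mult.commute)
  qed
  have sign: "(-1) ^ card A * of_bool (ok A \<phi>) =
      (\<Prod>e\<in>A. - of_bool (Z1 \<phi> e)) * (\<Prod>e\<in>M - A. of_bool (Z0 \<phi> e) :: int)" if "A \<subseteq> M" for A \<phi>
    using finite_subset[OF that finM] finM by (simp add: prod_neg_of_bool prod_of_bool ok_def)
  note [simp del] = sum_of_bool_eq sum_mult_of_bool_eq sum_of_bool_mult_eq
  have "(\<Sum>A\<in>Pow M. (-1) ^ card A * 3 ^ state_circles G \<rho> M A :: int) =
     (\<Sum>A\<in>Pow M. \<Sum>\<phi>\<in>P. 3 ^ card (circles G) * ((-1) ^ card A * of_bool (ok A \<phi>)))"
  proof (rule sum.cong)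
    fix A assume A: "A \<in> Pow M"
    show "(-1) ^ card A * 3 ^ state_circles G \<rho> M A =
       (\<Sum>\<phi>\<in>P. 3 ^ card (circles G) * ((-1) ^ card A * of_bool (ok A \<phi>)) :: int)"
      unfolding sum_distrib_left[symmetric] using count[of A] A by (simp add: mult.left_commute)
  qed simp
  also have "\<dots> = (\<Sum>\<phi>\<in>P. \<Sum>A\<in>Pow M. 3 ^ card (circles G) * ((-1) ^ card A * of_bool (ok A \<phi>)))"
    by (rule sum.swap)
  also have "\<dots> = 3 ^ card (circles G) * (\<Sum>\<phi>\<in>P. \<Sum>A\<in>Pow M. (-1) ^ card A * of_bool (ok A \<phi>))"
    by (simp add: sum_distrib_left)
  also have "(\<Sum>\<phi>\<in>P. \<Sum>A\<in>Pow M. (-1) ^ card A * of_bool (ok A \<phi>) :: int) =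
     (\<Sum>\<phi>\<in>P. \<Prod>e\<in>M. - of_bool (Z1 \<phi> e) + of_bool (Z0 \<phi> e))"
    unfolding prod_add[OF finM] by (intro sum.cong refl sign) simp
  also have "\<dots> = (\<Sum>\<phi>\<in>(\<lambda>c. restrict c (edges G - M)) ` tait_colorings G.
        \<Prod>e\<in>M. - of_bool (Z1 \<phi> e) + of_bool (Z0 \<phi> e))"
  proof (rule sum.mono_neutral_right[OF finP])
    show "(\<lambda>c. restrict c (edges G - M)) ` tait_colorings G \<subseteq> P"
    proof (rule image_subsetI)
      fix c assume c: "c \<in> tait_colorings G"
      have "c e \<in> {0, 1, 2}" if "e \<in> edges G - M" for e
        by (rule tait_color_range[OF c]) (use that in simp)
      then show "restrict c (edges G - M) \<in> P" unfolding P_def by simp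
    qed
    show "\<forall>\<phi>\<in>P - (\<lambda>c. restrict c (edges G - M)) ` tait_colorings G.
        (\<Prod>e\<in>M. - of_bool (Z1 \<phi> e) + of_bool (Z0 \<phi> e) :: int) = 0"
    proof
      fix \<phi> assume \<phi>: "\<phi> \<in> P - (\<lambda>c. restrict c (edges G - M)) ` tait_colorings G"
      define x1 x2 y1 y2 where "x1 e = \<phi> (fst (\<rho> (e, False)))" and "x2 e = \<phi> (fst (\<rho> (\<rho> (e, False))))"
        and "y1 e = \<phi> (fst (\<rho> (e, True)))" and "y2 e = \<phi> (fst (\<rho> (\<rho> (e, True))))" for e
      \<comment> \<open>If \<open>x1 e = x2 e\<close>, the two smoothings impose equivalent
        conditions, and if neither condition holds they agree as well; in both cases the factor at
        \<open>e\<close> is 0.\<close>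
      have "\<exists>e\<in>M. \<not> (x1 e \<noteq> x2 e \<and> (Z0 \<phi> e \<or> Z1 \<phi> e))"
      proof (rule ccontr)
        assume "\<not> ?thesis"
        then have ok: "x1 e \<noteq> x2 e" "x1 e = y2 e \<and> x2 e = y1 e \<or> x1 e = y1 e \<and> x2 e = y2 e" if "e \<in> M" for e
          using that unfolding Z0_def Z1_def x1_def x2_def y1_def y2_def by blast+
        \<comment> \<open>The colors 0, 1, 2 add up to 3, so this is the color missing from
          \<open>x1 e\<close> and \<open>x2 e\<close>.\<close>
        define c where "c = (\<lambda>e\<in>edges G. if e \<in> M then 3 - (x1 e + x2 e) else \<phi> e)"
        have r: "restrict c (edges G - M) = \<phi>"
        proof
          fix e show "restrict c (edges G - M) e = \<phi> e"
            using \<phi> PiE_arb[of \<phi> "edges G - M" "\<lambda>_. {0, 1, 2}" e]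
            by (cases "e \<in> edges G - M") (auto simp: P_def c_def)
        qed
        have \<phi>3: "\<phi> e \<in> {0, 1, 2}" if "e \<in> edges G - M" for e
          using \<phi> that unfolding P_def by (blast dest: PiE_mem)
        have xs: "x1 e \<in> {0, 1, 2}" "x2 e \<in> {0, 1, 2}" if "e \<in> M" for e
          using \<phi>3 Sin[OF that, of False] by (auto simp: x1_def x2_def S_def mem_Times_iff)
        have cM: "c (fst h) \<in> {0, 1, 2}" "c (fst h) \<noteq> c (fst (\<rho> h))" "c (fst h) \<noteq> c (fst (\<rho> (\<rho> h)))"
            "c (fst (\<rho> h)) \<noteq> c (fst (\<rho> (\<rho> h)))" if h: "h \<in> H" "fst h \<in> M" for h
        proof -
          obtain e b where hb: "h = (e, b)" by (cases h)
          have e: "e \<in> M" "e \<in> edges G" using h hb sub by auto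
          have c0: "c e = 3 - (x1 e + x2 e)" using e by (simp add: c_def)
          have c1: "c (fst (\<rho> h)) = \<phi> (fst (\<rho> h))" "c (fst (\<rho> (\<rho> h))) = \<phi> (fst (\<rho> (\<rho> h)))"
            using Mrot[OF h] fst_rotation_in[OF h(1)] by (auto simp: c_def)
          then have "c (fst (\<rho> h)) = x1 e \<and> c (fst (\<rho> (\<rho> h))) = x2 e \<or>
             c (fst (\<rho> h)) = x2 e \<and> c (fst (\<rho> (\<rho> h))) = x1 e"
            using ok(2)[OF e(1)] hb by (cases b) (auto simp: x1_def x2_def y1_def y2_def)
          moreover have "3 - (x1 e + x2 e) \<in> {0, 1, 2}" "3 - (x1 e + x2 e) \<noteq> x1 e" "3 - (x1 e + x2 e) \<noteq> x2 e"
            using ok(1)[OF e(1)] xs[OF e(1)] by auto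
          ultimately show "c (fst h) \<in> {0, 1, 2}" "c (fst h) \<noteq> c (fst (\<rho> h))" "c (fst h) \<noteq> c (fst (\<rho> (\<rho> h)))"
            "c (fst (\<rho> h)) \<noteq> c (fst (\<rho> (\<rho> h)))"
            using ok(1)[OF e(1)] c0 hb by auto
        qed
        have "c \<in> tait_colorings G"
          unfolding tait_colorings_iff
        proof (intro conjI ballI)
          show "c \<in> edges G \<rightarrow>\<^sub>E {0, 1, 2}"
          proof (rule PiE_I)
            fix e assume e: "e \<in> edges G"
            show "c e \<in> {0, 1, 2}"
              using cM(1)[of "(e, False)"] \<phi>3[of e] e by (cases "e \<in> M") (auto simp: c_def)
          qed (simp add: c_def)
          fix h assume h: "h \<in> H"
          have "fst h \<in> M \<or> fst (\<rho> h) \<in> M \<or> fst (\<rho> (\<rho> h)) \<in> M"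
            using M' h unfolding one_factor_iff by blast
          then have "c (fst h) \<noteq> c (fst (\<rho> h)) \<and> c (fst h) \<noteq> c (fst (\<rho> (\<rho> h))) \<and>
              c (fst (\<rho> h)) \<noteq> c (fst (\<rho> (\<rho> h)))"
            using cM[OF h] cM[OF rotation_in(1)[OF h]] cM[OF rotation_in(2)[OF h]]
              rotation_cubed[OF h] rotation_cubed[OF rotation_in(1)[OF h]] by auto
          then show "c (fst h) \<noteq> c (fst (\<rho> h))" "c (fst h) \<noteq> c (fst (\<rho> (\<rho> h)))"
              "c (fst (\<rho> h)) \<noteq> c (fst (\<rho> (\<rho> h)))" by blast+
        qed
        then show False using \<phi> r by blast
      qed
      then obtain e where "e \<in> M" "\<not> (x1 e \<noteq> x2 e \<and> (Z0 \<phi> e \<or> Z1 \<phi> e))" by blast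
      then have "e \<in> M" "Z0 \<phi> e = Z1 \<phi> e"
        unfolding Z0_def Z1_def x1_def x2_def by auto
      then show "(\<Prod>e\<in>M. - of_bool (Z1 \<phi> e) + of_bool (Z0 \<phi> e) :: int) = 0"
        using finM by (intro prod_zero bexI[of _ e]) auto
    qed
  qed
  also have "\<dots> = (\<Sum>\<phi>\<in>(\<lambda>c. restrict c (edges G - M)) ` tait_colorings G. 1)"
  proof (rule sum.cong)
    fix \<phi> assume "\<phi> \<in> (\<lambda>c. restrict c (edges G - M)) ` tait_colorings G"
    then obtain c where c: "c \<in> tait_colorings G" "\<phi> = restrict c (edges G - M)" by blast
    have "(\<Prod>e\<in>M. - of_bool (Z1 \<phi> e) + of_bool (Z0 \<phi> e) :: int) =
        (\<Prod>e\<in>M. - (vertex_sign c (e, False) * vertex_sign c (e, True)))"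
    proof (rule prod.cong)
      fix e assume e: "e \<in> M"
      have e': "(e, b) \<in> H" for b using e sub by auto
      have \<phi>c: "\<phi> (fst (\<rho> (e, b))) = c (fst (\<rho> (e, b)))" "\<phi> (fst (\<rho> (\<rho> (e, b)))) = c (fst (\<rho> (\<rho> (e, b))))" for b
        using Sin[OF e, of b] by (auto simp: c(2) S_def mem_Times_iff)
      show "- of_bool (Z1 \<phi> e) + of_bool (Z0 \<phi> e) = - (vertex_sign c (e, False) * vertex_sign c (e, True))"
        unfolding Z0_def Z1_def \<phi>c
        by (rule tait_colors_at[OF c(1) e', of False]; rule tait_colors_at[OF c(1) e', of True]) auto
    qed simp
    then show "(\<Prod>e\<in>M. - of_bool (Z1 \<phi> e) + of_bool (Z0 \<phi> e) :: int) = 1"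
      using prod_vertex_sign[OF c(1) M'] by simp
  qed simp
  also have "\<dots> = int (card (tait_colorings G))"
  proof -
    \<comment> \<open>The color of a matching edge is the one missing among its neighbors at either
      end, so restriction loses nothing.\<close>
    have "inj_on (\<lambda>c. restrict c (edges G - M)) (tait_colorings G)"
    proof (rule inj_onI)
      fix c c' assume c: "c \<in> tait_colorings G" "c' \<in> tait_colorings G"
        and eq: "restrict c (edges G - M) = restrict c' (edges G - M)"
      have eq': "c e = c' e" if "e \<in> edges G - M" for e
        using fun_cong[OF eq, of e] that by simp
      have "c e = c' e" if e: "e \<in> edges G" for e
      proof (cases "e \<in> M")
        case True
        have e': "(e, False) \<in> H" using e by simp
        have "c (fst (\<rho> (e, False))) = c' (fst (\<rho> (e, False)))"
          "c (fst (\<rho> (\<rho> (e, False)))) = c' (fst (\<rho> (\<rho> (e, False))))"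
          using eq' Sin[OF True, of False] by (auto simp: S_def mem_Times_iff)
        then show ?thesis
          by (rule_tac tait_colors_at[OF c(1) e']; rule_tac tait_colors_at[OF c(2) e']) auto
      next
        case False
        then show ?thesis using eq' e by simp
      qed
      then show "c = c'" using c by (intro PiE_ext[of c "edges G" "\<lambda>_. {0, 1, 2}"]) (auto simp: tait_colorings_iff)
    qed
    then show ?thesis by (simp add: card_image)
  qed
  finally show ?thesis by (simp add: mult.commute)
qed

end

section \<open>The signed sum over vertex sets\<close>

context cubic_rotation
begin

lemma one_factor_at:
  assumes "one_factor X" "h \<in> H"
  shows "fst h \<in> X \<and> fst (\<rho> h) \<notin> X \<and> fst (\<rho> (\<rho> h)) \<notin> X \<or>
         fst h \<notin> X \<and> fst (\<rho> h) \<in> X \<and> fst (\<rho> (\<rho> h)) \<notin> X \<or>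
         fst h \<notin> X \<and> fst (\<rho> h) \<notin> X \<and> fst (\<rho> (\<rho> h)) \<in> X"
proof -
  have R: "(fst k \<in> X \<or> fst (\<rho> k) \<in> X \<or> fst (\<rho> (\<rho> k)) \<in> X) \<and>
            (fst k \<in> X \<longrightarrow> fst (\<rho> k) \<notin> X \<and> fst (\<rho> (\<rho> k)) \<notin> X)" if "k \<in> H" for k
    using assms(1) that unfolding one_factor_iff by blast
  show ?thesis
    using R[OF assms(2)] R[OF rotation_in(1)[OF assms(2)]] rotation_cubed[OF assms(2)] by auto
qed

lemma one_factorI:
  assumes "X \<subseteq> edges G"
    and "\<And>h. h \<in> H \<Longrightarrow> fst h \<in> X \<and> fst (\<rho> h) \<notin> X \<and> fst (\<rho> (\<rho> h)) \<notin> X \<or>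
         fst h \<notin> X \<and> fst (\<rho> h) \<in> X \<and> fst (\<rho> (\<rho> h)) \<notin> X \<or>
         fst h \<notin> X \<and> fst (\<rho> h) \<notin> X \<and> fst (\<rho> (\<rho> h)) \<in> X"
  shows "one_factor X"
  unfolding one_factor_iff using assms by metis

lemma in_edges_rotation:
  "h \<in> H \<Longrightarrow> fst h \<in> edges G \<and> fst (\<rho> h) \<in> edges G \<and> fst (\<rho> (\<rho> h)) \<in> edges G"
  using fst_rotation_in[of h] by (simp add: mem_Times_iff)

lemma card_edges: "2 * card (edges G) = 3 * card (verts G)"
proof -
  have "card H = (\<Sum>h\<in>H. 1)" by simp
  also have "\<dots> = (\<Sum>v\<in>verts G. \<Sum>h\<in>{h \<in> H. vert_of G h = v}. 1)"
    by (rule sum.group[symmetric]) (use finite_edges finite_verts vert_of_in_verts in auto)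
  also have "\<dots> = (\<Sum>v\<in>verts G. 3)"
    by (rule sum.cong) (use trivalent in \<open>auto simp: trivalent_def half_edges_at_def\<close>)
  finally show ?thesis by (simp add: card_cartesian_product mult.commute)
qed

text \<open>Such an \<open>s\<close> is a union of pairs of ends of edges of \<open>M\<close>. Hence
  it corresponds to a subset of \<open>M\<close> and has even size, so all signs are 1.\<close>

lemma sum_sign_constant_on_matching:
  assumes M: "one_factor M"
  shows "(\<Sum>s\<in>Pow (verts G). (-1) ^ card s * of_bool (crossed_edges G s \<inter> M = {}) :: int) = 2 ^ card M"
proof -
  have sub: "M \<subseteq> edges G" using M by (simp add: one_factor_def)
  have finM: "finite M" using finite_subset[OF sub finite_edges] .
  define W where "W = {s \<in> Pow (verts G). crossed_edges G s \<inter> M = {}}"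
  have W: "source G e \<in> s \<longleftrightarrow> target G e \<in> s" if "s \<in> W" "e \<in> M" for s e
    using that sub by (auto simp: W_def crossed_edges_def)
  have bij: "bij_betw (vert_of G) (M \<times> UNIV) (verts G)" using one_factor_bij[OF M] .
  have "bij_betw (\<lambda>B. vert_of G ` (B \<times> UNIV)) (Pow M) W"
  proof (rule bij_betw_byWitness[where f' = "\<lambda>s. {e \<in> M. source G e \<in> s}"])
    have inB: "vert_of G (e, b) \<in> vert_of G ` (B \<times> UNIV) \<longleftrightarrow> e \<in> B" if "B \<subseteq> M" "e \<in> M" for B e b
      using inj_on_image_mem_iff[OF bij_betw_imp_inj_on[OF bij], of "(e, b)" "B \<times> UNIV"] that
      by (simp add: Sigma_mono del: vert_of.simps)
    show "\<forall>B\<in>Pow M. {e \<in> M. source G e \<in> vert_of G ` (B \<times> UNIV)} = B"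
    proof
      fix B assume "B \<in> Pow M"
      then have "source G e \<in> vert_of G ` (B \<times> UNIV) \<longleftrightarrow> e \<in> B" if "e \<in> M" for e
        using inB[of B e False] that by simp
      then show "{e \<in> M. source G e \<in> vert_of G ` (B \<times> UNIV)} = B" using \<open>B \<in> Pow M\<close> by blast
    qed
    show "(\<lambda>B. vert_of G ` (B \<times> UNIV)) ` Pow M \<subseteq> W"
    proof (rule image_subsetI)
      fix B assume "B \<in> Pow M"
      then have B: "B \<subseteq> M" by simp
      have "vert_of G ` (B \<times> UNIV) \<subseteq> verts G" using B bij by (auto simp: bij_betw_def)
      moreover have "source G e \<in> vert_of G ` (B \<times> UNIV) \<longleftrightarrow> target G e \<in> vert_of G ` (B \<times> UNIV)"
        if "e \<in> M" for e using inB[OF B that, of False] inB[OF B that, of True] by simp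
      ultimately show "vert_of G ` (B \<times> UNIV) \<in> W" by (auto simp: W_def crossed_edges_def)
    qed
    show "\<forall>s\<in>W. vert_of G ` ({e \<in> M. source G e \<in> s} \<times> UNIV) = s"
    proof
      fix s assume s: "s \<in> W"
      have "v \<in> vert_of G ` ({e \<in> M. source G e \<in> s} \<times> UNIV) \<longleftrightarrow> v \<in> s" if v: "v \<in> verts G" for v
      proof -
        obtain e b where e: "e \<in> M" "v = vert_of G (e, b)"
        proof -
          have "v \<in> vert_of G ` (M \<times> UNIV)" using bij v by (simp add: bij_betw_def)
          then show ?thesis using that by blast
        qed
        have "v \<in> s \<longleftrightarrow> source G e \<in> s" using W[OF s e(1)] e(2) by (cases b) auto
        moreover have "v \<in> vert_of G ` ({e \<in> M. source G e \<in> s} \<times> UNIV) \<longleftrightarrow> e \<in> {e \<in> M. source G e \<in> s}"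
          unfolding e(2) by (rule inB) (use e in auto)
        ultimately show ?thesis using e(1) by simp
      qed
      moreover have "s \<subseteq> verts G" using s by (simp add: W_def)
      moreover have "vert_of G ` ({e \<in> M. source G e \<in> s} \<times> UNIV) \<subseteq> verts G"
        using bij by (auto simp: bij_betw_def)
      ultimately show "vert_of G ` ({e \<in> M. source G e \<in> s} \<times> UNIV) = s" by blast
    qed
  qed auto
  then have "card (Pow M) = card W" by (rule bij_betw_same_card)
  then have cardW: "card W = 2 ^ card M" by (simp add: card_Pow finM)
  have sign: "(-1) ^ card s = (1::int)" if s: "s \<in> W" for s
  proof -
    have "(-1) ^ card s = (\<Prod>v\<in>verts G. if v \<in> s then - 1 else 1 :: int)"
      by (rule prod_sign[symmetric, OF finite_verts]) (use s in \<open>simp add: W_def\<close>)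
    also have "\<dots> = (\<Prod>e\<in>M. (if source G e \<in> s then - 1 else 1) * (if target G e \<in> s then - 1 else 1))"
      by (rule prod_one_factor[OF M])
    also have "\<dots> = 1" by (rule prod.neutral) (use W[OF s] in auto)
    finally show ?thesis .
  qed
  have "(\<Sum>s\<in>Pow (verts G). (-1) ^ card s * of_bool (crossed_edges G s \<inter> M = {}) :: int) = (\<Sum>s\<in>W. 1)"
    by (rule sum.mono_neutral_cong_right) (use finite_verts sign in \<open>auto simp: W_def\<close>)
  also have "\<dots> = 2 ^ card M" by (simp add: cardW)
  finally show ?thesis .
qed

text \<open>Expand the parity condition at every vertex into characters and sum over \<open>a\<close> first.\<close>

lemma sum_sign_constant_on_two_factor:
  assumes M: "one_factor M"
  shows "(\<Sum>t\<in>Pow (verts G). (-1) ^ card t * of_bool (crossed_edges G t \<inter> (edges G - M) = {}) :: int) =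
     int (card {a \<in> Pow (edges G - M). one_factor a})"
proof -
  define x where "x = edges G - M"
  have x: "x \<subseteq> edges G" "finite x" using finite_edges by (auto simp: x_def)
  have "card x = card (edges G) - card M"
    unfolding x_def by (rule card_Diff_subset) (use M finite_edges in \<open>auto simp: one_factor_def intro: finite_subset\<close>)
  \<comment> \<open>The factor \<open>2 ^ card x\<close> from the sum over \<open>a\<close> thus
    equals the factor \<open>2 ^ card (verts G)\<close> from the sum over \<open>t\<close>, and both
    cancel at the end.\<close>
  then have cardx: "card x = card (verts G)" using card_edges card_one_factor[OF M] by simp
  define w where "w a e = (if e \<in> a then - 1 else 1 :: int)" for a :: "'e set" and e
  define W where "W a v = (\<Prod>h\<in>{h \<in> H. vert_of G h = v}. w a (fst h))" for a v
  \<comment> \<open>The sign with exponent the sum over \<open>t\<close> of the degrees in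
    \<open>a\<close>. Edge by edge, only the edges of \<open>a\<close> with exactly one end in
    \<open>t\<close> contribute.\<close>
  define K where "K a t = (\<Prod>v\<in>verts G. if v \<in> t then W a v else 1)" for a t
  have K: "K a t = (\<Prod>e\<in>a. if e \<in> crossed_edges G t then - 1 else 1)" if a: "a \<subseteq> x" for a t
  proof -
    have "K a t = (\<Prod>v\<in>verts G. \<Prod>h\<in>{h \<in> H. vert_of G h = v}. if vert_of G h \<in> t then w a (fst h) else 1)"
      unfolding K_def W_def by (intro prod.cong refl) auto
    also have "\<dots> = (\<Prod>h\<in>H. if vert_of G h \<in> t then w a (fst h) else 1)"
      by (rule prod.group) (use finite_edges finite_verts vert_of_in_verts in auto)
    also have "\<dots> = (\<Prod>e\<in>edges G. \<Prod>b\<in>UNIV. if vert_of G (e, b) \<in> t then w a e else 1)"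
      by (simp add: prod.cartesian_product case_prod_beta' del: vert_of.simps)
    also have "\<dots> = (\<Prod>e\<in>a. if e \<in> crossed_edges G t then - 1 else 1)"
      by (rule prod.mono_neutral_cong_right)
        (use finite_edges a x in \<open>auto simp: UNIV_bool w_def crossed_edges_def\<close>)
    finally show ?thesis .
  qed
  have Wh: "W a (vert_of G h) = w a (fst h) * w a (fst (\<rho> h)) * w a (fst (\<rho> (\<rho> h)))" if h: "h \<in> H" for a h
  proof -
    have "{k \<in> H. vert_of G k = vert_of G h} = {h, \<rho> h, \<rho> (\<rho> h)}"
      using half_edges_at_vert_of[OF h] by (simp add: half_edges_at_def)
    then show ?thesis using rotation_distinct[OF h] by (simp add: W_def)
  qed
  have W1: "(W a v = - 1) \<or> (W a v = 1)" for a v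
  proof -
    have "(\<Prod>h\<in>S. w a (fst h)) \<in> {- 1, 1}" for S :: "('e \<times> bool) set"
      by (induction S rule: infinite_finite_induct) (auto simp: w_def)
    then show ?thesis unfolding W_def by blast
  qed
  have one_factor: "one_factor a \<longleftrightarrow> (\<forall>v\<in>verts G. W a v = - 1)" if a: "a \<subseteq> x" for a
  proof
    assume a1: "one_factor a"
    show "\<forall>v\<in>verts G. W a v = - 1"
    proof
      fix v assume "v \<in> verts G"
      then obtain h where h: "h \<in> H" "vert_of G h = v" using half_edge_at_exists by blast
      show "W a v = - 1" using one_factor_at[OF a1 h(1)] Wh[OF h(1), of a] h(2) by (auto simp: w_def)
    qed
  next
    assume W: "\<forall>v\<in>verts G. W a v = - 1"
    show "one_factor a"
    proof (rule one_factorI)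
      show "a \<subseteq> edges G" using a x by blast
      fix h assume h: "h \<in> H"
      have "w a (fst h) * w a (fst (\<rho> h)) * w a (fst (\<rho> (\<rho> h))) = - 1"
        using Wh[OF h, of a] W vert_of_in_verts[OF h] by simp
      \<comment> \<open>The set \<open>x\<close> contains only two of the three half-edges here, so
        an odd degree in \<open>a\<close> has to be 1.\<close>
      moreover have "fst h \<notin> a \<or> fst (\<rho> h) \<notin> a \<or> fst (\<rho> (\<rho> h)) \<notin> a"
        using one_factor_at[OF M h] a by (auto simp: x_def)
      ultimately show "fst h \<in> a \<and> fst (\<rho> h) \<notin> a \<and> fst (\<rho> (\<rho> h)) \<notin> a \<or>
         fst h \<notin> a \<and> fst (\<rho> h) \<in> a \<and> fst (\<rho> (\<rho> h)) \<notin> a \<or>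
         fst h \<notin> a \<and> fst (\<rho> h) \<notin> a \<and> fst (\<rho> (\<rho> h)) \<in> a"
        by (auto simp: w_def split: if_splits)
    qed
  qed
  have "(\<Sum>t\<in>Pow (verts G). (-1) ^ card t * K a t) = (if one_factor a then 2 ^ card (verts G) else 0)"
    if a: "a \<subseteq> x" for a
  proof -
    have "(-1) ^ card t * K a t = (\<Prod>v\<in>t. - W a v) * (\<Prod>v\<in>verts G - t. 1)" if "t \<in> Pow (verts G)" for t
    proof -
      have "K a t = (\<Prod>v\<in>t. W a v)"
        unfolding K_def by (rule prod.mono_neutral_cong_right) (use finite_verts that in auto)
      then show ?thesis by (simp add: prod_uminus)
    qed
    then have "(\<Sum>t\<in>Pow (verts G). (-1) ^ card t * K a t) = (\<Prod>v\<in>verts G. - W a v + 1)"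
      unfolding prod_add[OF finite_verts] by (intro sum.cong refl)
    also have "\<dots> = (if one_factor a then 2 ^ card (verts G) else 0)"
    proof (cases "one_factor a")
      case True
      then have "(\<Prod>v\<in>verts G. - W a v + 1) = (\<Prod>v\<in>verts G. 2)"
        using one_factor[OF a] by (intro prod.cong) auto
      then show ?thesis using True by simp
    next
      case False
      then obtain v where "v \<in> verts G" "W a v \<noteq> - 1" using one_factor[OF a] by blast
      then have "v \<in> verts G" "- W a v + 1 = 0" using W1[of a v] by auto
      then show ?thesis using False finite_verts by (simp add: prod_zero_iff) blast
    qed
    finally show ?thesis .
  qed
  then have "(\<Sum>a\<in>Pow x. \<Sum>t\<in>Pow (verts G). (-1) ^ card t * K a t) =
     (\<Sum>a\<in>Pow x. if one_factor a then 2 ^ card (verts G) else 0)"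
    by (intro sum.cong) auto
  also have "\<dots> = 2 ^ card (verts G) * int (card {a \<in> Pow x. one_factor a})"
    using x(2) by (simp add: sum.If_cases Collect_conj_eq Pow_def mult.commute)
  finally have 1: "(\<Sum>a\<in>Pow x. \<Sum>t\<in>Pow (verts G). (-1) ^ card t * K a t) =
      2 ^ card (verts G) * int (card {a \<in> Pow x. one_factor a})" .
  have "(\<Sum>a\<in>Pow x. K a t) = 2 ^ card x * of_bool (crossed_edges G t \<inter> x = {})" for t
  proof -
    have "(\<Sum>a\<in>Pow x. K a t) = (\<Sum>a\<in>Pow x. (\<Prod>e\<in>a. if e \<in> crossed_edges G t then - 1 else 1) * (\<Prod>e\<in>x - a. 1))"
      by (rule sum.cong) (simp_all add: K)
    also have "\<dots> = (\<Prod>e\<in>x. (if e \<in> crossed_edges G t then - 1 else 1) + 1)"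
      by (rule prod_add[OF x(2), symmetric])
    also have "\<dots> = 2 ^ card x * of_bool (crossed_edges G t \<inter> x = {})"
    proof (cases "crossed_edges G t \<inter> x = {}")
      case True
      then have "(\<Prod>e\<in>x. (if e \<in> crossed_edges G t then - 1 else 1) + 1 :: int) = (\<Prod>e\<in>x. 2)"
        by (intro prod.cong) auto
      then show ?thesis using True by simp
    next
      case False
      then obtain e where "e \<in> x" "e \<in> crossed_edges G t" by blast
      then have "(\<Prod>e\<in>x. (if e \<in> crossed_edges G t then - 1 else 1) + 1 :: int) = 0"
        by (intro prod_zero[OF x(2)] bexI[of _ e]) auto
      then show ?thesis using False by simp
    qed
    finally show ?thesis .
  qed
  then have "(\<Sum>t\<in>Pow (verts G). \<Sum>a\<in>Pow x. (-1) ^ card t * K a t) =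
     2 ^ card x * (\<Sum>t\<in>Pow (verts G). (-1) ^ card t * of_bool (crossed_edges G t \<inter> x = {}))"
    unfolding sum_distrib_left[symmetric] by (simp add: sum_distrib_left mult.left_commute
        del: sum_of_bool_eq sum_mult_of_bool_eq sum_of_bool_mult_eq)
  then have "2 ^ card x * (\<Sum>t\<in>Pow (verts G). (-1) ^ card t * of_bool (crossed_edges G t \<inter> x = {})) =
      2 ^ card (verts G) * int (card {a \<in> Pow x. one_factor a})"
    using 1 by (subst (asm) sum.swap) simp
  then show ?thesis unfolding cardx by (simp add: x_def)
qed

text \<open>A coloring is recorded by the 2-factor \<open>x\<close> of the colors 0 and 1 and the
  perfect matching \<open>a\<close> of color 0 inside it; color 2 is the complement of
  \<open>x\<close>.\<close>

lemma card_tait_colorings: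
  "card (tait_colorings G) =
     (\<Sum>x\<in>{x \<in> Pow (edges G). one_factor (edges G - x)}. card {a \<in> Pow x. one_factor a})"
proof -
  let ?X = "{x \<in> Pow (edges G). one_factor (edges G - x)}"
  let ?D = "SIGMA x : ?X. {a \<in> Pow x. one_factor a}"
  have "bij_betw (\<lambda>c. ({e \<in> edges G. c e \<noteq> 2}, {e \<in> edges G. c e = 0})) (tait_colorings G) ?D"
  proof (rule bij_betw_byWitness[where
        f' = "\<lambda>(x, a). \<lambda>e\<in>edges G. if e \<in> a then 0 else if e \<in> x then 1 else 2"])
    show "\<forall>c\<in>tait_colorings G. (case ({e \<in> edges G. c e \<noteq> 2}, {e \<in> edges G. c e = 0}) of
        (x, a) \<Rightarrow> \<lambda>e\<in>edges G. if e \<in> a then 0 else if e \<in> x then 1 else 2) = c"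
    proof
      fix c assume c: "c \<in> tait_colorings G"
      then have cE: "c \<in> edges G \<rightarrow>\<^sub>E {0, 1, 2}" by (simp add: tait_colorings_def)
      have "(if e \<in> {e \<in> edges G. c e = 0} then 0 else if e \<in> {e \<in> edges G. c e \<noteq> 2} then 1 else 2) = c e"
        if "e \<in> edges G" for e using tait_color_range[OF c that] that by auto
      then show "(case ({e \<in> edges G. c e \<noteq> 2}, {e \<in> edges G. c e = 0}) of
        (x, a) \<Rightarrow> \<lambda>e\<in>edges G. if e \<in> a then 0 else if e \<in> x then 1 else 2) = c"
        using PiE_arb[OF cE] by (auto simp: fun_eq_iff restrict_def)
    qed
    show "\<forall>p\<in>?D. ({e \<in> edges G. (case p of (x, a) \<Rightarrow>
            \<lambda>e\<in>edges G. if e \<in> a then 0 else if e \<in> x then 1 else 2 :: nat) e \<noteq> 2},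
          {e \<in> edges G. (case p of (x, a) \<Rightarrow>
            \<lambda>e\<in>edges G. if e \<in> a then 0 else if e \<in> x then 1 else 2 :: nat) e = 0}) = p"
      by auto
    show "(\<lambda>c. ({e \<in> edges G. c e \<noteq> 2}, {e \<in> edges G. c e = 0})) ` tait_colorings G \<subseteq> ?D"
    proof (rule image_subsetI)
      fix c assume c: "c \<in> tait_colorings G"
      have "edges G - {e \<in> edges G. c e \<noteq> 2} = {e \<in> edges G. c e = 2}" by auto
      then show "({e \<in> edges G. c e \<noteq> 2}, {e \<in> edges G. c e = 0}) \<in> ?D"
        using tait_color_class_one_factor[OF c, of 0] tait_color_class_one_factor[OF c, of 2] by auto
    qed
    show "(\<lambda>(x, a). \<lambda>e\<in>edges G. if e \<in> a then 0 else if e \<in> x then 1 else 2) ` ?D \<subseteq> tait_colorings G"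
    proof (rule image_subsetI)
      fix p assume "p \<in> ?D"
      then obtain x a where p: "p = (x, a)" and x: "x \<subseteq> edges G" "one_factor (edges G - x)"
        and a: "a \<subseteq> x" "one_factor a" by auto
      define c where "c = (\<lambda>e\<in>edges G. if e \<in> a then 0 else if e \<in> x then 1 else 2 :: nat)"
      have "c \<in> tait_colorings G"
        unfolding tait_colorings_iff
      proof (rule conjI)
        show "c \<in> edges G \<rightarrow>\<^sub>E {0, 1, 2}" by (simp add: c_def)
        show "\<forall>h\<in>H. c (fst h) \<noteq> c (fst (\<rho> h)) \<and> c (fst h) \<noteq> c (fst (\<rho> (\<rho> h))) \<and>
            c (fst (\<rho> h)) \<noteq> c (fst (\<rho> (\<rho> h)))"
        proof
          fix h assume h: "h \<in> H"
          show "c (fst h) \<noteq> c (fst (\<rho> h)) \<and> c (fst h) \<noteq> c (fst (\<rho> (\<rho> h))) \<and>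
            c (fst (\<rho> h)) \<noteq> c (fst (\<rho> (\<rho> h)))"
            using one_factor_at[OF x(2) h] one_factor_at[OF a(2) h] in_edges_rotation[OF h] a(1)
            by (auto simp: c_def)
        qed
      qed
      then show "(case p of (x, a) \<Rightarrow> \<lambda>e\<in>edges G. if e \<in> a then 0 else if e \<in> x then 1 else 2)
          \<in> tait_colorings G" by (simp add: p c_def)
    qed
  qed
  then have "card (tait_colorings G) = card ?D" by (rule bij_betw_same_card)
  also have "\<dots> = (\<Sum>x\<in>?X. card {a \<in> Pow x. one_factor a})"
  proof (rule card_SigmaI)
    show "\<forall>x\<in>?X. finite {a \<in> Pow x. one_factor a}"
    proof
      fix x assume "x \<in> ?X"
      then have "finite (Pow x)" using finite_edges by (auto intro: finite_subset)
      then show "finite {a \<in> Pow x. one_factor a}" by simp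
    qed
  qed (use finite_edges in simp)
  finally show ?thesis .
qed

lemma signed_sum_cut_pairs:
  "(\<Sum>T\<in>Pow (verts G). (-1) ^ card T * int (card (cut_pairs G (crossed_edges G T)))) =
     2 ^ (card (verts G) div 2) * int (card (tait_colorings G))"
proof -
  note [simp del] = sum_of_bool_eq sum_mult_of_bool_eq sum_of_bool_mult_eq
  let ?V = "Pow (verts G)"
  define X where "X = {x. even_subgraph G x}"
  have "X \<subseteq> Pow (edges G)" by (auto simp: X_def even_subgraph_def)
  then have finX: "finite X" using finite_edges by (auto intro: finite_subset)
  have finV: "finite ?V" using finite_verts by simp
  have cnt: "int (card (cut_pairs G A)) = (\<Sum>x\<in>X. \<Sum>s\<in>?V. of_bool (crossed_edges G s = A \<inter> x))" for A
  proof -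
    have "cut_pairs G A = (X \<times> ?V) \<inter> {p. crossed_edges G (snd p) = A \<inter> fst p}"
      by (auto simp: cut_pairs_def X_def)
    moreover have "(\<Sum>p\<in>X \<times> ?V. of_bool (crossed_edges G (snd p) = A \<inter> fst p)) =
        int (card ((X \<times> ?V) \<inter> {p. crossed_edges G (snd p) = A \<inter> fst p}))"
      by (rule sum_of_bool_eq) (rule finite_cartesian_product[OF finX finV])+
    ultimately show ?thesis by (simp add: sum.cartesian_product case_prod_beta')
  qed
  define F where "F x = (\<Sum>T\<in>?V. (-1) ^ card T * (\<Sum>s\<in>?V. of_bool (crossed_edges G s = crossed_edges G T \<inter> x) :: int))" for x
  have "(\<Sum>T\<in>?V. (-1) ^ card T * int (card (cut_pairs G (crossed_edges G T)))) = (\<Sum>x\<in>X. F x)"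
    unfolding cnt F_def sum_distrib_left by (rule sum.swap)
  also have "\<dots> = (\<Sum>x\<in>{x \<in> Pow (edges G). one_factor (edges G - x)}. F x)"
  proof (rule sum.mono_neutral_right[OF finX])
    show "{x \<in> Pow (edges G). one_factor (edges G - x)} \<subseteq> X"
    proof
      fix x assume "x \<in> {x \<in> Pow (edges G). one_factor (edges G - x)}"
      then have "x \<subseteq> edges G" "one_factor (edges G - x)" by auto
      moreover have "edges G - (edges G - x) = x" using \<open>x \<subseteq> edges G\<close> by blast
      ultimately show "x \<in> X" using even_subgraph_complement[of "edges G - x"] by (simp add: X_def)
    qed
    show "\<forall>x\<in>X - {x \<in> Pow (edges G). one_factor (edges G - x)}. F x = 0"
    proof
      fix x assume x: "x \<in> X - {x \<in> Pow (edges G). one_factor (edges G - x)}"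
      then have "even_subgraph G x" by (simp add: X_def)
      then have ev: "x \<subseteq> edges G" "\<And>h. h \<in> H \<Longrightarrow> (fst h \<in> x) = ((fst (\<rho> h) \<in> x) \<noteq> (fst (\<rho> (\<rho> h)) \<in> x))"
        unfolding even_subgraph_iff by blast+
      have "\<not> one_factor (edges G - x)" using x ev(1) by blast
      then obtain h where h: "h \<in> H" "\<not> (fst h \<in> edges G - x \<and> fst (\<rho> h) \<notin> edges G - x \<and> fst (\<rho> (\<rho> h)) \<notin> edges G - x \<or>
         fst h \<notin> edges G - x \<and> fst (\<rho> h) \<in> edges G - x \<and> fst (\<rho> (\<rho> h)) \<notin> edges G - x \<or>
         fst h \<notin> edges G - x \<and> fst (\<rho> h) \<notin> edges G - x \<and> fst (\<rho> (\<rho> h)) \<in> edges G - x)"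
        using one_factorI[of "edges G - x"] by blast
      \<comment> \<open>An even subgraph has degree 0 or 2 at a vertex, and the complement has
        degree 1 exactly where the degree is 2. So the failing vertex has degree 0.\<close>
      then have none: "fst h \<notin> x" "fst (\<rho> h) \<notin> x" "fst (\<rho> (\<rho> h)) \<notin> x"
        using ev(2)[OF h(1)] in_edges_rotation[OF h(1)] by auto
      define v where "v = vert_of G h"
      have off: "vert_of G (e, b) \<noteq> v" if "e \<in> x" for e b
      proof
        assume "vert_of G (e, b) = v"
        then have "(e, b) = h \<or> (e, b) = \<rho> h \<or> (e, b) = \<rho> (\<rho> h)"
          using that ev(1) by (intro same_vert_cases[OF h(1)]) (auto simp: v_def)
        then have "fst h = e \<or> fst (\<rho> h) = e \<or> fst (\<rho> (\<rho> h)) = e" by (metis fst_conv)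
        then show False using none that by auto
      qed
      have cross: "crossed_edges G (insert v T) \<inter> x = crossed_edges G T \<inter> x" for T
        using off[of _ False] off[of _ True] by (auto simp: crossed_edges_def)
      show "F x = 0"
        unfolding F_def
        by (rule sum_Pow_sign_eq_0[OF finite_verts, of v]) (use vert_of_in_verts[OF h(1)] cross in \<open>auto simp: v_def\<close>)
    qed
  qed
  also have "\<dots> = (\<Sum>x\<in>{x \<in> Pow (edges G). one_factor (edges G - x)}.
      2 ^ (card (verts G) div 2) * int (card {a \<in> Pow x. one_factor a}))"
  proof (rule sum.cong)
    fix x assume "x \<in> {x \<in> Pow (edges G). one_factor (edges G - x)}"
    then have x: "x \<subseteq> edges G" and M: "one_factor (edges G - x)" by auto
    define M where "M = edges G - x"
    have xM: "edges G - M = x" using x by (auto simp: M_def)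
    define \<sigma> where "\<sigma> s t = (s - t) \<union> (t - s)" for s t :: "'v set"
    have \<sigma>: "\<sigma> s t \<subseteq> verts G" if "s \<subseteq> verts G" "t \<subseteq> verts G" for s t using that by (auto simp: \<sigma>_def)
    have bij: "bij_betw (\<sigma> s) ?V ?V" if "s \<in> ?V" for s
      by (rule bij_betw_byWitness[where f' = "\<sigma> s"]) (use that \<sigma> in \<open>auto simp: \<sigma>_def\<close>)
    have sign: "(-1) ^ card (\<sigma> s t) = (-1) ^ card s * (-1 :: int) ^ card t" if "s \<in> ?V" "t \<in> ?V" for s t
    proof -
      have st: "s \<subseteq> verts G" "t \<subseteq> verts G" using that by auto
      show ?thesis
        unfolding prod_sign[OF finite_verts st(1), symmetric] prod_sign[OF finite_verts st(2), symmetric]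
          prod_sign[OF finite_verts \<sigma>[OF st], symmetric] prod.distrib[symmetric]
        by (rule prod.cong) (auto simp: \<sigma>_def)
    qed
    \<comment> \<open>The coboundary is additive mod 2. On \<open>M\<close> the condition says that
      the coboundary of \<open>s\<close> vanishes; on \<open>x\<close> the contribution of
      \<open>s\<close> cancels and that of \<open>t\<close> has to vanish.\<close>
    have cross: "crossed_edges G s = crossed_edges G (\<sigma> s t) \<inter> x \<longleftrightarrow>
       crossed_edges G s \<inter> M = {} \<and> crossed_edges G t \<inter> x = {}" for s t
    proof -
      have "e \<in> crossed_edges G (\<sigma> s t) \<longleftrightarrow> (e \<in> crossed_edges G s) \<noteq> (e \<in> crossed_edges G t)" for e
        by (auto simp: crossed_edges_def \<sigma>_def)
      moreover have "crossed_edges G s \<subseteq> edges G" by (auto simp: crossed_edges_def)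
      ultimately show ?thesis by (auto simp: M_def)
    qed
    have "F x = (\<Sum>s\<in>?V. \<Sum>T\<in>?V. (-1) ^ card T * of_bool (crossed_edges G s = crossed_edges G T \<inter> x))"
      unfolding F_def sum_distrib_left by (rule sum.swap)
    also have "\<dots> = (\<Sum>s\<in>?V. \<Sum>t\<in>?V. ((-1) ^ card s * of_bool (crossed_edges G s \<inter> M = {})) *
        ((-1) ^ card t * of_bool (crossed_edges G t \<inter> x = {})))"
    proof (rule sum.cong)
      fix s assume s: "s \<in> ?V"
      have "(\<Sum>T\<in>?V. (-1) ^ card T * of_bool (crossed_edges G s = crossed_edges G T \<inter> x) :: int) =
        (\<Sum>t\<in>?V. (-1) ^ card (\<sigma> s t) * of_bool (crossed_edges G s = crossed_edges G (\<sigma> s t) \<inter> x))"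
        by (rule sum.reindex_bij_betw[OF bij[OF s], symmetric])
      also have "\<dots> = (\<Sum>t\<in>?V. ((-1) ^ card s * of_bool (crossed_edges G s \<inter> M = {})) *
        ((-1) ^ card t * of_bool (crossed_edges G t \<inter> x = {})))"
        by (rule sum.cong) (use s in \<open>simp_all add: sign cross of_bool_conj\<close>)
      finally show "(\<Sum>T\<in>?V. (-1) ^ card T * of_bool (crossed_edges G s = crossed_edges G T \<inter> x) :: int) =
        (\<Sum>t\<in>?V. ((-1) ^ card s * of_bool (crossed_edges G s \<inter> M = {})) *
        ((-1) ^ card t * of_bool (crossed_edges G t \<inter> x = {})))" .
    qed simp
    also have "\<dots> = (\<Sum>s\<in>?V. (-1) ^ card s * of_bool (crossed_edges G s \<inter> M = {})) *
        (\<Sum>t\<in>?V. (-1) ^ card t * of_bool (crossed_edges G t \<inter> x = {}))"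
      by (rule sum_product[symmetric])
    also have "\<dots> = 2 ^ card M * int (card {a \<in> Pow x. one_factor a})"
      using sum_sign_constant_on_matching[of M] sum_sign_constant_on_two_factor[of M] M xM by (simp add: M_def)
    finally show "F x = 2 ^ (card (verts G) div 2) * int (card {a \<in> Pow x. one_factor a})"
      using card_one_factor[of M] M by (simp add: M_def)
  qed simp
  also have "\<dots> = 2 ^ (card (verts G) div 2) * int (card (tait_colorings G))"
    by (simp add: card_tait_colorings sum_distrib_left)
  finally show ?thesis .
qed

end

section \<open>Stereographic projection\<close>

text \<open>The sign in \<open>cross_ab\<close> makes \<open>a, b\<close> counterclockwise at the
  point \<open>- N\<close> when seen from outside the sphere, so that projection from
  \<open>N\<close> preserves orientation; see \<open>stereo_orientation\<close>.\<close>

locale orthonormal_frame =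
  fixes a b N :: "real^3"
  assumes inner_aa: "a \<bullet> a = 1" and inner_bb: "b \<bullet> b = 1" and inner_NN: "N \<bullet> N = 1"
    and inner_ab: "a \<bullet> b = 0" and inner_aN: "a \<bullet> N = 0" and inner_bN: "b \<bullet> N = 0"
    and cross_ab: "cross3 a b = - N"
begin

lemma cross_bN: "cross3 b N = - a"
proof -
  have "cross3 b (cross3 a b) = a" by (simp add: Lagrange inner_bb inner_ab inner_commute[of b a])
  then show ?thesis by (simp add: cross_ab) (metis minus_minus)
qed

lemma cross_Na: "cross3 N a = - b"
proof -
  have "cross3 a (cross3 a b) = - b" by (simp add: Lagrange inner_aa inner_ab)
  then have "cross3 a N = b" by (simp add: cross_ab)
  then show ?thesis by (metis cross_skew)
qed

lemma frame_expansion: "p = (a \<bullet> p) *\<^sub>R a + (b \<bullet> p) *\<^sub>R b + (N \<bullet> p) *\<^sub>R N"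
proof -
  define w where "w = p - ((a \<bullet> p) *\<^sub>R a + (b \<bullet> p) *\<^sub>R b + (N \<bullet> p) *\<^sub>R N)"
  have 1: "w \<bullet> a = 0" "w \<bullet> b = 0" "w \<bullet> N = 0"
    by (simp_all add: w_def inner_diff_left inner_add_left inner_aa inner_bb inner_NN inner_ab
        inner_aN inner_bN inner_commute[of b a] inner_commute[of N a] inner_commute[of N b]
        inner_commute[of p])
  have "cross3 w (cross3 a b) = 0" by (simp add: Lagrange 1)
  then have "cross3 w N = 0" by (simp add: cross_ab)
  then have "w = 0 \<or> N = 0" using 1(3) norm_and_cross_eq_0 by blast
  then have "w = 0" using inner_NN by auto
  then show ?thesis by (simp add: w_def)
qed

lemma inner_frame: "p \<bullet> q = (a \<bullet> p) * (a \<bullet> q) + (b \<bullet> p) * (b \<bullet> q) + (N \<bullet> p) * (N \<bullet> q)"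
  by (subst frame_expansion[of p]) (simp only: inner_add_left inner_scaleR_left)

lemma triple_frame:
  "cross3 p q \<bullet> w =
     - ((a \<bullet> w) * ((b \<bullet> p) * (N \<bullet> q) - (N \<bullet> p) * (b \<bullet> q))
      + (b \<bullet> w) * ((N \<bullet> p) * (a \<bullet> q) - (a \<bullet> p) * (N \<bullet> q))
      + (N \<bullet> w) * ((a \<bullet> p) * (b \<bullet> q) - (b \<bullet> p) * (a \<bullet> q)))"
proof -
  define x y z x' y' z' where "x = a \<bullet> p" "y = b \<bullet> p" "z = N \<bullet> p" "x' = a \<bullet> q" "y' = b \<bullet> q" "z' = N \<bullet> q"
  have p: "p = x *\<^sub>R a + y *\<^sub>R b + z *\<^sub>R N" and q: "q = x' *\<^sub>R a + y' *\<^sub>R b + z' *\<^sub>R N"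
    using frame_expansion by (auto simp: x_y_z_x'_y'_z'_def)
  have ba: "cross3 b a = N" and Nb: "cross3 N b = a" and aN: "cross3 a N = b"
    using cross_ab cross_bN cross_Na by (metis cross_skew minus_minus)+
  have "cross3 p q = - ((y * z' - z * y') *\<^sub>R a + (z * x' - x * z') *\<^sub>R b + (x * y' - y * x') *\<^sub>R N)"
    unfolding p q
    by (simp add: cross_add_left cross_add_right cross_mult_left cross_mult_right cross_ab cross_bN
        cross_Na ba Nb aN algebra_simps)
  then show ?thesis
    by (simp only: inner_add_left inner_minus_left inner_scaleR_left x_y_z_x'_y'_z'_def) (simp add: algebra_simps)
qed

definition stereo :: "real^3 \<Rightarrow> complex" where
  "stereo p = Complex ((a \<bullet> p) / (1 - N \<bullet> p)) ((b \<bullet> p) / (1 - N \<bullet> p))"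

lemma stereo_denominator: assumes "norm p = 1" "p \<noteq> N" shows "N \<bullet> p < 1"
proof -
  have "norm N = 1" using inner_NN by (simp add: norm_eq_1)
  then have "N \<bullet> p \<le> 1" using norm_cauchy_schwarz[of N p] assms(1) by simp
  moreover have "N \<bullet> p \<noteq> 1"
  proof
    assume "N \<bullet> p = 1"
    then have "(p - N) \<bullet> (p - N) = 0"
      using assms(1) inner_NN by (simp add: inner_diff_left inner_diff_right inner_commute norm_eq_1)
    then show False using assms(2) by simp
  qed
  ultimately show ?thesis by simp
qed

lemma continuous_on_stereo: "continuous_on (sphere 0 1 - {N}) stereo"
proof -
  have "N \<bullet> p \<noteq> 1" if "p \<in> sphere 0 1 - {N}" for p
    using stereo_denominator[of p] that by auto
  then have "continuous_on (sphere 0 1 - {N})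
     (\<lambda>p. complex_of_real ((a \<bullet> p) / (1 - N \<bullet> p)) + \<i> * complex_of_real ((b \<bullet> p) / (1 - N \<bullet> p)))"
    by (intro continuous_intros) auto
  then show ?thesis unfolding stereo_def Complex_eq by simp
qed

lemma unit_frame: "norm p = 1 \<Longrightarrow> (a \<bullet> p)\<^sup>2 + (b \<bullet> p)\<^sup>2 + (N \<bullet> p)\<^sup>2 = 1"
  using inner_frame[of p p] by (simp add: norm_eq_1 power2_eq_square)

text \<open>With x, y the coordinates of the image and d = 1 - N \<bullet> p, the equation of the
  sphere becomes (x^2 + y^2 + 1) d = 2. So the image determines d and then the point.\<close>

lemma inj_on_stereo: "inj_on stereo (sphere 0 1 - {N})"
proof (rule inj_onI)
  fix p q assume pq: "p \<in> sphere 0 1 - {N}" "q \<in> sphere 0 1 - {N}" "stereo p = stereo q"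
  define d d' where "d = 1 - N \<bullet> p" "d' = 1 - N \<bullet> q"
  have d: "d > 0" "d' > 0" using stereo_denominator pq by (auto simp: d_d'_def)
  define x y where "x = (a \<bullet> p) / d" "y = (b \<bullet> p) / d"
  have p: "a \<bullet> p = x * d" "b \<bullet> p = y * d" "N \<bullet> p = 1 - d" using d by (auto simp: x_y_def d_d'_def)
  have q: "a \<bullet> q = x * d'" "b \<bullet> q = y * d'" "N \<bullet> q = 1 - d'"
    using pq(3) d by (auto simp: x_y_def d_d'_def stereo_def)
  have "(x * d)\<^sup>2 + (y * d)\<^sup>2 + (1 - d)\<^sup>2 = 1" "(x * d')\<^sup>2 + (y * d')\<^sup>2 + (1 - d')\<^sup>2 = 1"
    using unit_frame[of p] unit_frame[of q] pq p q by auto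
  then have "d * ((x\<^sup>2 + y\<^sup>2 + 1) * d - 2) = 0" "d' * ((x\<^sup>2 + y\<^sup>2 + 1) * d' - 2) = 0"
    by (simp_all add: power2_eq_square algebra_simps)
  then have "(x\<^sup>2 + y\<^sup>2 + 1) * d = (x\<^sup>2 + y\<^sup>2 + 1) * d'" using d by auto
  moreover have "x\<^sup>2 + y\<^sup>2 + 1 > 0" by (simp add: add_nonneg_pos)
  ultimately have "d = d'" by simp
  then show "p = q" using frame_expansion[of p] frame_expansion[of q] p q by simp
qed

text \<open>As |p - u|^2 = 2 - 2 (p \<bullet> u), the cap of radius \<open>r\<close> is where p
  \<bullet> u is at least \<open>1 - r\<^sup>2 / 2\<close>, and the first assumption in
  \<open>r\<close> puts \<open>N\<close> outside of it. The circle then maps to a circle and the cap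
  to its inside.\<close>

lemma stereo_circle:
  assumes u: "norm u = 1" and r: "N \<bullet> u < 1 - r\<^sup>2 / 2" "0 < r"
  obtains c R where
    "\<And>p. norm p = 1 \<Longrightarrow> p \<noteq> N \<Longrightarrow> dist p u = r \<Longrightarrow> (cmod (stereo p - c))\<^sup>2 = R"
    "\<And>p. norm p = 1 \<Longrightarrow> p \<noteq> N \<Longrightarrow> dist p u \<le> r \<Longrightarrow> (cmod (stereo p - c))\<^sup>2 \<le> R"
proof -
  define \<kappa> \<nu> where "\<kappa> = 1 - r\<^sup>2 / 2" "\<nu> = N \<bullet> u"
  have \<kappa>: "\<kappa> - \<nu> > 0" using r by (simp add: \<kappa>_\<nu>_def)
  \<comment> \<open>The center results from inserting the inverse projection into the plane p
    \<bullet> u = \<kappa> and completing the square. Identity \<open>key\<close> exhibits the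
    squared distance minus \<open>R\<close> as a positive multiple of \<kappa> - p \<bullet>
    u.\<close>
  define c where "c = Complex ((a \<bullet> u) / (\<kappa> - \<nu>)) ((b \<bullet> u) / (\<kappa> - \<nu>))"
  define R where "R = (cmod c)\<^sup>2 - (\<kappa> + \<nu>) / (\<kappa> - \<nu>)"
  have key: "(cmod (stereo p - c))\<^sup>2 = 2 * (\<kappa> - p \<bullet> u) / ((1 - N \<bullet> p) * (\<kappa> - \<nu>)) + R"
    if p: "norm p = 1" "p \<noteq> N" for p
  proof -
    define X Y Z where "X = a \<bullet> p" "Y = b \<bullet> p" "Z = N \<bullet> p"
    define A B where "A = a \<bullet> u" "B = b \<bullet> u"
    have D: "1 - Z > 0" using stereo_denominator[OF p] by (simp add: X_Y_Z_def)
    have s: "p \<bullet> u = X * A + Y * B + Z * \<nu>" by (subst inner_frame) (simp add: X_Y_Z_def A_B_def \<kappa>_\<nu>_def)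
    have XYZ: "X\<^sup>2 + Y\<^sup>2 = (1 - Z) * (1 + Z)"
      using unit_frame[OF p(1)] by (simp add: X_Y_Z_def power2_eq_square algebra_simps)
    have "(cmod (stereo p - c))\<^sup>2 = (X / (1 - Z) - A / (\<kappa> - \<nu>))\<^sup>2 + (Y / (1 - Z) - B / (\<kappa> - \<nu>))\<^sup>2"
      by (simp add: stereo_def c_def cmod_power2 X_Y_Z_def A_B_def)
    also have "\<dots> = (X\<^sup>2 + Y\<^sup>2) / (1 - Z)\<^sup>2 - 2 * (X * A + Y * B) / ((1 - Z) * (\<kappa> - \<nu>))
        + ((A / (\<kappa> - \<nu>))\<^sup>2 + (B / (\<kappa> - \<nu>))\<^sup>2)"
      by (simp add: power2_diff power_divide add_divide_distrib algebra_simps)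
    also have "(A / (\<kappa> - \<nu>))\<^sup>2 + (B / (\<kappa> - \<nu>))\<^sup>2 = (cmod c)\<^sup>2"
      by (simp add: c_def cmod_power2 A_B_def)
    also have "(X\<^sup>2 + Y\<^sup>2) / (1 - Z)\<^sup>2 = (1 + Z) / (1 - Z)"
      using D unfolding XYZ by (simp add: power2_eq_square)
    also have "(1 + Z) / (1 - Z) - 2 * (X * A + Y * B) / ((1 - Z) * (\<kappa> - \<nu>)) =
       2 * (\<kappa> - p \<bullet> u) / ((1 - Z) * (\<kappa> - \<nu>)) - (\<kappa> + \<nu>) / (\<kappa> - \<nu>)"
    proof -
      have "(1 + Z) / (1 - Z) = (1 + Z) * (\<kappa> - \<nu>) / ((1 - Z) * (\<kappa> - \<nu>))"
        "(\<kappa> + \<nu>) / (\<kappa> - \<nu>) = (1 - Z) * (\<kappa> + \<nu>) / ((1 - Z) * (\<kappa> - \<nu>))"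
        using D \<kappa> by auto
      then show ?thesis
        unfolding s by (simp only: diff_divide_distrib[symmetric]) (simp add: algebra_simps)
    qed
    finally show ?thesis by (simp add: R_def X_Y_Z_def)
  qed
  have ds: "(dist p u)\<^sup>2 = 2 - 2 * (p \<bullet> u)" if "norm p = 1" for p
    using that u by (simp add: dist_norm power2_norm_eq_inner inner_diff_left inner_diff_right
        inner_commute norm_eq_1)
  show thesis
  proof
    fix p :: "real^3" assume p: "norm p = 1" "p \<noteq> N"
    { assume "dist p u = r"
      then have "p \<bullet> u = \<kappa>" using ds[OF p(1)] by (simp add: \<kappa>_\<nu>_def field_simps)
      then show "(cmod (stereo p - c))\<^sup>2 = R" using key[OF p] by simp }
    { assume "dist p u \<le> r"
      then have "(dist p u)\<^sup>2 \<le> r\<^sup>2" by (intro power_mono) auto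
      then have "\<kappa> - p \<bullet> u \<le> 0" using ds[OF p(1)] by (simp add: \<kappa>_\<nu>_def field_simps)
      moreover have "(1 - N \<bullet> p) * (\<kappa> - \<nu>) > 0" using stereo_denominator[OF p] \<kappa> by simp
      ultimately have "2 * (\<kappa> - p \<bullet> u) / ((1 - N \<bullet> p) * (\<kappa> - \<nu>)) \<le> 0"
        by (intro divide_nonpos_pos) auto
      then show "(cmod (stereo p - c))\<^sup>2 \<le> R" using key[OF p] by simp }
  qed
qed

text \<open>Projection from \<open>N\<close> is a central projection, so up to positive denominators
  the planar orientation is the determinant of the three vectors p i - N, that is, n \<bullet> (p 1
  - N) for the normal \<open>n\<close> of the plane through the points. All points have the same
  inner product with \<open>u\<close>, hence \<open>n\<close> is a multiple of
  \<open>u\<close>.\<close>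

lemma stereo_orientation:
  assumes u: "norm u = 1" and r: "N \<bullet> u < 1 - r\<^sup>2 / 2"
    and p: "\<And>i. i \<in> {1, 2, 3::nat} \<Longrightarrow> norm (p i) = 1 \<and> p i \<noteq> N \<and> dist (p i) u = r"
  obtains k where "k > 0" "Im (cnj (stereo (p 2) - stereo (p 1)) * (stereo (p 3) - stereo (p 1))) =
      k * (cross3 (p 2 - p 1) (p 3 - p 1) \<bullet> u)"
proof -
  define n where "n = cross3 (p 2 - p 1) (p 3 - p 1)"
  define \<kappa> where "\<kappa> = 1 - r\<^sup>2 / 2"
  have pu: "p i \<bullet> u = \<kappa>" if "i \<in> {1, 2, 3::nat}" for i
  proof -
    have "(dist (p i) u)\<^sup>2 = 2 - 2 * (p i \<bullet> u)"
      unfolding dist_norm power2_norm_eq_inner using p[OF that] u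
      by (simp add: inner_diff_left inner_diff_right inner_commute norm_eq_1)
    then show ?thesis using p[OF that] by (simp add: \<kappa>_def field_simps)
  qed
  have "cross3 u n = 0"
    using pu by (simp add: n_def Lagrange inner_diff_right inner_commute)
  then have "cross3 u (cross3 u n) = 0" by simp
  then have "(u \<bullet> n) *\<^sub>R u = (u \<bullet> u) *\<^sub>R n" by (simp add: Lagrange)
  then have n: "n = (n \<bullet> u) *\<^sub>R u" using u by (simp add: norm_eq_1 inner_commute)
  then have "n \<bullet> (p 1 - N) = (n \<bullet> u) * (u \<bullet> (p 1 - N))" by (metis inner_scaleR_left)
  then have n1: "n \<bullet> (p 1 - N) = (n \<bullet> u) * (\<kappa> - N \<bullet> u)"
    using pu by (simp add: inner_diff_right inner_commute)
  define X Y D where "X i = a \<bullet> p i" and "Y i = b \<bullet> p i" and "D i = 1 - N \<bullet> p i" for i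
  have D: "D i > 0" if "i \<in> {1, 2, 3}" for i
    using stereo_denominator p[OF that] by (simp add: D_def)
  have N: "N \<bullet> p i = 1 - D i" for i by (simp add: D_def)
  have det: "n \<bullet> (p 1 - N) =
     X 1 * (Y 2 * D 3 - D 2 * Y 3) - Y 1 * (X 2 * D 3 - D 2 * X 3) + D 1 * (X 2 * Y 3 - Y 2 * X 3)"
    unfolding n_def triple_frame inner_diff_right N inner_aN inner_bN inner_NN
      X_def[symmetric] Y_def[symmetric]
    by (simp add: algebra_simps)
  have st: "stereo (p i) = Complex (X i / D i) (Y i / D i)" for i
    by (simp add: stereo_def X_def Y_def D_def)
  have "Im (cnj (stereo (p 2) - stereo (p 1)) * (stereo (p 3) - stereo (p 1))) =
     (X 2 / D 2 - X 1 / D 1) * (Y 3 / D 3 - Y 1 / D 1) - (Y 2 / D 2 - Y 1 / D 1) * (X 3 / D 3 - X 1 / D 1)"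
    by (simp add: st algebra_simps)
  also have "\<dots> = (n \<bullet> (p 1 - N)) / (D 1 * D 2 * D 3)"
    using D[of 1] D[of 2] D[of 3] unfolding det by (simp add: field_simps)
  also have "\<dots> = (\<kappa> - N \<bullet> u) / (D 1 * D 2 * D 3) * (n \<bullet> u)" unfolding n1 by simp
  finally have "Im (cnj (stereo (p 2) - stereo (p 1)) * (stereo (p 3) - stereo (p 1))) =
    (\<kappa> - N \<bullet> u) / (D 1 * D 2 * D 3) * (n \<bullet> u)" .
  moreover have "(\<kappa> - N \<bullet> u) / (D 1 * D 2 * D 3) > 0"
    using D[of 1] D[of 2] D[of 3] r by (simp add: \<kappa>_def)
  ultimately show thesis using that unfolding n_def by blast
qed

lemma arcs_do_not_cover_sphere:
  assumes "finite \<A>" "\<And>A. A \<in> \<A> \<Longrightarrow> \<exists>g :: real \<Rightarrow> real^3. arc g \<and> A = path_image g"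
  shows "\<not> sphere 0 1 \<subseteq> \<Union>\<A>"
proof
  assume cover: "sphere 0 1 \<subseteq> \<Union>\<A>"
  define \<psi> where "\<psi> w = Re w *\<^sub>R a + Im w *\<^sub>R b + sqrt (1 - (cmod w)\<^sup>2) *\<^sub>R N" for w
  have \<psi>a: "a \<bullet> \<psi> w = Re w" and \<psi>b: "b \<bullet> \<psi> w = Im w" and \<psi>N: "N \<bullet> \<psi> w = sqrt (1 - (cmod w)\<^sup>2)" for w
    by (simp_all add: \<psi>_def inner_add_right inner_aa inner_bb inner_NN inner_ab inner_aN inner_bN
        inner_commute[of b a] inner_commute[of N a] inner_commute[of N b])
  have inj: "inj_on \<psi> S" for S
    by (intro inj_onI complex_eqI) (metis \<psi>a \<psi>b)+
  have cont: "continuous_on S \<psi>" for S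
    unfolding \<psi>_def by (intro continuous_intros)
  have sph: "\<psi> w \<in> sphere 0 1" if "w \<in> cball 0 1" for w
  proof -
    have "(cmod w)\<^sup>2 \<le> 1" using that by (simp add: power_le_one)
    moreover have "\<psi> w \<bullet> \<psi> w = (Re w)\<^sup>2 + (Im w)\<^sup>2 + (sqrt (1 - (cmod w)\<^sup>2))\<^sup>2"
      by (subst inner_frame) (simp add: \<psi>a \<psi>b \<psi>N power2_eq_square)
    ultimately show ?thesis by (simp add: norm_eq_1 cmod_power2)
  qed
  define P where "P A = {w \<in> cball 0 1. \<psi> w \<in> A}" for A
  have P: "closed (P A) \<and> interior (P A) = {}" if A: "A \<in> \<A>" for A
  proof -
    obtain g where g: "arc g" "A = path_image g" using assms(2)[OF A] by blast
    have "P A = cball 0 1 \<inter> \<psi> -` A" by (auto simp: P_def)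
    moreover have "closed A" using g by (simp add: closed_arc_image)
    ultimately have "closed (P A)" using continuous_closed_preimage[OF cont closed_cball] by metis
    moreover have "bounded (P A)" by (rule bounded_subset[OF bounded_cball[of 0 1]]) (auto simp: P_def)
    ultimately have comp: "compact (P A)" by (simp add: compact_eq_bounded_closed)
    obtain h where h: "homeomorphism {0..1} (path_image g) g h"
      using homeomorphism_arc[OF g(1)] by blast
    have sub: "\<psi> ` P A \<subseteq> path_image g" using g by (auto simp: P_def)
    have "P A homeomorphic \<psi> ` P A" by (rule homeomorphic_compact[OF comp cont refl inj])
    moreover have "\<psi> ` P A homeomorphic h ` \<psi> ` P A"
    proof (rule homeomorphic_compact[OF _ _ refl])
      show "compact (\<psi> ` P A)" by (rule compact_continuous_image[OF cont comp])
      show "continuous_on (\<psi> ` P A) h"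
        using continuous_on_subset[OF homeomorphism_cont2[OF h] sub] .
      show "inj_on h (\<psi> ` P A)"
        by (rule inj_on_subset[OF _ sub], rule inj_on_inverseI[of _ g]) (use h in \<open>simp add: homeomorphism_def\<close>)
    qed
    ultimately have "P A homeomorphic h ` \<psi> ` P A" by (rule homeomorphic_trans)
    then have "interior (P A) = {}" by (rule empty_interior_lowdim_gen[rotated]) simp
    then show ?thesis using \<open>closed (P A)\<close> by blast
  qed
  have "closed (\<Union>(P ` \<B>)) \<and> interior (\<Union>(P ` \<B>)) = {}" if "\<B> \<subseteq> \<A>" for \<B>
    using finite_subset[OF that assms(1)] that
  proof (induction \<B> rule: finite_induct)
    case (insert A \<B>)
    have "interior (P A \<union> \<Union>(P ` \<B>)) = interior (P A)"
      by (rule interior_closed_Un_empty_interior) (use insert P in auto)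
    then show ?case using insert P[of A] by (simp add: closed_Un)
  qed simp
  then have "interior (\<Union>(P ` \<A>)) = {}" by blast
  moreover have "cball 0 1 \<subseteq> \<Union>(P ` \<A>)" using cover sph unfolding P_def by blast
  then have "interior (cball 0 1) \<subseteq> interior (\<Union>(P ` \<A>))" by (rule interior_mono)
  ultimately show False by auto
qed

end

lemma orthonormal_frame_exists:
  assumes "norm N = 1" obtains a b where "orthonormal_frame a b N"
proof -
  obtain a0 :: "real^3" where a0: "a0 \<noteq> 0" "orthogonal N a0"
    using orthogonal_to_vector_exists[of N] by auto
  define a where "a = a0 /\<^sub>R norm a0"
  have aa: "a \<bullet> a = 1" using a0(1) by (simp add: a_def power2_norm_eq_inner[symmetric] power2_eq_square field_simps)
  have aN: "a \<bullet> N = 0" using a0(2) by (simp add: a_def orthogonal_def inner_commute)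
  have NN: "N \<bullet> N = 1" using assms by (simp add: norm_eq_1)
  define b where "b = cross3 a N"
  have "norm b ^ 2 = 1" unfolding b_def norm_cross using aa aN assms by (simp add: power2_norm_eq_inner)
  then have bb: "b \<bullet> b = 1" by (simp add: power2_norm_eq_inner)
  have "cross3 a b = - N" unfolding b_def Lagrange by (simp add: aa aN)
  moreover have "a \<bullet> b = 0" "b \<bullet> N = 0" by (simp_all add: b_def dot_cross_self)
  ultimately show thesis using that aa aN NN bb by (simp add: orthonormal_frame_def)
qed

section \<open>Pairs of arcs from a common point\<close>

text \<open>The difference divided by 2 pi i is continuous with integer values, hence constant on a
  connected set.\<close>

lemma log_unique:
  fixes f g :: "'a::topological_space \<Rightarrow> complex"
  assumes "connected S" "continuous_on S f" "continuous_on S g"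
    and eq: "\<And>x. x \<in> S \<Longrightarrow> exp (f x) = exp (g x)"
  obtains n :: int where "\<And>x. x \<in> S \<Longrightarrow> f x = g x + 2 * pi * n * \<i>"
proof -
  define k where "k x = (f x - g x) / (2 * pi * \<i>)" for x
  have int: "\<exists>n::int. k x = of_int n" if x: "x \<in> S" for x
  proof -
    obtain n :: int where "f x = g x + (of_int (2 * n) * pi) * \<i>" using eq[OF x] exp_eq by blast
    then show ?thesis by (intro exI[of _ n]) (simp add: k_def field_simps)
  qed
  have "k constant_on S"
  proof (rule continuous_discrete_range_constant[OF assms(1)])
    show "continuous_on S k" unfolding k_def using assms(2,3) by (intro continuous_intros) auto
    show "\<exists>e>0. \<forall>y. y \<in> S \<and> k y \<noteq> k x \<longrightarrow> e \<le> cmod (k y - k x)" if x: "x \<in> S" for x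
    proof (intro exI[of _ 1] conjI allI impI)
      fix y assume y: "y \<in> S \<and> k y \<noteq> k x"
      then obtain m n :: int where mn: "k y = of_int m" "k x = of_int n" using int x by metis
      then have "m \<noteq> n" using y by auto
      moreover have "cmod (k y - k x) = \<bar>real_of_int (m - n)\<bar>"
        unfolding mn by (simp only: of_int_diff[symmetric] norm_of_int)
      ultimately show "1 \<le> cmod (k y - k x)" by simp
    qed simp
  qed
  then obtain c where c: "\<And>x. x \<in> S \<Longrightarrow> k x = c" unfolding constant_on_def by blast
  have "\<exists>n::int. \<forall>x\<in>S. k x = of_int n"
  proof (cases "S = {}")
    case False
    then obtain x where "x \<in> S" by blast
    then show ?thesis using int[of x] c by auto
  qed simp
  then obtain n :: int where n: "\<And>x. x \<in> S \<Longrightarrow> k x = of_int n" by blast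
  show thesis
  proof (rule that)
    fix x assume "x \<in> S"
    then show "f x = g x + 2 * pi * n * \<i>" using n[of x] by (simp add: k_def field_simps)
  qed
qed

text \<open>Two curves that leave \<open>u\<close> and do not meet again. They need not have
  directions at \<open>u\<close>; the logarithms \<open>a\<close>, \<open>b\<close> of their
  positions relative to \<open>u\<close>, on intervals open at 0, take the place of
  directions.\<close>

locale two_arcs =
  fixes \<alpha> \<beta> a b :: "real \<Rightarrow> complex" and u :: complex and \<sigma> \<tau> :: real
  assumes \<sigma>: "0 < \<sigma>" and \<tau>: "0 < \<tau>"
    and cont_\<alpha>: "continuous_on {0..\<sigma>} \<alpha>" and cont_\<beta>: "continuous_on {0..\<tau>} \<beta>"
    and start: "\<alpha> 0 = u" "\<beta> 0 = u"
    and disjoint: "\<And>s t. \<lbrakk>0 \<le> s; s \<le> \<sigma>; 0 \<le> t; t \<le> \<tau>; \<alpha> s = \<beta> t\<rbrakk> \<Longrightarrow> s = 0 \<and> t = 0"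
    and cont_a: "continuous_on {0<..\<sigma>} a" and exp_a: "\<And>s. \<lbrakk>0 < s; s \<le> \<sigma>\<rbrakk> \<Longrightarrow> exp (a s) = \<alpha> s - u"
    and cont_b: "continuous_on {0<..\<tau>} b" and exp_b: "\<And>t. \<lbrakk>0 < t; t \<le> \<tau>\<rbrakk> \<Longrightarrow> exp (b t) = \<beta> t - u"
begin

definition box :: "(real \<times> real) set" where "box = {0..\<sigma>} \<times> {0..\<tau>} - {(0, 0)}"

text \<open>\<open>m\<close> is the number of turns by which \<open>b\<close> has to be corrected for the direction of \<open>\<beta>\<close> to lie
  between the direction of \<open>\<alpha>\<close> and one full turn further.\<close>

definition linking_log :: "(real \<Rightarrow> real \<Rightarrow> complex) \<Rightarrow> int \<Rightarrow> bool" where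
  "linking_log B m \<longleftrightarrow> continuous_on box (\<lambda>(s, t). B s t) \<and>
     (\<forall>(s, t)\<in>box. exp (B s t) = \<beta> t - \<alpha> s) \<and>
     (\<forall>s. 0 < s \<longrightarrow> s \<le> \<sigma> \<longrightarrow> B s 0 = a s + pi * \<i>) \<and>
     (\<forall>t. 0 < t \<longrightarrow> t \<le> \<tau> \<longrightarrow> B 0 t = b t + 2 * pi * m * \<i>)"

text \<open>A rectangle without one corner is convex, so the nonvanishing difference of the curves
  has a logarithm on it. On the side t = 0 the difference is - (\<alpha> s - u), which fixes the
  normalization; the integer left over on the side s = 0 is \<open>m\<close>.\<close>

lemma linking_log_exists: obtains B m where "linking_log B m"
proof -
  have box: "box = {0..\<sigma>} \<times> {0..\<tau>} \<inter> {x. (1, 1) \<bullet> x > 0}" unfolding box_def by auto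
  have "convex box" unfolding box
    by (intro convex_Int convex_Times convex_halfspace_gt) auto
  then have contr: "contractible box" by (rule convex_imp_contractible)
  have cont: "continuous_on box (\<lambda>(s, t). \<beta> t - \<alpha> s)"
  proof -
    have "continuous_on box (\<lambda>x. \<beta> (snd x) - \<alpha> (fst x))"
      by (intro continuous_on_diff continuous_on_compose2[OF cont_\<beta>] continuous_on_compose2[OF cont_\<alpha>]
          continuous_intros) (auto simp: box_def)
    then show ?thesis by (simp add: case_prod_unfold)
  qed
  have nz: "(\<lambda>(s, t). \<beta> t - \<alpha> s) x \<noteq> 0" if "x \<in> box" for x
    using that disjoint[of "fst x" "snd x"] by (cases x) (auto simp: box_def)
  obtain L where L: "continuous_on box L" "\<And>x. x \<in> box \<Longrightarrow> (\<lambda>(s, t). \<beta> t - \<alpha> s) x = exp (L x)"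
    using continuous_logarithm_on_contractible[OF cont contr nz] by metis
  have contL: "continuous_on X (\<lambda>x. L (f x, g x))"
    if "continuous_on X f" "continuous_on X g" "\<And>x. x \<in> X \<Longrightarrow> (f x, g x) \<in> box" for X and f g :: "real \<Rightarrow> real"
    by (rule continuous_on_compose2[OF L(1)]) (use that in \<open>auto intro!: continuous_intros\<close>)
  obtain n :: int where n: "\<And>s. s \<in> {0<..\<sigma>} \<Longrightarrow> L (s, 0) = (a s + pi * \<i>) + 2 * pi * n * \<i>"
  proof (rule log_unique[of "{0<..\<sigma>}" "\<lambda>s. L (s, 0)" "\<lambda>s. a s + pi * \<i>"])
    show "continuous_on {0<..\<sigma>} (\<lambda>s. L (s, 0))"
      by (intro contL continuous_intros) (use \<tau> in \<open>auto simp: box_def\<close>)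
    show "continuous_on {0<..\<sigma>} (\<lambda>s. a s + pi * \<i>)" by (intro continuous_intros cont_a)
    show "exp (L (s, 0)) = exp (a s + pi * \<i>)" if "s \<in> {0<..\<sigma>}" for s
      using L(2)[of "(s, 0)"] exp_a[of s] start that \<tau> by (auto simp: box_def exp_add mult.commute)
  qed auto
  obtain k :: int where k: "\<And>t. t \<in> {0<..\<tau>} \<Longrightarrow> L (0, t) = b t + 2 * pi * k * \<i>"
  proof (rule log_unique[of "{0<..\<tau>}" "\<lambda>t. L (0, t)" b])
    show "continuous_on {0<..\<tau>} (\<lambda>t. L (0, t))"
      by (intro contL continuous_intros) (use \<sigma> in \<open>auto simp: box_def\<close>)
    show "exp (L (0, t)) = exp (b t)" if "t \<in> {0<..\<tau>}" for t
      using L(2)[of "(0, t)"] exp_b[of t] start that \<sigma> by (auto simp: box_def)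
  qed (auto intro: cont_b)
  define B where "B s t = L (s, t) - 2 * pi * n * \<i>" for s t
  have "linking_log B (k - n)"
    unfolding linking_log_def
  proof (intro conjI allI impI)
    have "continuous_on box (\<lambda>x. L x - 2 * pi * n * \<i>)" by (intro continuous_intros L(1))
    then show "continuous_on box (\<lambda>(s, t). B s t)" by (simp add: B_def case_prod_unfold)
    have "exp (2 * complex_of_real pi * of_int n * \<i>) = 1"
      by (auto simp: exp_eq_1 intro!: exI[of _ n])
    then show "\<forall>(s, t)\<in>box. exp (B s t) = \<beta> t - \<alpha> s"
      using L(2) by (fastforce simp: B_def exp_diff)
    show "B s 0 = a s + pi * \<i>" if "0 < s" "s \<le> \<sigma>" for s
      using n[of s] that by (simp add: B_def)
    show "B 0 t = b t + 2 * pi * (k - n) * \<i>" if "0 < t" "t \<le> \<tau>" for t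
      using k[of t] that by (simp add: B_def algebra_simps)
  qed
  then show thesis by (rule that)
qed

end

section \<open>Exit points of arcs from a disc\<close>

text \<open>An argument of \<open>p - c\<close> continued from a logarithm \<open>l\<close> of
  \<open>p - u\<close>. The center \<open>c\<close> of the projected circle is in general not the
  projected vertex \<open>u\<close>; the principal logarithm supplies the angle between the two
  vectors.\<close>

definition exit_angle :: "complex \<Rightarrow> complex \<Rightarrow> complex \<Rightarrow> complex \<Rightarrow> real" where
  "exit_angle c u p l = Im (l + Ln ((p - c) / (p - u)))"

text \<open>To leave the interval, \<open>f\<close> would have to pass through a zero of the
  cosine.\<close>

lemma cos_pos_bound:
  fixes f :: "real \<Rightarrow> real"
  assumes cont: "continuous_on {0..T} f" and cos: "\<And>t. t \<in> {0..T} \<Longrightarrow> cos (f t) > 0"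
    and "0 \<le> T" and f0: "\<bar>f 0\<bar> < pi / 2"
  shows "\<bar>f T\<bar> < pi / 2"
proof (rule ccontr)
  assume "\<not> \<bar>f T\<bar> < pi / 2"
  then have f0: "f 0 \<le> pi / 2" "- (pi / 2) \<le> f 0" using f0 by linarith+
  from \<open>\<not> \<bar>f T\<bar> < pi / 2\<close> consider "f T \<ge> pi / 2" | "f T \<le> - (pi / 2)" by linarith
  then show False
  proof cases
    case 1
    then obtain t where "t \<in> {0..T}" "f t = pi / 2"
      using IVT'[of f 0 "pi / 2" T, OF f0(1) 1 assms(3) cont] by auto
    then show False by (metis cos cos_pi_half less_irrefl)
  next
    case 2
    then obtain t where "t \<in> {0..T}" "f t = - (pi / 2)"
      using IVT2'[of f T "- (pi / 2)" 0, OF 2 f0(2) assms(3) cont] by auto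
    then show False by (metis cos cos_minus cos_pi_half less_irrefl)
  qed
qed

lemma inner_exp: "exp p \<bullet> exp q = exp (Re p + Re q) * cos (Im p - Im q)"
  by (simp add: inner_complex_def Re_exp Im_exp cos_diff exp_add algebra_simps)

lemma exit_angle:
  assumes l: "exp l = p - u" and pos: "(u - p) \<bullet> (c - p) > 0"
  shows "p - c = exp (l + Ln ((p - c) / (p - u)))" "\<bar>Im l - exit_angle c u p l\<bar> < pi / 2"
proof -
  have nz: "p \<noteq> u" "p \<noteq> c" using pos by auto
  then show "p - c = exp (l + Ln ((p - c) / (p - u)))"
    using l by (simp add: exp_add)
  have "Re ((p - c) / (p - u)) = ((u - p) \<bullet> (c - p)) / (cmod (p - u))\<^sup>2"
    by (simp add: Re_divide inner_complex_def cmod_power2 algebra_simps)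
  also have "\<dots> > 0" using pos nz by simp
  finally have "\<bar>Im (Ln ((p - c) / (p - u)))\<bar> < pi / 2"
    using Re_Ln_pos_lt[of "(p - c) / (p - u)"] nz by simp
  then show "\<bar>Im l - exit_angle c u p l\<bar> < pi / 2" by (simp add: exit_angle_def)
qed

context two_arcs
begin

text \<open>Start from the argument of \<beta> t - \<alpha> s for the two exit points. If the second
  point is moved back to \<open>u\<close> along \<beta>, the difference stays in the open half-plane
  around c - \<alpha> s, so the argument is within pi / 2 of the angle of \<alpha> s plus pi. Moving
  the first point along \<alpha> instead, it is within pi / 2 of the corrected angle of \<beta> t.
  Hence \<phi> differs from pi by less than pi.\<close>

lemma exit_angle_between:
  assumes B: "linking_log B m" and s: "0 < s" "s \<le> \<sigma>" and t: "0 < t" "t \<le> \<tau>"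
    and pos_\<alpha>: "\<And>t'. \<lbrakk>0 \<le> t'; t' \<le> t\<rbrakk> \<Longrightarrow> (\<beta> t' - \<alpha> s) \<bullet> (c - \<alpha> s) > 0"
    and pos_\<beta>: "\<And>s'. \<lbrakk>0 \<le> s'; s' \<le> s\<rbrakk> \<Longrightarrow> (\<alpha> s' - \<beta> t) \<bullet> (c - \<beta> t) > 0"
  defines "\<phi> \<equiv> exit_angle c u (\<beta> t) (b t) + 2 * pi * m - exit_angle c u (\<alpha> s) (a s)"
  shows "0 < \<phi>" "\<phi> < 2 * pi"
proof -
  have contB: "continuous_on box (\<lambda>(s, t). B s t)"
    and expB: "\<And>s t. (s, t) \<in> box \<Longrightarrow> exp (B s t) = \<beta> t - \<alpha> s"
    and Bs: "B s 0 = a s + pi * \<i>" and Bt: "B 0 t = b t + 2 * pi * m * \<i>"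
    using B s t unfolding linking_log_def by blast+
  define la lb where "la = a s + Ln ((\<alpha> s - c) / (\<alpha> s - u))" "lb = b t + Ln ((\<beta> t - c) / (\<beta> t - u))"
  have la: "\<alpha> s - c = exp la" "\<bar>Im (a s) - Im la\<bar> < pi / 2"
    using exit_angle[OF exp_a, of s c] pos_\<alpha>[of 0] s t start by (auto simp: la_lb_def exit_angle_def)
  have lb: "\<beta> t - c = exp lb" "\<bar>Im (b t) - Im lb\<bar> < pi / 2"
    using exit_angle[OF exp_b, of t c] pos_\<beta>[of 0] s t start by (auto simp: la_lb_def exit_angle_def)
  have la': "c - \<alpha> s = - exp la" and lb': "c - \<beta> t = - exp lb"
    using la(1) lb(1) by (metis minus_diff_eq)+
  have cosI: "cos x > 0" if "exp r * cos x > 0" for r x :: real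
    using that by (simp add: zero_less_mult_iff)
  have "\<bar>Im (B s t) - Im la - pi\<bar> < pi / 2"
  proof (rule cos_pos_bound[of t "\<lambda>t'. Im (B s t') - Im la - pi"])
    have "continuous_on {0..t} (\<lambda>t'. (\<lambda>(s, t). B s t) (s, t'))"
      by (rule continuous_on_compose2[OF contB]) (use s t in \<open>auto simp: box_def intro!: continuous_intros\<close>)
    then show "continuous_on {0..t} (\<lambda>t'. Im (B s t') - Im la - pi)"
      by (auto intro!: continuous_intros)
    show "cos (Im (B s t') - Im la - pi) > 0" if "t' \<in> {0..t}" for t'
    proof -
      have "exp (B s t') \<bullet> (- exp la) > 0"
        using pos_\<alpha>[of t'] that expB[of s t'] s t unfolding la' by (simp add: box_def)
      then have "exp (Re (B s t') + Re la) * cos (Im (B s t') - Im la - pi) > 0"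
        by (simp add: inner_exp)
      then show ?thesis by (rule cosI)
    qed
    show "\<bar>Im (B s 0) - Im la - pi\<bar> < pi / 2" using la(2) by (simp add: Bs)
  qed (use t in simp)
  moreover have "\<bar>Im (B s t) - (Im lb + 2 * pi * m)\<bar> < pi / 2"
  proof (rule cos_pos_bound[of s "\<lambda>s'. Im (B s' t) - (Im lb + 2 * pi * m)"])
    have "continuous_on {0..s} (\<lambda>s'. (\<lambda>(s, t). B s t) (s', t))"
      by (rule continuous_on_compose2[OF contB]) (use s t in \<open>auto simp: box_def intro!: continuous_intros\<close>)
    then show "continuous_on {0..s} (\<lambda>s'. Im (B s' t) - (Im lb + 2 * pi * m))"
      by (auto intro!: continuous_intros)
    show "cos (Im (B s' t) - (Im lb + 2 * pi * m)) > 0" if "s' \<in> {0..s}" for s'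
    proof -
      have "\<alpha> s' - \<beta> t = - exp (B s' t)" using expB[of s' t] that s t by (simp add: box_def)
      then have "(- exp (B s' t)) \<bullet> (- exp lb) > 0"
        using pos_\<beta>[of s'] that unfolding lb' by simp
      then have "exp (Re (B s' t) + Re lb) * cos (Im (B s' t) - Im lb) > 0"
        by (simp add: inner_exp)
      then have "cos (Im (B s' t) - Im lb) > 0" by (rule cosI)
      moreover have "cos (Im (B s' t) - (Im lb + 2 * pi * m)) = cos (Im (B s' t) - Im lb)"
        using cos_int_2pin[of m] sin_int_2pin[of m]
        by (simp add: cos_diff cos_add sin_add mult.commute mult.left_commute)
      ultimately show ?thesis by simp
    qed
    show "\<bar>Im (B 0 t) - (Im lb + 2 * pi * m)\<bar> < pi / 2" using lb(2) by (simp add: Bt)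
  qed (use s in simp)
  moreover have "\<phi> = Im lb + 2 * pi * m - Im la" by (simp add: \<phi>_def exit_angle_def la_lb_def)
  ultimately show "0 < \<phi>" "\<phi> < 2 * pi" by linarith+
qed

end

text \<open>A continuous branch of the square root of \<open>(p - pathstart \<beta>) * (p - pathfinish \<beta>)\<close> off \<open>\<beta>\<close>.\<close>

definition root_branch :: "(real \<Rightarrow> complex) \<Rightarrow> complex \<Rightarrow> complex" where
  "root_branch \<beta> p = (p - pathstart \<beta>) * exp (pi * \<i> * winding_number \<beta> p)"

lemma root_branch_square:
  assumes "path \<beta>" "p \<notin> path_image \<beta>"
  shows "(root_branch \<beta> p)\<^sup>2 = (p - pathstart \<beta>) * (p - pathfinish \<beta>)"
proof -
  have "(exp (pi * \<i> * winding_number \<beta> p))\<^sup>2 = exp (2 * pi * \<i> * winding_number \<beta> p)"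
    by (simp add: exp_double[symmetric] mult_ac)
  then have "(root_branch \<beta> p)\<^sup>2 = (p - pathstart \<beta>)\<^sup>2 * exp (2 * pi * \<i> * winding_number \<beta> p)"
    by (simp add: root_branch_def power_mult_distrib)
  also have "\<dots> = (p - pathstart \<beta>) * - (exp (2 * pi * \<i> * winding_number \<beta> p) * (pathstart \<beta> - p))"
    by (simp add: power2_eq_square algebra_simps)
  finally show ?thesis unfolding winding_number_exp_2pi[OF assms, symmetric] by simp
qed

text \<open>\<open>E * E\<close> is the quotient of the differences to the two ends, so multiplying
  by \<open>E\<close> at one end is dividing by \<open>E\<close> at the other. The root therefore
  belongs to the undirected edge.\<close>

lemma root_branch_reversepath:
  assumes "path \<beta>" "p \<notin> path_image \<beta>"
  shows "root_branch (reversepath \<beta>) p = root_branch \<beta> p"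
proof -
  define E where "E = exp (pi * \<i> * winding_number \<beta> p)"
  have "E \<noteq> 0" by (simp add: E_def)
  have "E * E = exp (2 * pi * \<i> * winding_number \<beta> p)" by (simp add: E_def exp_add[symmetric] mult_ac)
  then have "pathfinish \<beta> - p = E * E * (pathstart \<beta> - p)"
    using winding_number_exp_2pi[OF assms] by simp
  then have "(p - pathfinish \<beta>) / E = (p - pathstart \<beta>) * E"
    using \<open>E \<noteq> 0\<close> by (simp add: field_simps)
  then show ?thesis
    using assms by (simp add: root_branch_def winding_number_reversepath exp_minus E_def divide_inverse)
qed

lemma continuous_at_root_branch:
  assumes "path \<beta>" "p \<notin> path_image \<beta>"
  shows "continuous (at p) (root_branch \<beta>)"
  unfolding root_branch_def using continuous_at_winding_number[OF assms]
  by (intro continuous_intros)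

context two_arcs
begin

text \<open>The winding number around \<alpha> s is the increment of \<open>B s\<close> along
  \<beta>, which makes the quotient equal to exp ((B s 1 - pi i) / 2) already for s > 0. The limit
  then only uses continuity of \<open>B\<close>, and \<open>m\<close> enters through its parity. The
  winding number needs the whole path \<beta>, hence \<tau> = 1.\<close>

lemma root_branch_asymptotics:
  assumes B: "linking_log B m" and \<tau>1: "\<tau> = 1"
  shows "((\<lambda>s. root_branch \<beta> (\<alpha> s) / exp (a s / 2)) \<longlongrightarrow>
           exp ((b 1 - pi * \<i>) / 2 + pi * m * \<i>)) (at_right 0)"
proof -
  have contB: "continuous_on box (\<lambda>(s, t). B s t)"
    and expB: "\<And>s t. (s, t) \<in> box \<Longrightarrow> exp (B s t) = \<beta> t - \<alpha> s"
    and Bs: "\<And>s. 0 < s \<Longrightarrow> s \<le> \<sigma> \<Longrightarrow> B s 0 = a s + pi * \<i>"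
    and B1: "B 0 1 = b 1 + 2 * pi * m * \<i>"
    using B \<tau>1 unfolding linking_log_def by auto
  have in_box: "(s, t) \<in> box \<longleftrightarrow> 0 \<le> s \<and> s \<le> \<sigma> \<and> 0 \<le> t \<and> t \<le> 1 \<and> (s \<noteq> 0 \<or> t \<noteq> 0)" for s t
    unfolding box_def using \<tau>1 by auto
  have path: "path \<beta>" using cont_\<beta> \<tau>1 by (simp add: path_def)
  have "root_branch \<beta> (\<alpha> s) / exp (a s / 2) = exp ((B s 1 - pi * \<i>) / 2)" if s: "0 < s" "s \<le> \<sigma>" for s
  proof -
    have "\<alpha> s \<notin> path_image \<beta>"
    proof
      assume "\<alpha> s \<in> path_image \<beta>"
      then obtain t where "0 \<le> t" "t \<le> 1" "\<alpha> s = \<beta> t" by (auto simp: path_image_def)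
      then show False using disjoint[of s t] s \<tau>1 by simp
    qed
    then obtain q where q: "path q"
      "pathfinish q - pathstart q = 2 * of_real pi * \<i> * winding_number \<beta> (\<alpha> s)"
      "\<And>t. t \<in> {0..1} \<Longrightarrow> \<beta> t = \<alpha> s + exp (q t)"
      using winding_number_as_continuous_log[OF path] by metis
    obtain n :: int where n: "\<And>t. t \<in> {0..1} \<Longrightarrow> B s t = q t + 2 * pi * n * \<i>"
    proof (rule log_unique[of "{0..1}" "B s" q])
      have "continuous_on {0..1} (\<lambda>t'. (\<lambda>(s, t). B s t) (s, t'))"
        by (rule continuous_on_compose2[OF contB]) (use s in \<open>auto simp: in_box intro!: continuous_intros\<close>)
      then show "continuous_on {0..1} (B s)" by simp
      show "continuous_on {0..1} q" using q(1) by (simp add: path_def)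
      show "exp (B s t) = exp (q t)" if "t \<in> {0..1}" for t
        using expB[of s t] q(3)[OF that] that s by (auto simp: in_box)
    qed auto
    have "2 * of_real pi * \<i> * winding_number \<beta> (\<alpha> s) = B s 1 - (a s + pi * \<i>)"
      using n[of 0] n[of 1] Bs[OF s] unfolding q(2)[symmetric] pathfinish_def pathstart_def by simp
    then have w: "pi * \<i> * winding_number \<beta> (\<alpha> s) = (B s 1 - (a s + pi * \<i>)) / 2"
      by (simp add: field_simps)
    have "root_branch \<beta> (\<alpha> s) = exp (a s + (B s 1 - (a s + pi * \<i>)) / 2)"
      unfolding root_branch_def w using exp_a[OF s] start by (simp add: exp_add pathstart_def)
    also have "\<dots> = exp (a s / 2 + (B s 1 - pi * \<i>) / 2)"
      by (rule arg_cong[of _ _ exp]) (simp add: field_simps)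
    finally show ?thesis by (simp add: exp_add)
  qed
  then have ev: "\<forall>\<^sub>F s in at_right 0. exp ((B s 1 - pi * \<i>) / 2) = root_branch \<beta> (\<alpha> s) / exp (a s / 2)"
    using \<sigma> unfolding eventually_at_right_field by (intro exI[of _ \<sigma>]) auto
  have "continuous_on {0..\<sigma>} (\<lambda>s. (\<lambda>(s, t). B s t) (s, 1))"
    by (rule continuous_on_compose2[OF contB]) (auto simp: in_box intro!: continuous_intros)
  then have "((\<lambda>s. B s 1) \<longlongrightarrow> B 0 1) (at 0 within {0..\<sigma>})"
    using \<sigma> by (auto simp: continuous_on_def)
  then have "((\<lambda>s. B s 1) \<longlongrightarrow> B 0 1) (at_right 0)"
    using \<sigma> by (simp add: at_within_Icc_at_right)
  then have "((\<lambda>s. exp ((B s 1 - pi * \<i>) / 2)) \<longlongrightarrow> exp ((B 0 1 - pi * \<i>) / 2)) (at_right 0)"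
    by (intro tendsto_intros) auto
  moreover have "(B 0 1 - pi * \<i>) / 2 = (b 1 - pi * \<i>) / 2 + pi * m * \<i>"
    by (simp add: B1 field_simps)
  ultimately have "((\<lambda>s. exp ((B s 1 - pi * \<i>) / 2)) \<longlongrightarrow> exp ((b 1 - pi * \<i>) / 2 + pi * m * \<i>)) (at_right 0)"
    by simp
  then show ?thesis using ev by (rule Lim_transform_eventually)
qed

end

text \<open>The three gaps lie strictly between 0 and 2 pi and add up to a multiple of 2 pi, so
  going around through the three points takes one turn or two. The signed area tells these cases
  apart.\<close>

lemma circle_orientation:
  fixes \<theta>1 \<theta>2 \<theta>3 R :: real and m12 m23 m31 :: int
  assumes w: "w1 = c + R * cis \<theta>1" "w2 = c + R * cis \<theta>2" "w3 = c + R * cis \<theta>3" and R: "R \<noteq> 0"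
    and "0 < \<theta>2 - \<theta>1 + 2 * pi * m12" "\<theta>2 - \<theta>1 + 2 * pi * m12 < 2 * pi"
    and "0 < \<theta>3 - \<theta>2 + 2 * pi * m23" "\<theta>3 - \<theta>2 + 2 * pi * m23 < 2 * pi"
    and "0 < \<theta>1 - \<theta>3 + 2 * pi * m31" "\<theta>1 - \<theta>3 + 2 * pi * m31 < 2 * pi"
  shows "m12 + m23 + m31 = 1 \<and> Im (cnj (w2 - w1) * (w3 - w1)) > 0 \<or>
         m12 + m23 + m31 = 2 \<and> Im (cnj (w2 - w1) * (w3 - w1)) < 0"
proof -
  define x y z where "x = (\<theta>2 - \<theta>1 + 2 * pi * m12) / 2" "y = (\<theta>3 - \<theta>2 + 2 * pi * m23) / 2"
    "z = (\<theta>1 - \<theta>3 + 2 * pi * m31) / 2"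
  define M where "M = m12 + m23 + m31"
  have xyz: "x + y + z = pi * M" by (simp add: x_y_z_def M_def field_simps)
  have x: "0 < x" "x < pi" and y: "0 < y" "y < pi" and z: "0 < z" "z < pi"
    using assms(5-) by (auto simp: x_y_z_def)
  have "0 < pi * M" "pi * M < pi * 3" using x y z xyz by linarith+
  then have "0 < real_of_int M" "real_of_int M < 3" by (simp_all add: zero_less_mult_iff)
  then have M: "M = 1 \<or> M = 2" by linarith
  have per: "sin (\<theta> + 2 * pi * real_of_int m) = sin \<theta>" for \<theta> m
    using cos_int_2pin[of m] sin_int_2pin[of m] by (simp add: sin_add mult.commute mult.left_commute)
  have s: "sin (2 * x) = sin (\<theta>2 - \<theta>1)" "sin (2 * y) = sin (\<theta>3 - \<theta>2)" "sin (2 * z) = sin (\<theta>1 - \<theta>3)"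
  proof -
    have "2 * x = \<theta>2 - \<theta>1 + 2 * pi * m12" "2 * y = \<theta>3 - \<theta>2 + 2 * pi * m23"
      "2 * z = \<theta>1 - \<theta>3 + 2 * pi * m31" by (simp_all add: x_y_z_def)
    then show "sin (2 * x) = sin (\<theta>2 - \<theta>1)" "sin (2 * y) = sin (\<theta>3 - \<theta>2)" "sin (2 * z) = sin (\<theta>1 - \<theta>3)"
      by (simp_all only: per)
  qed
  have "Im (cnj (w2 - w1) * (w3 - w1)) = R\<^sup>2 * (sin (\<theta>2 - \<theta>1) + sin (\<theta>3 - \<theta>2) + sin (\<theta>1 - \<theta>3))"
    by (simp add: w sin_diff power2_eq_square algebra_simps)
  also have "\<dots> = R\<^sup>2 * (sin (2 * x) + sin (2 * y) + sin (2 * z))" by (simp add: s)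
  also have "sin (2 * x) + sin (2 * y) + sin (2 * z) =
      (if M = 1 then 4 else - 4) * (sin x * sin y * sin z)"
  proof -
    have "2 * z = - (2 * (x + y)) + 2 * pi * M" using xyz by simp
    then have "sin (2 * z) = sin (- (2 * (x + y)))" by (simp only: per)
    then have sz: "sin (2 * z) = - sin (2 * (x + y))" by (simp only: sin_minus)
    have z': "z = pi * M - (x + y)" using xyz by simp
    have "sin z = (if M = 1 then sin (x + y) else - sin (x + y))"
      using M unfolding z' by (auto simp: sin_diff)
    moreover have "sin (2 * x) + sin (2 * y) - sin (2 * (x + y)) = 4 * (sin x * sin y * sin (x + y))"
    proof -
      have sq: "1 - cos x * cos x = sin x * sin x" "1 - cos y * cos y = sin y * sin y"
        by (metis power2_eq_square sin_squared_eq)+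
      have "sin (2 * x) + sin (2 * y) - sin (2 * (x + y)) =
          2 * sin x * cos x * (1 - cos y * cos y + sin y * sin y) +
          2 * sin y * cos y * (1 - cos x * cos x + sin x * sin x)"
        unfolding sin_double sin_add cos_add by (simp add: algebra_simps)
      then show ?thesis unfolding sq sin_add by (simp add: algebra_simps)
    qed
    ultimately show ?thesis using sz by simp
  qed
  finally have Im: "Im (cnj (w2 - w1) * (w3 - w1)) =
     R\<^sup>2 * ((if M = 1 then 4 else - 4) * (sin x * sin y * sin z))" .
  have "sin x * sin y * sin z > 0" using sin_gt_zero x y z by simp
  then have "R\<^sup>2 * (sin x * sin y * sin z) > 0" using R by simp
  then show ?thesis using M unfolding Im M_def[symmetric] by (auto simp: mult_ac)
qed

section \<open>Rotation systems of plane cubic graphs\<close>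

lemma sphere_not_covered_by_arcs:
  assumes "finite \<A>" "\<And>A. A \<in> \<A> \<Longrightarrow> \<exists>g :: real \<Rightarrow> real^3. arc g \<and> A = path_image g"
  obtains N where "norm N = 1" "N \<notin> \<Union>\<A>"
proof -
  obtain a b where "orthonormal_frame a b (axis 1 1)"
    using orthonormal_frame_exists[of "axis 1 1"] by (auto simp: norm_axis_1)
  from orthonormal_frame.arcs_do_not_cover_sphere[OF this assms]
  obtain N :: "real^3" where "N \<in> sphere 0 1" "N \<notin> \<Union>\<A>" by blast
  then show thesis using that[of N] by simp
qed

text \<open>The hitting times form a closed set, so the infimum is attained, and by the intermediate
  value theorem the path cannot be farther away before. The time \<open>c\<close> is one at which
  the path is known to be outside.\<close>

lemma first_exit_time:
  fixes p :: "real \<Rightarrow> 'a::metric_space"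
  assumes cont: "continuous_on {0..1} p" and c: "0 \<le> c" "c \<le> 1" and r: "0 < r" "r < dist (p c) (p 0)"
  defines "\<tau> \<equiv> Inf {t \<in> {0..1}. dist (p t) (p 0) = r}"
  shows "0 < \<tau>" "\<tau> \<le> c" "dist (p \<tau>) (p 0) = r" "\<And>t. \<lbrakk>0 \<le> t; t \<le> \<tau>\<rbrakk> \<Longrightarrow> dist (p t) (p 0) \<le> r"
proof -
  define S where "S = {t \<in> {0..1}. dist (p t) (p 0) = r}"
  have contd: "continuous_on {0..1} (\<lambda>t. dist (p t) (p 0))" by (intro continuous_intros cont)
  have bdd: "bdd_below S" by (rule bdd_belowI[of _ 0]) (auto simp: S_def)
  have hit: "\<exists>t'. 0 \<le> t' \<and> t' \<le> t \<and> t' \<in> S" if t: "0 \<le> t" "t \<le> 1" "r \<le> dist (p t) (p 0)" for t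
  proof -
    have "continuous_on {0..t} (\<lambda>t. dist (p t) (p 0))" by (rule continuous_on_subset[OF contd]) (use t in auto)
    then obtain t' where "0 \<le> t'" "t' \<le> t" "dist (p t') (p 0) = r"
      using IVT'[of "\<lambda>t. dist (p t) (p 0)" 0 r t] t r by auto
    then show ?thesis using t by (intro exI[of _ t']) (auto simp: S_def)
  qed
  obtain t' where t': "t' \<le> c" "t' \<in> S" using hit[of c] c r by auto
  have "S = {0..1} \<inter> (\<lambda>t. dist (p t) (p 0)) -` {r}" by (auto simp: S_def)
  then have "closed S" using continuous_closed_preimage[OF contd, of "{r}"] by simp
  then have \<tau>: "\<tau> \<in> S" unfolding \<tau>_def S_def[symmetric]
    using closed_contains_Inf[OF _ bdd] t' by blast
  have lower: "\<tau> \<le> t" if "t \<in> S" for t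
    unfolding \<tau>_def S_def[symmetric] by (rule cInf_lower[OF that bdd])
  show "dist (p \<tau>) (p 0) = r" "\<tau> \<le> c" using \<tau> lower[OF t'(2)] t'(1) by (auto simp: S_def)
  have "\<tau> \<noteq> 0" using \<tau> r by (auto simp: S_def)
  then show "0 < \<tau>" using \<tau> by (auto simp: S_def)
  show "dist (p t) (p 0) \<le> r" if t: "0 \<le> t" "t \<le> \<tau>" for t
  proof (rule ccontr)
    assume far: "\<not> dist (p t) (p 0) \<le> r"
    then obtain t' where "0 \<le> t'" "t' \<le> t" "t' \<in> S" using hit[of t] t \<tau> by (auto simp: S_def)
    then have "t = \<tau>" using lower[of t'] t by simp
    then show False using far \<tau> by (simp add: S_def)
  qed
qed

section \<open>Strands of a plane cubic graph and where they meet\<close>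

fun opposite :: "'e \<times> bool \<Rightarrow> 'e \<times> bool" where
  "opposite (e, b) = (e, \<not> b)"

lemma opposite_simps [simp]: "fst (opposite h) = fst h" "opposite (opposite h) = h" "opposite h \<noteq> h"
  by (cases h; simp)+

lemma same_edge_cases: "fst h = fst k \<longleftrightarrow> k = h \<or> k = opposite h"
  by (cases h; cases k) auto

locale plane_cubic =
  fixes G :: "('v, 'e) mgraph" and \<Gamma> :: "('v, 'e) drawing"
  assumes finite_mgraph: "finite_mgraph G" and trivalent: "trivalent G" and plane: "plane_graph G \<Gamma>"
begin

abbreviation "H \<equiv> edges G \<times> (UNIV :: bool set)"

lemma opposite_in [simp]: "opposite h \<in> H \<longleftrightarrow> h \<in> H"
  by (cases h) auto

lemma vert_of_in_verts: "h \<in> H \<Longrightarrow> vert_of G h \<in> verts G"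
  using finite_mgraph by (cases h) (auto simp: finite_mgraph_def)

lemma fin: "finite (verts G)" "finite (edges G)"
  using finite_mgraph by (auto simp: finite_mgraph_def)

lemma strand_opposite: "strand \<Gamma> (opposite h) = reversepath (strand \<Gamma> h)"
  by (cases h) auto

lemma simple_path_strand: "h \<in> H \<Longrightarrow> simple_path (strand \<Gamma> h)"
  using plane by (cases h) (auto simp: plane_graph_def simple_path_reversepath)

lemma path_image_strand: "path_image (strand \<Gamma> h) = path_image (curve \<Gamma> (fst h))"
  by (cases h) auto

lemma strand_in_image: "s \<in> {0..1} \<Longrightarrow> strand \<Gamma> h s \<in> path_image (curve \<Gamma> (fst h))"
  using path_image_strand[of h] by (force simp: path_image_def)

lemma curve_at_vertices:
  "e \<in> edges G \<Longrightarrow> path_image (curve \<Gamma> e) \<inter> pos \<Gamma> ` verts G \<subseteq> pos \<Gamma> ` ends G e"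
  using plane unfolding plane_graph_def by blast

lemma strand_norm: "h \<in> H \<Longrightarrow> t \<in> {0..1} \<Longrightarrow> norm (strand \<Gamma> h t) = 1"
proof -
  assume h: "h \<in> H" and t: "t \<in> {0..1}"
  then have "strand \<Gamma> h t \<in> path_image (curve \<Gamma> (fst h))"
    unfolding path_image_strand[symmetric] by (simp add: path_image_def)
  moreover have "path_image (curve \<Gamma> (fst h)) \<subseteq> sphere 0 1"
    using plane h by (auto simp: plane_graph_def)
  ultimately show ?thesis by auto
qed

lemma strand_ends:
  assumes "h \<in> H"
  shows "strand \<Gamma> h 0 = pos \<Gamma> (vert_of G h)" "strand \<Gamma> h 1 = pos \<Gamma> (vert_of G (opposite h))"
proof -
  obtain e b where h: "h = (e, b)" by (cases h)
  then have "pathstart (curve \<Gamma> e) = pos \<Gamma> (source G e)" "pathfinish (curve \<Gamma> e) = pos \<Gamma> (target G e)"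
    using plane assms by (simp_all add: plane_graph_def)
  then show "strand \<Gamma> h 0 = pos \<Gamma> (vert_of G h)" "strand \<Gamma> h 1 = pos \<Gamma> (vert_of G (opposite h))"
    by (cases b; simp add: h pathstart_def pathfinish_def reversepath_def)+
qed

lemma strand_inj:
  assumes "h \<in> H" "s \<in> {0..1}" "t \<in> {0..1}" "strand \<Gamma> h s = strand \<Gamma> h t"
  shows "s = t \<or> s = 0 \<and> t = 1 \<or> s = 1 \<and> t = 0"
  using simple_path_strand[OF assms(1)] assms(2-4) unfolding simple_path_def loop_free_def by blast

lemma pos_inj: "v \<in> verts G \<Longrightarrow> w \<in> verts G \<Longrightarrow> pos \<Gamma> v = pos \<Gamma> w \<Longrightarrow> v = w"
  using plane by (auto simp: plane_graph_def inj_on_def)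

lemma strand_at_vertex:
  assumes "h \<in> H" "s \<in> {0..1}" "v \<in> verts G" "strand \<Gamma> h s = pos \<Gamma> v"
  shows "s = 0 \<and> v = vert_of G h \<or> s = 1 \<and> v = vert_of G (opposite h)"
proof -
  have "strand \<Gamma> h s \<in> path_image (curve \<Gamma> (fst h))" using assms(2) by (rule strand_in_image)
  then have "pos \<Gamma> v \<in> path_image (curve \<Gamma> (fst h)) \<inter> pos \<Gamma> ` verts G" using assms by auto
  moreover have "path_image (curve \<Gamma> (fst h)) \<inter> pos \<Gamma> ` verts G \<subseteq> pos \<Gamma> ` ends G (fst h)"
    by (rule curve_at_vertices) (use assms(1) in \<open>simp add: mem_Times_iff\<close>)
  ultimately have "pos \<Gamma> v \<in> pos \<Gamma> ` {vert_of G h, vert_of G (opposite h)}"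
    using assms(1) by (cases h) (auto simp: ends_def split: if_splits)
  then have v: "v = vert_of G h \<or> v = vert_of G (opposite h)"
    using pos_inj assms(3) vert_of_in_verts[OF assms(1)] vert_of_in_verts[of "opposite h"] assms(1) by auto
  have loop: "vert_of G h = vert_of G (opposite h)" if "strand \<Gamma> h 0 = strand \<Gamma> h 1"
    by (rule pos_inj) (use that strand_ends[OF assms(1)] assms(1) vert_of_in_verts in auto)
  show ?thesis
  proof (rule disjE[OF v])
    assume v: "v = vert_of G h"
    then have "strand \<Gamma> h s = strand \<Gamma> h 0" using assms(4) strand_ends(1)[OF assms(1)] by simp
    then have "s = 0 \<or> s = 1 \<and> strand \<Gamma> h 0 = strand \<Gamma> h 1"
      using strand_inj[OF assms(1,2), of 0] by auto
    then show ?thesis using v loop by auto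
  next
    assume v: "v = vert_of G (opposite h)"
    then have "strand \<Gamma> h s = strand \<Gamma> h 1" using assms(4) strand_ends(2)[OF assms(1)] by simp
    then have "s = 1 \<or> s = 0 \<and> strand \<Gamma> h 0 = strand \<Gamma> h 1"
      using strand_inj[OF assms(1,2), of 1] by auto
    then show ?thesis using v loop by auto
  qed
qed

lemma strands_disjoint:
  assumes "h \<in> H" "k \<in> H" "fst h \<noteq> fst k" "s \<in> {0..1}" "t \<in> {0..1}" "strand \<Gamma> h s = strand \<Gamma> k t"
  obtains v where "v \<in> verts G" "strand \<Gamma> h s = pos \<Gamma> v"
proof -
  have "strand \<Gamma> h s \<in> path_image (curve \<Gamma> (fst h)) \<inter> path_image (curve \<Gamma> (fst k))"
    using strand_in_image[OF assms(4), of h] strand_in_image[OF assms(5), of k] assms(6) by simp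
  moreover have "path_image (curve \<Gamma> (fst h)) \<inter> path_image (curve \<Gamma> (fst k)) \<subseteq> pos \<Gamma> ` verts G"
    using plane assms(1-3) unfolding plane_graph_def by (metis UnI1 mem_Times_iff)
  ultimately show thesis using that by blast
qed

definition loop_edge where "loop_edge h \<longleftrightarrow> vert_of G (opposite h) = vert_of G h"

text \<open>The two strands of a loop run along one curve from the same vertex; a bound below 1/2
  keeps their initial pieces apart. Other strands are used in full, as their winding numbers
  require.\<close>

definition reach :: "'e \<times> bool \<Rightarrow> real" where "reach h = (if loop_edge h then 1/3 else 1)"

lemma reach: "1/3 \<le> reach h" "reach h \<le> 1" "0 < reach h" by (simp_all add: reach_def)

text \<open>The first strand is cut at 1/3 even if it is no loop, since two parallel edges also meet
  at their far ends. The other one may then run to its end.\<close>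

lemma strands_at_vertex_disjoint:
  assumes h: "h \<in> H" and k: "k \<in> H" and hk: "h \<noteq> k" "vert_of G h = vert_of G k"
    and st: "0 \<le> s" "s \<le> 1/3" "0 \<le> t" "t \<le> reach k" and eq: "strand \<Gamma> h s = strand \<Gamma> k t"
  shows "s = 0 \<and> t = 0"
proof (cases "fst h = fst k")
  case True
  then have k': "k = opposite h" using same_edge_cases[of h k] hk by auto
  then have loop: "loop_edge k" using hk by (simp add: loop_edge_def)
  then have t: "t \<le> 1/3" using st by (simp add: reach_def)
  have "strand \<Gamma> h s = strand \<Gamma> h (1 - t)"
    using eq by (simp add: k' strand_opposite reversepath_def)
  then show ?thesis using strand_inj[OF h, of s "1 - t"] st t by auto
next
  case False
  have st': "s \<in> {0..1}" "t \<in> {0..1}" using st reach[of k] by auto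
  obtain v where v: "v \<in> verts G" "strand \<Gamma> h s = pos \<Gamma> v"
    using strands_disjoint[OF h k False st' eq] by blast
  have s: "s = 0" "v = vert_of G h" using strand_at_vertex[OF h st'(1) v] st by auto
  have "t = 0 \<and> v = vert_of G k \<or> t = 1 \<and> v = vert_of G (opposite k)"
    using strand_at_vertex[OF k st'(2) v(1)] v(2) eq by simp
  moreover have "\<not> (t = 1 \<and> v = vert_of G (opposite k))"
  proof
    assume "t = 1 \<and> v = vert_of G (opposite k)"
    then have "loop_edge k" "t = 1" using s hk by (auto simp: loop_edge_def)
    then show False using st by (simp add: reach_def)
  qed
  ultimately show ?thesis using s by blast
qed

end

section \<open>The cyclic order at a vertex in a stereographic chart\<close>

locale plane_chart = plane_cubic G \<Gamma> + orthonormal_frame a b N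
  for G :: "('v, 'e) mgraph" and \<Gamma> :: "('v, 'e) drawing" and a b N +
  assumes N_off: "\<And>e. e \<in> edges G \<Longrightarrow> N \<notin> path_image (curve \<Gamma> e)"
begin

definition Z :: "'e \<times> bool \<Rightarrow> real \<Rightarrow> complex" where "Z h t = stereo (strand \<Gamma> h t)"

definition z :: "'v \<Rightarrow> complex" where "z v = stereo (pos \<Gamma> v)"

lemma strand_off: "h \<in> H \<Longrightarrow> t \<in> {0..1} \<Longrightarrow> strand \<Gamma> h t \<noteq> N"
  using N_off[of "fst h"] unfolding path_image_strand[symmetric] by (auto simp: path_image_def)

lemma strand_sphere: "h \<in> H \<Longrightarrow> t \<in> {0..1} \<Longrightarrow> strand \<Gamma> h t \<in> sphere 0 1 - {N}"
  using strand_off strand_norm by simp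

lemma continuous_on_Z: "h \<in> H \<Longrightarrow> continuous_on {0..1} (Z h)"
  unfolding Z_def
proof (rule continuous_on_compose2[OF continuous_on_stereo])
  assume h: "h \<in> H"
  show "continuous_on {0..1} (strand \<Gamma> h)"
    using simple_path_strand[OF h] by (simp add: simple_path_def path_def)
  show "strand \<Gamma> h ` {0..1} \<subseteq> sphere 0 1 - {N}" using strand_sphere[OF h] by blast
qed

lemma Z_eq_iff:
  "h \<in> H \<Longrightarrow> k \<in> H \<Longrightarrow> s \<in> {0..1} \<Longrightarrow> t \<in> {0..1} \<Longrightarrow> Z h s = Z k t \<longleftrightarrow> strand \<Gamma> h s = strand \<Gamma> k t"
  unfolding Z_def using inj_on_eq_iff[OF inj_on_stereo] strand_sphere by blast

lemma Z_0: "h \<in> H \<Longrightarrow> Z h 0 = z (vert_of G h)" and Z_1: "h \<in> H \<Longrightarrow> Z h 1 = z (vert_of G (opposite h))"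
  by (simp_all add: Z_def z_def strand_ends)

lemma Z_opposite: "Z (opposite h) = reversepath (Z h)"
  by (simp add: Z_def strand_opposite reversepath_def fun_eq_iff)

lemma Z_not_start: "h \<in> H \<Longrightarrow> 0 < s \<Longrightarrow> s \<le> reach h \<Longrightarrow> Z h s \<noteq> z (vert_of G h)"
proof
  assume h: "h \<in> H" and s: "0 < s" "s \<le> reach h" and "Z h s = z (vert_of G h)"
  then have "strand \<Gamma> h s = strand \<Gamma> h 0"
    using Z_eq_iff[OF h h, of s 0] reach[of h] by (simp add: Z_0)
  then have "s = 1" "strand \<Gamma> h 1 = strand \<Gamma> h 0" using strand_inj[OF h, of s 0] s reach[of h] by auto
  then have "loop_edge h" using strand_ends[OF h] pos_inj[of "vert_of G (opposite h)" "vert_of G h"]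
    vert_of_in_verts[OF h] vert_of_in_verts[of "opposite h"] h by (simp add: loop_edge_def)
  then show False using \<open>s = 1\<close> s by (simp add: reach_def)
qed

text \<open>One logarithm is fixed per half-edge, so that the linking numbers of different pairs
  refer to the same angles and can be added in \<open>turns\<close>.\<close>

definition L :: "'e \<times> bool \<Rightarrow> real \<Rightarrow> complex" where
  "L h = (SOME l. continuous_on {0<..reach h} l \<and>
     (\<forall>s. 0 < s \<longrightarrow> s \<le> reach h \<longrightarrow> exp (l s) = Z h s - z (vert_of G h)))"

lemma L: assumes h: "h \<in> H"
  shows "continuous_on {0<..reach h} (L h)"
    "\<And>s. 0 < s \<Longrightarrow> s \<le> reach h \<Longrightarrow> exp (L h s) = Z h s - z (vert_of G h)"
proof -
  have cont: "continuous_on {0<..reach h} (\<lambda>s. Z h s - z (vert_of G h))"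
    by (intro continuous_intros continuous_on_subset[OF continuous_on_Z[OF h]]) (use reach[of h] in auto)
  obtain l where "continuous_on {0<..reach h} l" "\<And>s. s \<in> {0<..reach h} \<Longrightarrow> Z h s - z (vert_of G h) = exp (l s)"
    by (rule continuous_logarithm_on_contractible[OF cont convex_imp_contractible])
      (use Z_not_start[OF h] in auto)
  then have "\<exists>l. continuous_on {0<..reach h} l \<and>
     (\<forall>s. 0 < s \<longrightarrow> s \<le> reach h \<longrightarrow> exp (l s) = Z h s - z (vert_of G h))" by force
  from someI_ex[OF this] show "continuous_on {0<..reach h} (L h)"
    "\<And>s. 0 < s \<Longrightarrow> s \<le> reach h \<Longrightarrow> exp (L h s) = Z h s - z (vert_of G h)"
    unfolding L_def by blast+
qed

lemma two_arcs:
  assumes h: "h \<in> H" and k: "k \<in> H" and hk: "h \<noteq> k" "vert_of G h = vert_of G k"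
  shows "two_arcs (Z h) (Z k) (L h) (L k) (z (vert_of G h)) (1/3) (reach k)"
proof
  show "continuous_on {0..1 / 3} (Z h)" "continuous_on {0..reach k} (Z k)"
    using reach[of k] by (auto intro: continuous_on_subset[OF continuous_on_Z] h k)
  show "s = 0 \<and> t = 0" if "0 \<le> s" "s \<le> 1 / 3" "0 \<le> t" "t \<le> reach k" "Z h s = Z k t" for s t
    using that strands_at_vertex_disjoint[OF h k hk that(1-4)] Z_eq_iff[OF h k, of s t] reach[of k] by auto
  show "continuous_on {0<..1 / 3} (L h)"
    by (rule continuous_on_subset[OF L(1)[OF h]]) (use reach[of h] in auto)
  show "exp (L h s) = Z h s - z (vert_of G h)" if "0 < s" "s \<le> 1 / 3" for s
    using L(2)[OF h] that reach[of h] by simp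
qed (use L[OF k] Z_0[OF h] Z_0[OF k] hk reach in auto)

text \<open>A single value depends on the choices in \<open>L\<close>. Sums over a cycle of
  half-edges do not: shifting one logarithm by a full turn changes two neighboring terms
  oppositely.\<close>

definition link :: "'e \<times> bool \<Rightarrow> 'e \<times> bool \<Rightarrow> int" where
  "link h k = (SOME m. \<exists>B. two_arcs.linking_log (Z h) (Z k) (L h) (L k) (1/3) (reach k) B m)"

lemma link:
  assumes "h \<in> H" "k \<in> H" "h \<noteq> k" "vert_of G h = vert_of G k"
  obtains B where "two_arcs.linking_log (Z h) (Z k) (L h) (L k) (1/3) (reach k) B (link h k)"
proof -
  interpret two_arcs "Z h" "Z k" "L h" "L k" "z (vert_of G h)" "1/3" "reach k"
    by (rule two_arcs[OF assms])
  have "\<exists>m B. linking_log B m" using linking_log_exists by metis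
  from someI_ex[OF this] show thesis using that unfolding link_def by blast
qed

definition exit_time :: "'e \<times> bool \<Rightarrow> real \<Rightarrow> real" where
  "exit_time h r = Inf {t \<in> {0..1}. dist (strand \<Gamma> h t) (strand \<Gamma> h 0) = r}"

text \<open>The first condition puts all first exits into the initial thirds, where strands are
  disjoint; the second is the hypothesis of \<open>stereo_circle\<close>.\<close>

definition small :: "real \<Rightarrow> bool" where
  "small r \<longleftrightarrow> 0 < r \<and> (\<forall>h\<in>H. r < dist (strand \<Gamma> h (1/3)) (strand \<Gamma> h 0) \<and> N \<bullet> pos \<Gamma> (vert_of G h) < 1 - r\<^sup>2 / 2)"

lemma eventually_small: "\<forall>\<^sub>F r in at_right 0. small r"
proof -
  have pos: "\<forall>\<^sub>F r::real in at_right 0. 0 < r" by (simp add: eventually_at_right_less)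
  have "\<forall>\<^sub>F r in at_right 0. \<forall>h\<in>H. r < dist (strand \<Gamma> h (1/3)) (strand \<Gamma> h 0) \<and>
      N \<bullet> pos \<Gamma> (vert_of G h) < 1 - r\<^sup>2 / 2"
  proof (rule eventually_ball_finite)
    show "finite H" using fin by simp
    show "\<forall>h\<in>H. \<forall>\<^sub>F r in at_right 0. r < dist (strand \<Gamma> h (1/3)) (strand \<Gamma> h 0) \<and>
      N \<bullet> pos \<Gamma> (vert_of G h) < 1 - r\<^sup>2 / 2"
    proof
      fix h assume h: "h \<in> H"
      have "strand \<Gamma> h (1/3) \<noteq> strand \<Gamma> h 0" using strand_inj[OF h, of "1/3" 0] by auto
      then have "\<forall>\<^sub>F r in at_right 0. r < dist (strand \<Gamma> h (1/3)) (strand \<Gamma> h 0)"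
        by (intro order_tendstoD(2)[OF tendsto_ident_at]) simp
      moreover have "N \<bullet> pos \<Gamma> (vert_of G h) < 1"
        using stereo_denominator[of "strand \<Gamma> h 0"] strand_norm[OF h, of 0] strand_off[OF h, of 0]
        by (simp add: strand_ends(1)[OF h])
      then have "\<forall>\<^sub>F r in at_right 0. N \<bullet> pos \<Gamma> (vert_of G h) < 1 - r\<^sup>2 / 2"
        by (intro order_tendstoD(1)[where y = "1 - 0\<^sup>2 / 2 :: real"] tendsto_intros) auto
      ultimately show "\<forall>\<^sub>F r in at_right 0. r < dist (strand \<Gamma> h (1/3)) (strand \<Gamma> h 0) \<and>
          N \<bullet> pos \<Gamma> (vert_of G h) < 1 - r\<^sup>2 / 2" by eventually_elim simp
    qed
  qed
  with pos show ?thesis unfolding small_def by eventually_elim blast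
qed

lemma exit_time:
  assumes h: "h \<in> H" and r: "small r"
  shows "0 < exit_time h r" "exit_time h r \<le> 1/3"
    "dist (strand \<Gamma> h (exit_time h r)) (pos \<Gamma> (vert_of G h)) = r"
    "\<And>t. \<lbrakk>0 \<le> t; t \<le> exit_time h r\<rbrakk> \<Longrightarrow> dist (strand \<Gamma> h t) (pos \<Gamma> (vert_of G h)) \<le> r"
proof -
  have cont: "continuous_on {0..1} (strand \<Gamma> h)"
    using simple_path_strand[OF h] by (simp add: simple_path_def path_def)
  have r': "0 < r" "r < dist (strand \<Gamma> h (1/3)) (strand \<Gamma> h 0)" using r h by (auto simp: small_def)
  note * = first_exit_time[OF cont _ _ r', folded exit_time_def, simplified strand_ends(1)[OF h]]
  show "0 < exit_time h r" "exit_time h r \<le> 1/3"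
    "dist (strand \<Gamma> h (exit_time h r)) (pos \<Gamma> (vert_of G h)) = r"
    "\<And>t. \<lbrakk>0 \<le> t; t \<le> exit_time h r\<rbrakk> \<Longrightarrow> dist (strand \<Gamma> h t) (pos \<Gamma> (vert_of G h)) \<le> r"
    using * by simp_all
qed

text \<open>All exit points at \<open>u\<close> lie on the image of a single spherical circle, so
  their arguments around its center \<open>c\<close> can be compared; up to their exits the strands
  stay in the disc and do not meet.\<close>

lemma exit_angles:
  assumes u: "u \<in> verts G" and r: "small r"
  obtains c R \<theta> where "R \<noteq> 0"
    "\<And>h. \<lbrakk>h \<in> H; vert_of G h = u\<rbrakk> \<Longrightarrow> Z h (exit_time h r) = c + complex_of_real R * cis (\<theta> h)"
    "\<And>h k. \<lbrakk>h \<in> H; k \<in> H; h \<noteq> k; vert_of G h = u; vert_of G k = u\<rbrakk> \<Longrightarrow>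
        0 < \<theta> k - \<theta> h + 2 * pi * link h k \<and> \<theta> k - \<theta> h + 2 * pi * link h k < 2 * pi"
proof -
  have "card (half_edges_at G u) = 3" using trivalent u by (simp add: trivalent_def)
  then have "half_edges_at G u \<noteq> {}" by auto
  then obtain h0 where h0: "h0 \<in> H" "vert_of G h0 = u" by (auto simp: half_edges_at_def)
  have nu: "norm (pos \<Gamma> u) = 1" using strand_norm[OF h0(1), of 0] strand_ends(1)[OF h0(1)] h0(2) by simp
  have "N \<bullet> pos \<Gamma> u < 1 - r\<^sup>2 / 2" "0 < r" using r h0 by (auto simp: small_def)
  then obtain c R2 where
    c1: "\<And>p. norm p = 1 \<Longrightarrow> p \<noteq> N \<Longrightarrow> dist p (pos \<Gamma> u) = r \<Longrightarrow> (cmod (stereo p - c))\<^sup>2 = R2" and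
    c2: "\<And>p. norm p = 1 \<Longrightarrow> p \<noteq> N \<Longrightarrow> dist p (pos \<Gamma> u) \<le> r \<Longrightarrow> (cmod (stereo p - c))\<^sup>2 \<le> R2"
    using stereo_circle[OF nu] by metis
  have on: "(cmod (Z h (exit_time h r) - c))\<^sup>2 = R2" if "h \<in> H" "vert_of G h = u" for h
    unfolding Z_def
    by (rule c1) (use exit_time[OF that(1) r] that strand_norm[OF that(1)] strand_off[OF that(1)] in auto)
  have inside: "(cmod (Z h t - c))\<^sup>2 \<le> R2" if "h \<in> H" "vert_of G h = u" "0 \<le> t" "t \<le> exit_time h r" for h t
    unfolding Z_def
    by (rule c2) (use exit_time[OF that(1) r] that strand_norm[OF that(1)] strand_off[OF that(1)] in auto)
  \<comment> \<open>A point of a closed disc other than the boundary point \<open>p\<close> lies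
    strictly on the inner side of the tangent at \<open>p\<close>.\<close>
  have half_plane: "(q - p) \<bullet> (c - p) > 0"
    if "(cmod (p - c))\<^sup>2 = R2" "(cmod (q - c))\<^sup>2 \<le> R2" "q \<noteq> p" for p q
  proof -
    have "(cmod (q - c))\<^sup>2 = (cmod (q - p))\<^sup>2 - 2 * ((q - p) \<bullet> (c - p)) + (cmod (p - c))\<^sup>2"
      by (simp add: power2_norm_eq_inner inner_diff_left inner_diff_right inner_commute algebra_simps)
    moreover have "(cmod (q - p))\<^sup>2 > 0" using that by simp
    ultimately show ?thesis using that by linarith
  qed
  define R where "R = sqrt R2"
  define \<theta> where "\<theta> h = exit_angle c (z u) (Z h (exit_time h r)) (L h (exit_time h r))" for h
  have start: "(z u - Z h (exit_time h r)) \<bullet> (c - Z h (exit_time h r)) > 0"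
    if h: "h \<in> H" "vert_of G h = u" for h
    using half_plane[OF on[OF h] inside[OF h, of 0]] exit_time(1,2)[OF h(1) r]
      Z_not_start[OF h(1), of "exit_time h r"] reach[of h] h by (simp add: Z_0)
  have R0: "R2 \<noteq> 0"
  proof
    assume "R2 = 0"
    then have "Z h0 (exit_time h0 r) = c" using on[OF h0] by simp
    then show False using start[OF h0] by simp
  qed
  show thesis
  proof
    show "R \<noteq> 0" using R0 by (simp add: R_def)
    show "Z h (exit_time h r) = c + complex_of_real R * cis (\<theta> h)" if h: "h \<in> H" "vert_of G h = u" for h
    proof -
      have l: "exp (L h (exit_time h r)) = Z h (exit_time h r) - z u"
        using L(2)[OF h(1), of "exit_time h r"] exit_time(1,2)[OF h(1) r] reach[of h] h by simp
      define l' where "l' = L h (exit_time h r) + Ln ((Z h (exit_time h r) - c) / (Z h (exit_time h r) - z u))"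
      have e: "Z h (exit_time h r) - c = exp l'" and im: "Im l' = \<theta> h"
        using exit_angle(1)[OF l start[OF h]] by (simp_all add: l'_def \<theta>_def exit_angle_def)
      have "(exp (Re l'))\<^sup>2 = R2" using on[OF h] by (simp add: e)
      then have "exp (Re l') = R" unfolding R_def by (simp add: real_sqrt_unique)
      then have "exp l' = complex_of_real R * cis (\<theta> h)"
        using im by (simp add: exp_eq_polar)
      then show ?thesis using e by (simp add: algebra_simps)
    qed
    show "0 < \<theta> k - \<theta> h + 2 * pi * link h k \<and> \<theta> k - \<theta> h + 2 * pi * link h k < 2 * pi"
      if hk: "h \<in> H" "k \<in> H" "h \<noteq> k" "vert_of G h = u" "vert_of G k = u" for h k
    proof -
      have hk': "vert_of G h = vert_of G k" using hk by simp
      interpret two_arcs "Z h" "Z k" "L h" "L k" "z (vert_of G h)" "1/3" "reach k"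
        by (rule two_arcs[OF hk(1-3) hk'])
      obtain B where B: "linking_log B (link h k)" using link[OF hk(1-3) hk'] .
      note eh = exit_time(1,2)[OF hk(1) r] and ek = exit_time(1,2)[OF hk(2) r]
      have "Z k t' \<noteq> Z h (exit_time h r)" if "0 \<le> t'" "t' \<le> exit_time k r" for t'
        using disjoint[of "exit_time h r" t'] that eh ek reach[of k] by auto
      then have pa: "(Z k t' - Z h (exit_time h r)) \<bullet> (c - Z h (exit_time h r)) > 0"
        if "0 \<le> t'" "t' \<le> exit_time k r" for t'
        using half_plane[OF on[OF hk(1,4)] inside[OF hk(2,5) that]] that by blast
      have "Z h s' \<noteq> Z k (exit_time k r)" if "0 \<le> s'" "s' \<le> exit_time h r" for s'
        using disjoint[of s' "exit_time k r"] that eh ek reach[of k] by auto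
      then have pb: "(Z h s' - Z k (exit_time k r)) \<bullet> (c - Z k (exit_time k r)) > 0"
        if "0 \<le> s'" "s' \<le> exit_time h r" for s'
        using half_plane[OF on[OF hk(2,5)] inside[OF hk(1,4) that]] that by blast
      have ek': "exit_time k r \<le> reach k" using ek reach[of k] by simp
      show ?thesis
        using exit_angle_between[OF B eh ek(1) ek' pa pb] hk(4) by (simp add: \<theta>_def algebra_simps)
    qed
  qed
qed

text \<open>The gaps from \<open>h\<close> to \<open>k\<close> and back add up to a multiple of a
  full turn strictly between 0 and 2 turns, hence to one turn.\<close>

lemma link_reverse:
  assumes "h \<in> H" "k \<in> H" "h \<noteq> k" "vert_of G h = vert_of G k"
  shows "link k h = 1 - link h k"
proof -
  obtain r where r: "small r" using eventually_happens[OF eventually_small] by auto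
  obtain \<theta> :: "'e \<times> bool \<Rightarrow> real" where
    "0 < \<theta> k - \<theta> h + 2 * pi * link h k \<and> \<theta> k - \<theta> h + 2 * pi * link h k < 2 * pi"
    "0 < \<theta> h - \<theta> k + 2 * pi * link k h \<and> \<theta> h - \<theta> k + 2 * pi * link k h < 2 * pi"
    using exit_angles[OF vert_of_in_verts[OF assms(1)] r] assms by metis
  then have "0 < 2 * pi * real_of_int (link h k + link k h)" "2 * pi * real_of_int (link h k + link k h) < 2 * pi * 2"
    by (auto simp: distrib_left)
  then have "0 < real_of_int (link h k + link k h)" "real_of_int (link h k + link k h) < 2"
    by (simp_all only: zero_less_mult_iff mult_less_cancel_left) (auto simp: pi_gt_zero not_less[symmetric])
  then show ?thesis by linarith
qed

text \<open>The number of full turns made by going counterclockwise from \<open>h\<close> via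
  \<open>k\<close> and \<open>l\<close> back to \<open>h\<close>.\<close>

definition turns where "turns h k l = link h k + link k l + link l h"

lemma exit_orientation:
  assumes hkl: "h \<in> H" "k \<in> H" "l \<in> H" "h \<noteq> k" "k \<noteq> l" "h \<noteq> l"
    "vert_of G k = vert_of G h" "vert_of G l = vert_of G h" and r: "small r"
  defines "s \<equiv> cross3 (first_exit (strand \<Gamma> k) r - first_exit (strand \<Gamma> h) r)
      (first_exit (strand \<Gamma> l) r - first_exit (strand \<Gamma> h) r) \<bullet> pos \<Gamma> (vert_of G h)"
  shows "turns h k l = 1 \<and> s > 0 \<or> turns h k l = 2 \<and> s < 0"
proof -
  define u where "u = vert_of G h"
  have u: "vert_of G h = u" "vert_of G k = u" "vert_of G l = u" using hkl by (auto simp: u_def)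
  obtain c R \<theta> where R: "R \<noteq> 0" and
    Zc: "\<And>h. \<lbrakk>h \<in> H; vert_of G h = u\<rbrakk> \<Longrightarrow> Z h (exit_time h r) = c + complex_of_real R * cis (\<theta> h)" and
    \<theta>: "\<And>h k. \<lbrakk>h \<in> H; k \<in> H; h \<noteq> k; vert_of G h = u; vert_of G k = u\<rbrakk> \<Longrightarrow>
        0 < \<theta> k - \<theta> h + 2 * pi * link h k \<and> \<theta> k - \<theta> h + 2 * pi * link h k < 2 * pi"
    using exit_angles[OF vert_of_in_verts[OF hkl(1)] r, folded u_def] by metis
  have fe: "first_exit (strand \<Gamma> x) r = strand \<Gamma> x (exit_time x r)" for x
    by (simp add: first_exit_def exit_time_def)
  define p where "p i = first_exit (strand \<Gamma> (if i = 1 then h else if i = 2 then k else l)) r" for i :: nat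
  have p: "norm (p i) = 1 \<and> p i \<noteq> N \<and> dist (p i) (pos \<Gamma> u) = r" if "i \<in> {1, 2, 3}" for i
  proof -
    define x where "x = (if i = 1 then h else if i = 2 then k else l)"
    have x: "x \<in> H" "vert_of G x = u" using hkl u by (auto simp: x_def)
    have "exit_time x r \<in> {0..1}" using exit_time(1,2)[OF x(1) r] by simp
    moreover have "p i = strand \<Gamma> x (exit_time x r)" by (simp add: p_def fe x_def)
    ultimately show ?thesis
      using strand_norm[OF x(1)] strand_off[OF x(1)] exit_time(3)[OF x(1) r] x(2) by simp
  qed
  have nu: "norm (pos \<Gamma> u) = 1" using strand_norm[OF hkl(1), of 0] strand_ends(1)[OF hkl(1)] u by simp
  have Nu: "N \<bullet> pos \<Gamma> u < 1 - r\<^sup>2 / 2" using r hkl(1) u by (auto simp: small_def)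
  obtain K where K: "K > 0" "Im (cnj (stereo (p 2) - stereo (p 1)) * (stereo (p 3) - stereo (p 1))) =
      K * (cross3 (p 2 - p 1) (p 3 - p 1) \<bullet> pos \<Gamma> u)"
    by (rule stereo_orientation[where p = p, OF nu Nu p])
  have ps: "stereo (p 1) = Z h (exit_time h r)" "stereo (p 2) = Z k (exit_time k r)" "stereo (p 3) = Z l (exit_time l r)"
    by (simp_all add: p_def fe Z_def)
  have s: "cross3 (p 2 - p 1) (p 3 - p 1) \<bullet> pos \<Gamma> u = s" by (simp add: p_def s_def u)
  have "turns h k l = 1 \<and> Im (cnj (stereo (p 2) - stereo (p 1)) * (stereo (p 3) - stereo (p 1))) > 0 \<or>
         turns h k l = 2 \<and> Im (cnj (stereo (p 2) - stereo (p 1)) * (stereo (p 3) - stereo (p 1))) < 0"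
    unfolding ps turns_def
    by (rule circle_orientation[OF Zc Zc Zc R]) (use \<theta> hkl u in auto)
  then show ?thesis unfolding K(2) s using K(1) by (auto simp: zero_less_mult_iff mult_less_0_iff)
qed

text \<open>No radius enters \<open>turns\<close>, so the sign of the triple product at one small
  radius decides it at all of them.\<close>

lemma counterclockwise_iff:
  assumes hkl: "h \<in> H" "k \<in> H" "l \<in> H" "h \<noteq> k" "k \<noteq> l" "h \<noteq> l"
    "vert_of G k = vert_of G h" "vert_of G l = vert_of G h"
  shows "counterclockwise G \<Gamma> h k l \<longleftrightarrow> turns h k l = 1" "turns h k l = 1 \<or> turns h k l = 2"
proof -
  obtain r where r: "small r" using eventually_happens[OF eventually_small] by auto
  show 12: "turns h k l = 1 \<or> turns h k l = 2" using exit_orientation[OF hkl r] by auto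
  show "counterclockwise G \<Gamma> h k l \<longleftrightarrow> turns h k l = 1"
  proof
    assume "counterclockwise G \<Gamma> h k l"
    then have "\<forall>\<^sub>F r in at_right 0. cross3 (first_exit (strand \<Gamma> k) r - first_exit (strand \<Gamma> h) r)
      (first_exit (strand \<Gamma> l) r - first_exit (strand \<Gamma> h) r) \<bullet> pos \<Gamma> (vert_of G h) > 0"
      by (simp add: counterclockwise_def Let_def)
    then have "\<forall>\<^sub>F r in at_right 0. small r \<and> cross3 (first_exit (strand \<Gamma> k) r - first_exit (strand \<Gamma> h) r)
      (first_exit (strand \<Gamma> l) r - first_exit (strand \<Gamma> h) r) \<bullet> pos \<Gamma> (vert_of G h) > 0"
      using eventually_small by eventually_elim simp
    then obtain r where "small r" "cross3 (first_exit (strand \<Gamma> k) r - first_exit (strand \<Gamma> h) r)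
      (first_exit (strand \<Gamma> l) r - first_exit (strand \<Gamma> h) r) \<bullet> pos \<Gamma> (vert_of G h) > 0"
      using eventually_happens by force
    then show "turns h k l = 1" using exit_orientation[OF hkl] by force
  next
    assume 1: "turns h k l = 1"
    show "counterclockwise G \<Gamma> h k l"
      unfolding counterclockwise_def Let_def using eventually_small
    proof eventually_elim
      case (elim r)
      then show ?case using exit_orientation[OF hkl elim] 1 by auto
    qed
  qed
qed

lemma turns_swap:
  assumes hkl: "h \<in> H" "k \<in> H" "l \<in> H" "h \<noteq> k" "k \<noteq> l" "h \<noteq> l"
    "vert_of G k = vert_of G h" "vert_of G l = vert_of G h"
  shows "turns h l k = 3 - turns h k l"
  using link_reverse[of h k] link_reverse[of k l] link_reverse[of l h] hkl by (simp add: turns_def)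

text \<open>By \<open>turns_swap\<close> exactly one of the two orders of the remaining half-edges
  is counterclockwise, so the description in \<open>rotation\<close> has a unique solution.\<close>

lemma rotation_eq:
  assumes hkl: "h \<in> H" "k \<in> H" "l \<in> H" "h \<noteq> k" "k \<noteq> l" "h \<noteq> l"
    "vert_of G k = vert_of G h" "vert_of G l = vert_of G h"
  shows "rotation G \<Gamma> h = (if turns h k l = 1 then k else l)"
proof -
  define u where "u = vert_of G h"
  have u: "vert_of G h = u" "vert_of G k = u" "vert_of G l = u" using hkl by (auto simp: u_def)
  have fin: "finite (half_edges_at G u)" using fin(2) by (simp add: half_edges_at_def)
  have "card (half_edges_at G u) = 3" using trivalent vert_of_in_verts[OF hkl(1)] by (simp add: trivalent_def u_def)
  moreover have "{h, k, l} \<subseteq> half_edges_at G u" using hkl u by (auto simp: half_edges_at_def)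
  moreover have "card {h, k, l} = 3" using hkl by simp
  ultimately have at: "half_edges_at G u = {h, k, l}" using card_subset_eq[OF fin] by metis
  have main: "rotation G \<Gamma> h = k" if kl: "k \<in> H" "l \<in> H" "h \<noteq> k" "k \<noteq> l" "h \<noteq> l"
    "vert_of G k = u" "vert_of G l = u" and at: "half_edges_at G u = {h, k, l}" and 1: "turns h k l = 1" for k l
    unfolding rotation_def
  proof (rule the_equality)
    have hkl': "vert_of G k = vert_of G h" "vert_of G l = vert_of G h" using kl u by auto
    show "\<exists>h''. half_edges_at G (vert_of G h) = {h, k, h''} \<and> counterclockwise G \<Gamma> h k h''"
      using at counterclockwise_iff(1)[OF hkl(1) kl(1-5) hkl'] 1 u by (intro exI[of _ l]) simp
    fix k' assume "\<exists>h''. half_edges_at G (vert_of G h) = {h, k', h''} \<and> counterclockwise G \<Gamma> h k' h''"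
    then obtain l' where l': "{h, k, l} = {h, k', l'}" "counterclockwise G \<Gamma> h k' l'"
      using at u by auto
    show "k' = k"
    proof (rule ccontr)
      assume "k' \<noteq> k"
      have "card {h, k, l} = 3" using hkl(1) kl by simp
      then have "h \<noteq> k'" "h \<noteq> l'" "k' \<noteq> l'" unfolding l'(1) by (auto simp: card_insert_if split: if_splits)
      moreover have "k' \<in> {h, k, l}" "l' \<in> {h, k, l}" using l'(1) by blast+
      ultimately have "k' = l" "l' = k" using \<open>k' \<noteq> k\<close> by auto
      then have "turns h l k = 1"
        using l'(2) counterclockwise_iff(1)[OF hkl(1) kl(2,1,5) _ kl(3) hkl'(2,1)] kl by simp
      then show False using turns_swap[OF hkl(1) kl(1-5) hkl'] 1 by simp
    qed
  qed
  show ?thesis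
  proof (cases "turns h k l = 1")
    case True
    then show ?thesis using main[of k l] hkl u at by simp
  next
    case False
    then have "turns h l k = 1" using turns_swap[OF hkl] counterclockwise_iff(2)[OF hkl] by simp
    then show ?thesis using main[of l k] hkl u at False by (simp add: insert_commute)
  qed
qed

sublocale rot: cubic_rotation G "rotation G \<Gamma>"
proof
  fix h assume h: "h \<in> H"
  define u where "u = vert_of G h"
  have fin: "finite (half_edges_at G u)" using fin(2) by (simp add: half_edges_at_def)
  have c3: "card (half_edges_at G u) = 3" using trivalent vert_of_in_verts[OF h] by (simp add: trivalent_def u_def)
  have hu: "h \<in> half_edges_at G u" using h by (simp add: half_edges_at_def u_def)
  then have "card (half_edges_at G u - {h}) = 2" using c3 fin by simp
  then obtain k l where kl: "half_edges_at G u - {h} = {k, l}" "k \<noteq> l" by (auto simp: card_2_iff)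
  then have hkl: "h \<in> H" "k \<in> H" "l \<in> H" "h \<noteq> k" "k \<noteq> l" "h \<noteq> l"
    "vert_of G k = vert_of G h" "vert_of G l = vert_of G h"
    using h by (auto simp: half_edges_at_def u_def)
  have at: "half_edges_at G u = {h, k, l}" using kl hu by blast
  have "half_edges_at G (vert_of G h) = {h, rotation G \<Gamma> h, rotation G \<Gamma> (rotation G \<Gamma> h)} \<and>
     rotation G \<Gamma> (rotation G \<Gamma> (rotation G \<Gamma> h)) = h"
  proof -
    have *: "rotation G \<Gamma> h = k \<and> rotation G \<Gamma> k = l \<and> rotation G \<Gamma> l = h"
      if hkl: "h \<in> H" "k \<in> H" "l \<in> H" "h \<noteq> k" "k \<noteq> l" "h \<noteq> l"
        "vert_of G k = vert_of G h" "vert_of G l = vert_of G h" and 1: "turns h k l = 1" for k l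
    proof -
      have t: "turns k l h = 1" "turns l h k = 1" using 1 by (simp_all add: turns_def)
      have v: "vert_of G l = vert_of G k" "vert_of G h = vert_of G k" "vert_of G h = vert_of G l"
        "vert_of G k = vert_of G l" using hkl(7,8) by simp_all
      have "rotation G \<Gamma> h = k" unfolding rotation_eq[OF hkl] using 1 by (rule if_P)
      moreover have "rotation G \<Gamma> k = l"
        unfolding rotation_eq[OF hkl(2,3,1,5) hkl(6,4)[symmetric] v(1,2)] using t(1) by (rule if_P)
      moreover have "rotation G \<Gamma> l = h"
        unfolding rotation_eq[OF hkl(3,1,2) hkl(6)[symmetric] hkl(4) hkl(5)[symmetric] v(3,4)] using t(2) by (rule if_P)
      ultimately show ?thesis by blast
    qed
    show ?thesis
    proof (cases "turns h k l = 1")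
      case True
      then show ?thesis using *[OF hkl] at by (simp add: u_def)
    next
      case False
      then have "turns h l k = 1" using turns_swap[OF hkl] counterclockwise_iff(2)[OF hkl] by simp
      then show ?thesis using *[of l k] hkl at by (simp add: u_def insert_commute)
    qed
  qed
  then show "half_edges_at G (vert_of G h) = {h, rotation G \<Gamma> h, rotation G \<Gamma> (rotation G \<Gamma> h)}"
    "rotation G \<Gamma> (rotation G \<Gamma> (rotation G \<Gamma> h)) = h" by blast+
qed (use finite_mgraph trivalent in auto)

end

section \<open>Face colorings of even subgraphs\<close>

context plane_chart
begin

definition branch :: "'e \<Rightarrow> complex \<Rightarrow> complex" where
  "branch e = root_branch (Z (e, False))"

lemma path_Z: "h \<in> H \<Longrightarrow> path (Z h)"
  using continuous_on_Z by (simp add: path_def)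

lemma path_image_Z: "path_image (Z h) = path_image (Z (fst h, False))"
proof -
  obtain e b where h: "h = (e, b)" by (cases h)
  show ?thesis
  proof (cases b)
    case True
    then have "Z h = reversepath (Z (e, False))" using Z_opposite[of "(e, False)"] h by simp
    then show ?thesis using h by simp
  qed (simp add: h)
qed

lemma branch_eq:
  assumes h: "h \<in> H" and p: "p \<notin> path_image (Z h)"
  shows "branch (fst h) p = root_branch (Z h) p"
proof -
  obtain e b where hb: "h = (e, b)" by (cases h)
  show ?thesis
  proof (cases b)
    case True
    have "root_branch (reversepath (Z (e, False))) p = root_branch (Z (e, False)) p"
      by (rule root_branch_reversepath[OF path_Z]) (use h p path_image_Z[of h] hb in auto)
    then show ?thesis using Z_opposite[of "(e, False)"] True hb by (simp add: branch_def)
  qed (simp add: hb branch_def)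
qed

lemma branch_square:
  assumes "e \<in> edges G" "p \<notin> path_image (Z (e, False))"
  shows "(branch e p)\<^sup>2 = (p - z (source G e)) * (p - z (target G e))"
  using root_branch_square[OF path_Z assms(2)] Z_0[of "(e, False)"] Z_1[of "(e, False)"] assms(1)
  by (simp add: branch_def pathstart_def pathfinish_def)

lemma continuous_at_branch:
  "e \<in> edges G \<Longrightarrow> p \<notin> path_image (Z (e, False)) \<Longrightarrow> isCont (branch e) p"
  unfolding branch_def by (rule continuous_at_root_branch[OF path_Z]) auto

lemma Z_on_edge_iff:
  assumes "h \<in> H" "0 < s" "s < 1" "f \<in> edges G"
  shows "Z h s \<in> path_image (Z (f, False)) \<longleftrightarrow> f = fst h"
proof
  assume "Z h s \<in> path_image (Z (f, False))"
  then obtain t where t: "t \<in> {0..1}" "Z h s = Z (f, False) t" by (auto simp: path_image_def)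
  then have eq: "strand \<Gamma> h s = strand \<Gamma> (f, False) t" using Z_eq_iff[OF assms(1), of "(f, False)" s t] assms by simp
  show "f = fst h"
  proof (rule ccontr)
    assume "f \<noteq> fst h"
    then have "fst h \<noteq> fst (f, False)" by simp
    moreover have "(f, False) \<in> H" "s \<in> {0..1}" using assms by auto
    ultimately obtain v where "v \<in> verts G" "strand \<Gamma> h s = pos \<Gamma> v"
      using strands_disjoint[OF assms(1) _ _ _ t(1) eq] by blast
    then show False using strand_at_vertex[OF assms(1), of s v] assms by auto
  qed
next
  assume "f = fst h"
  then have "path_image (Z (f, False)) = path_image (Z h)" using path_image_Z[of h] by simp
  then show "Z h s \<in> path_image (Z (f, False))" using assms by (auto simp: path_image_def)
qed

lemma Z_not_vertex: "h \<in> H \<Longrightarrow> 0 < s \<Longrightarrow> s < 1 \<Longrightarrow> v \<in> verts G \<Longrightarrow> Z h s \<noteq> z v"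
proof
  assume h: "h \<in> H" and s: "0 < s" "s < 1" and v: "v \<in> verts G" and eq: "Z h s = z v"
  obtain k where k: "k \<in> H" "vert_of G k = v" using rot.half_edge_at_exists[OF v] .
  have "strand \<Gamma> h s = pos \<Gamma> v"
    using eq Z_eq_iff[OF h k(1), of s 0] s k Z_0[OF k(1)] strand_ends(1)[OF k(1)] by simp
  then show False using strand_at_vertex[OF h _ v, of s] s by auto
qed

lemma z_inj: "v \<in> verts G \<Longrightarrow> w \<in> verts G \<Longrightarrow> z v = z w \<Longrightarrow> v = w"
proof -
  assume v: "v \<in> verts G" and w: "w \<in> verts G" and eq: "z v = z w"
  obtain h where h: "h \<in> H" "vert_of G h = v" using rot.half_edge_at_exists[OF v] .
  obtain k where k: "k \<in> H" "vert_of G k = w" using rot.half_edge_at_exists[OF w] .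
  have "pos \<Gamma> v = pos \<Gamma> w"
    using eq Z_eq_iff[OF h(1) k(1), of 0 0] Z_0[OF h(1)] Z_0[OF k(1)] strand_ends(1)[OF h(1)]
      strand_ends(1)[OF k(1)] h k by simp
  then show "v = w" using pos_inj v w by blast
qed

lemma vertex_on_edge:
  assumes "v \<in> verts G" "f \<in> edges G" "z v \<in> path_image (Z (f, False))"
  shows "v = source G f \<or> v = target G f"
proof -
  obtain t where t: "t \<in> {0..1}" "z v = Z (f, False) t" using assms(3) by (auto simp: path_image_def)
  have f: "(f, False) \<in> H" using assms by simp
  consider "t = 0" | "t = 1" | "0 < t" "t < 1" using t(1) by fastforce
  then show ?thesis
  proof cases
    case 1
    then show ?thesis using t Z_0[OF f] z_inj[OF assms(1) vert_of_in_verts[OF f]] by simp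
  next
    case 2
    then show ?thesis using t Z_1[OF f] z_inj[OF assms(1) vert_of_in_verts[of "opposite (f, False)"]] f by simp
  next
    case 3
    then show ?thesis using Z_not_vertex[OF f 3 assms(1)] t by simp
  qed
qed

end

section \<open>The sign of an even subgraph and its change across an edge\<close>

locale even_chart = plane_chart G \<Gamma> a b N
  for G :: "('v, 'e) mgraph" and \<Gamma> :: "('v, 'e) drawing" and a b N +
  fixes x :: "'e set"
  assumes even: "even_subgraph G x"
begin

abbreviation "\<rho> \<equiv> rotation G \<Gamma>"

definition covered :: "'v set" where "covered = {v \<in> verts G. \<exists>h\<in>H. vert_of G h = v \<and> fst h \<in> x}"

definition vertex_poly :: "complex \<Rightarrow> complex" where "vertex_poly p = (\<Prod>v\<in>covered. p - z v)"

text \<open>The sign \<open>\<omega>\<close> is the parity of the winding number of the even subgraph \<open>x\<close>; no orientation of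
  \<open>x\<close> or decomposition into cycles is needed to define it.\<close>

definition \<omega> :: "complex \<Rightarrow> complex" where "\<omega> p = (\<Prod>e\<in>x. branch e p) / vertex_poly p"

lemma x_edges: "x \<subseteq> edges G" and finite_x: "finite x"
  using even fin finite_subset unfolding even_subgraph_def by blast+

lemma finite_covered: "finite covered" using fin by (simp add: covered_def)

lemma covered_iff: "h \<in> H \<Longrightarrow> vert_of G h \<in> covered \<longleftrightarrow> fst h \<in> x \<or> fst (\<rho> h) \<in> x \<or> fst (\<rho> (\<rho> h)) \<in> x"
proof
  assume h: "h \<in> H" and "vert_of G h \<in> covered"
  then obtain k where "k \<in> H" "vert_of G k = vert_of G h" "fst k \<in> x" by (auto simp: covered_def)
  then show "fst h \<in> x \<or> fst (\<rho> h) \<in> x \<or> fst (\<rho> (\<rho> h)) \<in> x" using rot.same_vert_cases[OF h, of k] by auto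
next
  assume h: "h \<in> H" and "fst h \<in> x \<or> fst (\<rho> h) \<in> x \<or> fst (\<rho> (\<rho> h)) \<in> x"
  then have "\<exists>k\<in>H. vert_of G k = vert_of G h \<and> fst k \<in> x"
    using h rot.rotation_in[OF h] rot.vert_of_rotation[OF h] by metis
  then show "vert_of G h \<in> covered" using vert_of_in_verts[OF h] by (simp add: covered_def del: vert_of.simps)
qed

lemma even_at: "h \<in> H \<Longrightarrow> (fst h \<in> x) = ((fst (\<rho> h) \<in> x) \<noteq> (fst (\<rho> (\<rho> h)) \<in> x))"
  using even unfolding rot.even_subgraph_iff by blast

text \<open>At a covered vertex exactly two half-edges belong to \<open>x\<close>, so its factor
  occurs twice. This makes \<omega> a quotient of two square roots of the same polynomial.\<close>

lemma prod_over_half_edges: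
  "(\<Prod>e\<in>x. (p - z (source G e)) * (p - z (target G e))) = (vertex_poly p)\<^sup>2"
proof -
  have "(\<Prod>e\<in>x. (p - z (source G e)) * (p - z (target G e))) = (\<Prod>e\<in>x. \<Prod>b\<in>UNIV. p - z (vert_of G (e, b)))"
    by (simp add: UNIV_bool mult.commute)
  also have "\<dots> = (\<Prod>h\<in>x \<times> UNIV. p - z (vert_of G h))"
    by (simp add: prod.cartesian_product case_prod_beta' del: vert_of.simps)
  also have "\<dots> = (\<Prod>v\<in>covered. \<Prod>h\<in>{h \<in> x \<times> UNIV. vert_of G h = v}. p - z (vert_of G h))"
  proof (rule prod.group[symmetric])
    show "vert_of G ` (x \<times> UNIV) \<subseteq> covered"
      using x_edges vert_of_in_verts unfolding covered_def by (auto simp del: vert_of.simps)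
  qed (use finite_x finite_covered in auto)
  also have "\<dots> = (\<Prod>v\<in>covered. (p - z v)\<^sup>2)"
  proof (rule prod.cong)
    fix v assume "v \<in> covered"
    then obtain h where h: "h \<in> H" "vert_of G h = v" "fst h \<in> x" by (auto simp: covered_def)
    have "{k \<in> x \<times> UNIV. vert_of G k = v} = {k \<in> half_edges_at G v. fst k \<in> x}"
      using x_edges by (auto simp: half_edges_at_def)
    also have "\<dots> = {k \<in> {h, \<rho> h, \<rho> (\<rho> h)}. fst k \<in> x}"
      using rot.half_edges_at_vert_of[OF h(1)] h(2) by simp
    also have "\<dots> = {h, if fst (\<rho> h) \<in> x then \<rho> h else \<rho> (\<rho> h)}"
      using even_at[OF h(1)] h(3) by auto
    finally have "card {k \<in> x \<times> UNIV. vert_of G k = v} = 2"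
      using rot.rotation_distinct[OF h(1)] by simp
    then show "(\<Prod>h\<in>{h \<in> x \<times> UNIV. vert_of G h = v}. p - z (vert_of G h)) = (p - z v)\<^sup>2"
      by simp
  qed simp
  also have "\<dots> = (vertex_poly p)\<^sup>2" by (simp add: vertex_poly_def prod_power_distrib)
  finally show ?thesis .
qed

lemma \<omega>_square:
  assumes "\<And>e. e \<in> x \<Longrightarrow> p \<notin> path_image (Z (e, False))" "\<And>v. v \<in> covered \<Longrightarrow> p \<noteq> z v"
  shows "(\<omega> p)\<^sup>2 = 1"
proof -
  have "(\<Prod>e\<in>x. branch e p)\<^sup>2 = (\<Prod>e\<in>x. (p - z (source G e)) * (p - z (target G e)))"
    unfolding prod_power_distrib by (rule prod.cong) (use branch_square assms(1) x_edges in auto)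
  moreover have "vertex_poly p \<noteq> 0" using assms(2) finite_covered by (auto simp: vertex_poly_def)
  ultimately show ?thesis unfolding \<omega>_def power_divide prod_over_half_edges by simp
qed

lemma isCont_\<omega>:
  assumes "\<And>e. e \<in> x \<Longrightarrow> p \<notin> path_image (Z (e, False))" "\<And>v. v \<in> covered \<Longrightarrow> p \<noteq> z v"
  shows "isCont \<omega> p"
proof -
  have "vertex_poly p \<noteq> 0" using assms(2) finite_covered by (auto simp: vertex_poly_def)
  then show ?thesis
    unfolding \<omega>_def vertex_poly_def
    by (intro continuous_intros continuous_at_branch) (use assms x_edges in auto)
qed

lemma sign_function_constant:
  fixes f :: "real \<Rightarrow> complex"
  assumes "connected S" "continuous_on S f" "\<And>s. s \<in> S \<Longrightarrow> (f s)\<^sup>2 = 1" "s \<in> S" "t \<in> S"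
  shows "f s = f t"
proof -
  have "f ` S \<subseteq> {1, - 1}" using assms(3) by (auto simp: power2_eq_1_iff)
  then have "finite (f ` S)" by (rule finite_subset) simp
  then have "f constant_on S" using continuous_finite_range_constant[OF assms(1,2)] by blast
  then show ?thesis using assms(4,5) unfolding constant_on_def by auto
qed

text \<open>The sign is constant along an edge off \<open>x\<close> (\<open>\<omega>_along\<close>);
  the midpoint stands for the edge.\<close>

definition val :: "'e \<times> bool \<Rightarrow> complex" where "val k = \<omega> (Z k (1/2))"

lemma off_x:
  assumes "k \<in> H" "fst k \<notin> x" "0 < s" "s < 1"
  shows "\<And>e. e \<in> x \<Longrightarrow> Z k s \<notin> path_image (Z (e, False))" "\<And>v. v \<in> covered \<Longrightarrow> Z k s \<noteq> z v"
proof -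
  show "Z k s \<notin> path_image (Z (e, False))" if "e \<in> x" for e
    using Z_on_edge_iff[OF assms(1,3,4), of e] that x_edges assms(2) by auto
  show "Z k s \<noteq> z v" if "v \<in> covered" for v
    using Z_not_vertex[OF assms(1,3,4)] that by (simp add: covered_def)
qed

lemma isCont_Z: "h \<in> H \<Longrightarrow> 0 < s \<Longrightarrow> s < 1 \<Longrightarrow> isCont (Z h) s"
  using continuous_on_interior[OF continuous_on_Z, of h s] by simp

lemma \<omega>_along:
  assumes k: "k \<in> H" "fst k \<notin> x" and s: "0 < s" "s < 1"
  shows "\<omega> (Z k s) = val k" "(val k)\<^sup>2 = 1"
proof -
  have sq: "(\<omega> (Z k t))\<^sup>2 = 1" if "t \<in> {0<..<1}" for t
    using \<omega>_square off_x[OF k, of t] that by auto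
  show "(val k)\<^sup>2 = 1" unfolding val_def by (rule sq) simp
  show "\<omega> (Z k s) = val k"
    unfolding val_def
  proof (rule sign_function_constant[where S = "{0<..<1}" and f = "\<lambda>t. \<omega> (Z k t)", OF _ _ sq])
    show "continuous_on {0<..<1} (\<lambda>t. \<omega> (Z k t))"
    proof (rule continuous_at_imp_continuous_on, rule ballI)
      fix t :: real assume t: "t \<in> {0<..<1}"
      have "isCont \<omega> (Z k t)" using isCont_\<omega> off_x[OF k, of t] t by auto
      then show "isCont (\<lambda>t. \<omega> (Z k t)) t"
        using isCont_o2[OF isCont_Z[OF k(1), of t]] t by simp
    qed
  qed (use s in auto)
qed

lemma val_opposite: "val (opposite k) = val k"
  by (simp add: val_def Z_opposite reversepath_def)

lemma tendsto_Z: assumes "h \<in> H" shows "(Z h \<longlongrightarrow> z (vert_of G h)) (at_right 0)"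
proof -
  have "(Z h \<longlongrightarrow> Z h 0) (at 0 within {0..1})"
    using continuous_on_Z[OF assms] by (simp add: continuous_on_def)
  then show ?thesis by (simp add: at_within_Icc_at_right Z_0[OF assms])
qed

text \<open>All factors of \<omega> are regular at a vertex off \<open>x\<close>, so the sign
  extends continuously to it, and the edges meeting there have the same sign.\<close>

lemma val_uncovered:
  assumes h: "h \<in> H" and "vert_of G h \<notin> covered"
  shows "val h = \<omega> (z (vert_of G h))"
proof -
  let ?u = "vert_of G h"
  have hx: "fst h \<notin> x" using covered_iff[OF h] assms(2) by blast
  have u: "?u \<in> verts G" using vert_of_in_verts[OF h] .
  have "isCont \<omega> (z ?u)"
  proof (rule isCont_\<omega>)
    show "z ?u \<noteq> z v" if "v \<in> covered" for v
    proof
      assume eq: "z ?u = z v"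
      have "v \<in> verts G" using that by (simp add: covered_def)
      then have "?u = v" using z_inj[OF u _ eq] by simp
      then show False using that assms(2) by simp
    qed
    show "z ?u \<notin> path_image (Z (e, False))" if e: "e \<in> x" for e
    proof
      assume "z ?u \<in> path_image (Z (e, False))"
      then have "?u = source G e \<or> ?u = target G e" using vertex_on_edge[OF u] e x_edges by auto
      then have "?u = vert_of G (e, False) \<or> ?u = vert_of G (e, True)" by simp
      then obtain c where c: "vert_of G (e, c) = ?u" by metis
      have "(e, c) \<in> H" using e x_edges by auto
      then have "?u \<in> covered" using covered_iff[of "(e, c)"] c e by simp
      then show False using assms(2) by simp
    qed
  qed
  then have "((\<lambda>s. \<omega> (Z h s)) \<longlongrightarrow> \<omega> (z ?u)) (at_right 0)"
    by (rule isCont_tendsto_compose[OF _ tendsto_Z[OF h]])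
  moreover have "\<forall>\<^sub>F s in at_right 0. \<omega> (Z h s) = val h"
    unfolding eventually_at_right_field using \<omega>_along(1)[OF h hx] by (intro exI[of _ 1]) auto
  ultimately have "((\<lambda>_. val h) \<longlongrightarrow> \<omega> (z ?u)) (at_right (0::real))"
    by (rule Lim_transform_eventually)
  then show ?thesis by (simp add: tendsto_const_iff)
qed

text \<open>The counterpart of \<open>\<omega>\<close> on an edge of \<open>x\<close>, with the square root along the edge continued by \<open>L\<close>.\<close>

definition \<psi> :: "'e \<times> bool \<Rightarrow> real \<Rightarrow> complex" where
  "\<psi> h s = (\<Prod>e\<in>x - {fst h}. branch e (Z h s)) / vertex_poly (Z h s) *
     exp ((L h s + L (opposite h) (1 - s)) / 2)"

lemma \<psi>_opposite: "\<psi> (opposite h) s = \<psi> h (1 - s)"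
  by (simp add: \<psi>_def Z_opposite reversepath_def add.commute)

lemma loop_edge_opposite: "loop_edge (opposite h) = loop_edge h"
  by (auto simp: loop_edge_def)

text \<open>The exponential is a square root of the factor belonging to \<open>fst h\<close>, so
  \<psi> squares to 1 just as \<omega> does. For a loop the logarithms reach only the first third
  and do not cover the edge.\<close>

lemma \<psi>_constant:
  assumes h: "h \<in> H" "fst h \<in> x" and loop: "\<not> loop_edge h" and s: "0 < s" "s < 1" and t: "0 < t" "t < 1"
  shows "\<psi> h s = \<psi> h t"
proof (rule sign_function_constant[where S = "{0<..<1}"])
  have h': "opposite h \<in> H" using h by simp
  have r: "reach h = 1" "reach (opposite h) = 1" using loop by (simp_all add: reach_def loop_edge_opposite)
  have off: "Z h s \<notin> path_image (Z (e, False))" if "e \<in> x - {fst h}" "s \<in> {0<..<1}" for e s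
    using Z_on_edge_iff[OF h(1), of s e] that x_edges by auto
  have nz: "Z h s \<noteq> z v" if "v \<in> covered" "s \<in> {0<..<1}" for v s
    using Z_not_vertex[OF h(1), of s v] that by (auto simp: covered_def)
  have poly: "vertex_poly (Z h s) \<noteq> 0" if "s \<in> {0<..<1}" for s
    using nz[OF _ that] finite_covered by (auto simp: vertex_poly_def)
  show "continuous_on {0<..<1} (\<psi> h)"
    unfolding \<psi>_def
  proof (intro continuous_intros poly)
    show "continuous_on {0<..<1} (L h)" by (rule continuous_on_subset[OF L(1)[OF h(1)]]) (auto simp: r)
    show "continuous_on {0<..<1} (\<lambda>s. L (opposite h) (1 - s))"
      by (rule continuous_on_compose2[OF L(1)[OF h']]) (auto simp: r intro!: continuous_intros)
    show "continuous_on {0<..<1} (\<lambda>s. vertex_poly (Z h s))"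
      unfolding vertex_poly_def by (intro continuous_intros continuous_on_subset[OF continuous_on_Z[OF h(1)]]) auto
    show "continuous_on {0<..<1} (\<lambda>s. branch e (Z h s))" if e: "e \<in> x - {fst h}" for e
    proof (rule continuous_at_imp_continuous_on, rule ballI)
      fix t :: real assume t: "t \<in> {0<..<1}"
      have "isCont (branch e) (Z h t)" using continuous_at_branch off[OF e t] e x_edges by auto
      then show "isCont (\<lambda>t. branch e (Z h t)) t" using isCont_o2[OF isCont_Z[OF h(1), of t]] t by simp
    qed
  qed (use poly in auto)
  show "(\<psi> h s)\<^sup>2 = 1" if s: "s \<in> {0<..<1}" for s
  proof -
    let ?p = "Z h s"
    let ?P = "\<lambda>e. (?p - z (source G e)) * (?p - z (target G e))"
    have "(exp (w / 2))\<^sup>2 = exp w" for w :: complex by (simp add: exp_double[symmetric])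
    then have "(exp ((L h s + L (opposite h) (1 - s)) / 2))\<^sup>2 = exp (L h s) * exp (L (opposite h) (1 - s))"
      by (simp only: exp_add)
    also have "\<dots> = (?p - z (vert_of G h)) * (?p - z (vert_of G (opposite h)))"
      using L(2)[OF h(1), of s] L(2)[OF h', of "1 - s"] s by (simp add: r Z_opposite reversepath_def)
    also have "\<dots> = ?P (fst h)" by (cases h; cases "snd h") auto
    finally have 1: "(exp ((L h s + L (opposite h) (1 - s)) / 2))\<^sup>2 = ?P (fst h)" .
    have "(\<Prod>e\<in>x - {fst h}. branch e ?p)\<^sup>2 = (\<Prod>e\<in>x - {fst h}. ?P e)"
      unfolding prod_power_distrib by (rule prod.cong) (use branch_square off[OF _ s] x_edges in auto)
    then have "(\<psi> h s)\<^sup>2 = (\<Prod>e\<in>x. ?P e) / (vertex_poly ?p)\<^sup>2"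
      unfolding \<psi>_def power_mult_distrib power_divide 1 prod.remove[OF finite_x h(2)] by (simp add: mult.commute)
    then show ?thesis using poly[OF s] by (simp add: prod_over_half_edges)
  qed
qed (use s t in auto)

text \<open>The values of \<open>\<omega>\<close> next to the third half-edge \<open>k\<close> and of \<open>\<psi>\<close> along \<open>h\<close> both extend to the
  vertex, so that they can be compared there.\<close>

lemma val_at_vertex:
  assumes h: "h \<in> H" "fst h \<in> x" and loop: "\<not> loop_edge h"
    and d: "d \<in> H" "fst d \<in> x" "d \<noteq> h" "vert_of G d = vert_of G h"
    and k: "k \<in> H" "fst k \<notin> x" "vert_of G k = vert_of G h"
  shows "val k = \<psi> h (1/2) * exp (pi * \<i> * of_int (turns h k d)) *
     exp ((L h 1 - pi * \<i> - L (opposite h) 1) / 2)"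
proof -
  define u where "u = vert_of G h"
  have u: "u \<in> verts G" using vert_of_in_verts[OF h(1)] by (simp add: u_def)
  have h': "opposite h \<in> H" using h by simp
  have kne: "k \<noteq> h" "k \<noteq> d" "fst k \<noteq> fst h" "fst k \<noteq> fst d" using h d k by auto
  have at_u: "f \<in> {h, d, k}" if "f \<in> H" "vert_of G f = u" for f
  proof -
    have "{h, d, k} \<subseteq> half_edges_at G u" using h d k by (auto simp: half_edges_at_def u_def)
    moreover have "finite (half_edges_at G u)" using fin by (simp add: half_edges_at_def)
    moreover have "card {h, d, k} = card (half_edges_at G u)"
      using trivalent u d(3) kne by (simp add: trivalent_def)
    ultimately have "{h, d, k} = half_edges_at G u" by (metis card_subset_eq)
    then show ?thesis using that by (auto simp: half_edges_at_def)
  qed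
  have dh: "fst d \<noteq> fst h"
  proof
    assume "fst d = fst h"
    then have "d = opposite h" using same_edge_cases[of h d] d(3) by metis
    then show False using d(4) loop by (simp add: loop_edge_def)
  qed
  have loop_d: "\<not> loop_edge d"
  proof
    assume "loop_edge d"
    then have "opposite d \<in> {h, d, k}" using at_u[of "opposite d"] d by (simp add: loop_edge_def u_def)
    then have "opposite d = h \<or> opposite d = d \<or> opposite d = k" by blast
    then have "fst d = fst h \<or> fst d = fst k" using opposite_simps(1,3)[of d] by metis
    then show False using dh kne(4) by simp
  qed
  have r: "reach h = 1" "reach d = 1" "reach (opposite h) = 1"
    using loop loop_d by (simp_all add: reach_def loop_edge_opposite)
  \<comment> \<open>The part of \<omega> that is regular at \<open>u\<close>: the roots of
    \<open>h\<close> and \<open>d\<close> and the factor p - z u have been removed.\<close>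
  define rest where "rest p = (\<Prod>e\<in>x - {fst h} - {fst d}. branch e p) / (\<Prod>v\<in>covered - {u}. p - z v)" for p
  have u_cov: "u \<in> covered" unfolding u_def covered_iff[OF h(1)] using h(2) by blast
  have poly: "vertex_poly p = (p - z u) * (\<Prod>v\<in>covered - {u}. p - z v)" for p
    unfolding vertex_poly_def by (rule prod.remove[OF finite_covered u_cov])
  have dx: "fst d \<in> x - {fst h}" using d dh by simp
  have prod_h: "(\<Prod>e\<in>x - {fst h}. branch e p) = branch (fst d) p * (\<Prod>e\<in>x - {fst h} - {fst d}. branch e p)" for p
    by (rule prod.remove[OF _ dx]) (use finite_x in simp)
  have prod_x: "(\<Prod>e\<in>x. branch e p) = branch (fst h) p * (branch (fst d) p * (\<Prod>e\<in>x - {fst h} - {fst d}. branch e p))" for p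
    unfolding prod_h[symmetric] by (rule prod.remove[OF finite_x h(2)])
  have rest: "isCont rest (z u)"
    unfolding rest_def
  proof (intro continuous_intros continuous_at_branch)
    fix e assume e: "e \<in> x - {fst h} - {fst d}"
    then show eE: "e \<in> edges G" using x_edges by auto
    show "z u \<notin> path_image (Z (e, False))"
    proof
      assume "z u \<in> path_image (Z (e, False))"
      then have "u = vert_of G (e, False) \<or> u = vert_of G (e, True)" using vertex_on_edge[OF u eE] by simp
      moreover have "(e, False) \<in> H" "(e, True) \<in> H" using eE by simp_all
      ultimately have "(e, False) \<in> {h, d, k} \<or> (e, True) \<in> {h, d, k}" using at_u by metis
      then have "e = fst h \<or> e = fst d \<or> e = fst k" by (metis empty_iff fst_conv insert_iff)
      then show False using e k(2) by blast
    qed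
  next
    show "(\<Prod>v\<in>covered - {u}. z u - z v) \<noteq> 0"
      using finite_covered z_inj[OF u] by (auto simp: covered_def)
  qed
  have rest_lim: "((\<lambda>s. rest (Z l s)) \<longlongrightarrow> rest (z u)) (at_right 0)" if "l \<in> H" "vert_of G l = u" for l
    by (rule isCont_tendsto_compose[OF rest]) (use tendsto_Z[OF that(1)] that(2) in simp)
  have asym: "((\<lambda>s. root_branch (Z l) (Z j s) / exp (L j s / 2)) \<longlongrightarrow>
           exp ((L l 1 - pi * \<i>) / 2 + pi * link j l * \<i>)) (at_right 0)"
    if jl: "j \<in> H" "l \<in> H" "j \<noteq> l" "vert_of G j = vert_of G l" and "reach l = 1" for j l
  proof -
    interpret two_arcs "Z j" "Z l" "L j" "L l" "z (vert_of G j)" "1/3" "reach l"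
      by (rule two_arcs[OF jl])
    obtain B where B: "linking_log B (link j l)" using link[OF jl] .
    show ?thesis by (rule root_branch_asymptotics[OF B that(5)])
  qed
  have ev: "\<forall>\<^sub>F s in at_right 0. s < (1::real) \<and> 0 < s"
    unfolding eventually_at_right_field by (intro exI[of _ 1]) auto
  have br: "branch (fst l) (Z j s) = root_branch (Z l) (Z j s)"
    if "j \<in> H" "l \<in> H" "fst j \<noteq> fst l" "0 < s" "s < 1" for j l s
    using branch_eq[OF that(2), of "Z j s"] Z_on_edge_iff[OF that(1,4,5), of "fst l"] path_image_Z[of l] that
    by (auto simp: mem_Times_iff)
  have expL: "exp (L j s / 2) * exp (L j s / 2) = Z j s - z u"
    if "j \<in> H" "vert_of G j = u" "0 < s" "s \<le> reach j" for j s
    using L(2)[OF that(1,3,4)] that(2) by (simp add: exp_add[symmetric])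
  define A where "A j l = exp ((L l 1 - pi * \<i>) / 2 + pi * link j l * \<i>)" for j l

  \<comment> \<open>Along \<open>h\<close> its own root cancels half of 1 / (p - z u), and the
    quotient of the root of \<open>d\<close> by exp (L h s / 2) remains. Along \<open>k\<close>, in
    \<open>lim2\<close>, the roots of \<open>h\<close> and \<open>d\<close> share that factor
    evenly.\<close>
  have lim1: "((\<lambda>s. root_branch (Z d) (Z h s) / exp (L h s / 2) * rest (Z h s) * exp (L (opposite h) (1 - s) / 2))
      \<longlongrightarrow> A h d * rest (z u) * exp (L (opposite h) 1 / 2)) (at_right 0)"
  proof (intro tendsto_mult tendsto_intros)
    show "((\<lambda>s. root_branch (Z d) (Z h s) / exp (L h s / 2)) \<longlongrightarrow> A h d) (at_right 0)"
      unfolding A_def by (rule asym) (use h d r in auto)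
    show "((\<lambda>s. rest (Z h s)) \<longlongrightarrow> rest (z u)) (at_right 0)" by (rule rest_lim) (use h in \<open>auto simp: u_def\<close>)
    have "continuous_on {0..1/2} (\<lambda>s. L (opposite h) (1 - s))"
      by (rule continuous_on_compose2[OF L(1)[OF h']]) (auto simp: r intro!: continuous_intros)
    then have "((\<lambda>s. L (opposite h) (1 - s)) \<longlongrightarrow> L (opposite h) (1 - 0)) (at 0 within {0..1/2})"
      unfolding continuous_on_def by (rule bspec) simp
    then show "((\<lambda>s. L (opposite h) (1 - s)) \<longlongrightarrow> L (opposite h) 1) (at_right 0)"
      by (simp add: at_within_Icc_at_right)
  qed simp
  have "\<forall>\<^sub>F s in at_right 0. root_branch (Z d) (Z h s) / exp (L h s / 2) * rest (Z h s) * exp (L (opposite h) (1 - s) / 2) = \<psi> h (1/2)"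
    using ev
  proof eventually_elim
    case (elim s)
    have e: "exp (L h s / 2) * exp (L h s / 2) = Z h s - z u" by (rule expL) (use h r elim in \<open>auto simp: u_def\<close>)
    have "\<psi> h s = branch (fst d) (Z h s) / (Z h s - z u) * rest (Z h s) *
        (exp (L h s / 2) * exp (L (opposite h) (1 - s) / 2))"
      unfolding \<psi>_def rest_def prod_h poly by (simp add: add_divide_distrib exp_add)
    also have "\<dots> = root_branch (Z d) (Z h s) / exp (L h s / 2) * rest (Z h s) * exp (L (opposite h) (1 - s) / 2)"
      using elim h d dh by (simp add: br e[symmetric])
    finally show ?case using \<psi>_constant[OF h loop, of s "1/2"] elim by simp
  qed
  from Lim_transform_eventually[OF lim1 this]
  have \<psi>: "\<psi> h (1/2) = A h d * rest (z u) * exp (L (opposite h) 1 / 2)"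
    by (simp add: tendsto_const_iff)
  have lim2: "((\<lambda>s. root_branch (Z h) (Z k s) / exp (L k s / 2) * (root_branch (Z d) (Z k s) / exp (L k s / 2)) * rest (Z k s))
      \<longlongrightarrow> A k h * A k d * rest (z u)) (at_right 0)"
  proof (intro tendsto_mult)
    show "((\<lambda>s. root_branch (Z h) (Z k s) / exp (L k s / 2)) \<longlongrightarrow> A k h) (at_right 0)"
      "((\<lambda>s. root_branch (Z d) (Z k s) / exp (L k s / 2)) \<longlongrightarrow> A k d) (at_right 0)"
      unfolding A_def by (rule asym; use h d k kne r in auto)+
    show "((\<lambda>s. rest (Z k s)) \<longlongrightarrow> rest (z u)) (at_right 0)" by (rule rest_lim) (use k in \<open>auto simp: u_def\<close>)
  qed
  have ev': "\<forall>\<^sub>F s in at_right 0. s < 1/3 \<and> 0 < (s::real)"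
    unfolding eventually_at_right_field by (intro exI[of _ "1/3"]) auto
  have "\<forall>\<^sub>F s in at_right 0. root_branch (Z h) (Z k s) / exp (L k s / 2) * (root_branch (Z d) (Z k s) / exp (L k s / 2)) * rest (Z k s) = val k"
    using ev'
  proof eventually_elim
    case (elim s)
    have e: "exp (L k s / 2) * exp (L k s / 2) = Z k s - z u"
      by (rule expL) (use k reach[of k] elim in \<open>auto simp: u_def\<close>)
    have "\<omega> (Z k s) = branch (fst h) (Z k s) * branch (fst d) (Z k s) / (Z k s - z u) * rest (Z k s)"
      unfolding \<omega>_def rest_def prod_x poly by simp
    also have "\<dots> = root_branch (Z h) (Z k s) / exp (L k s / 2) * (root_branch (Z d) (Z k s) / exp (L k s / 2)) * rest (Z k s)"
      using elim h d k kne by (simp add: br e[symmetric])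
    finally show ?case using \<omega>_along(1)[OF k(1,2), of s] elim by simp
  qed
  from Lim_transform_eventually[OF lim2 this]
  have val: "val k = A k h * A k d * rest (z u)" by (simp add: tendsto_const_iff)
  \<comment> \<open>Up to an even integer, which is a period of the exponential, the linking numbers
    in \<open>A k h\<close>, \<open>A k d\<close> and \<open>A h d\<close> combine to
    \<open>turns h k d\<close>.\<close>
  have t: "turns h k d = link k h + link k d - link h d + 2 * link h k"
    using link_reverse[of h k] link_reverse[of h d] h d k kne by (simp add: turns_def)
  have per: "exp (2 * pi * \<i> * of_int n) = (1::complex)" for n
    by (auto simp: exp_eq_1 intro!: exI[of _ n])
  have "A k h * A k d = A h d * exp (L (opposite h) 1 / 2) * exp (pi * \<i> * of_int (turns h k d)) *
     exp ((L h 1 - pi * \<i> - L (opposite h) 1) / 2)"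
  proof -
    have "A h d * exp (L (opposite h) 1 / 2) * exp (pi * \<i> * of_int (turns h k d)) * exp ((L h 1 - pi * \<i> - L (opposite h) 1) / 2)
       = exp ((L d 1 - pi * \<i>) / 2 + pi * link h d * \<i> + L (opposite h) 1 / 2 + pi * \<i> * of_int (turns h k d)
          + (L h 1 - pi * \<i> - L (opposite h) 1) / 2)"
      by (simp add: A_def exp_add)
    also have "(L d 1 - pi * \<i>) / 2 + pi * link h d * \<i> + L (opposite h) 1 / 2 + pi * \<i> * of_int (turns h k d)
          + (L h 1 - pi * \<i> - L (opposite h) 1) / 2 =
        ((L h 1 - pi * \<i>) / 2 + pi * link k h * \<i>) + ((L d 1 - pi * \<i>) / 2 + pi * link k d * \<i>) + 2 * pi * \<i> * of_int (link h k)"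
      unfolding t of_int_add of_int_diff of_int_mult of_int_numeral by (simp add: field_simps)
    also have "exp \<dots> = A k h * A k d" unfolding exp_add per A_def by simp
    finally show ?thesis ..
  qed
  then show ?thesis unfolding val \<psi> by simp
qed

text \<open>At its start \<open>\<rho> h\<close> is left of \<open>h\<close>, while
  \<open>\<rho> (opposite h)\<close> is right of \<open>h\<close> at its end; so the signs agree iff
  \<open>k\<close> and \<open>k'\<close> are on the same side. Both are compared with the constant
  \<psi>. The factors at the two ends involve \<delta> and its inverse, and \<delta> * \<delta> = -
  1 because the difference of the end vertices changes sign under reversal.\<close>

lemma val_across:
  assumes h: "h \<in> H" "fst h \<in> x" and loop: "\<not> loop_edge h"
    and k: "k \<in> H" "fst k \<notin> x" "vert_of G k = vert_of G h"
    and k': "k' \<in> H" "fst k' \<notin> x" "vert_of G k' = vert_of G (opposite h)"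
  shows "val k = val k' \<longleftrightarrow> (k = \<rho> h) \<noteq> (k' = \<rho> (opposite h))"
proof -
  have h': "opposite h \<in> H" "fst (opposite h) \<in> x" "\<not> loop_edge (opposite h)"
    using h loop by (simp_all add: loop_edge_opposite)
  have side: "\<exists>d. d \<in> H \<and> fst d \<in> x \<and> d \<noteq> h \<and> vert_of G d = vert_of G h \<and>
      exp (pi * \<i> * of_int (turns h k d)) = (if k = \<rho> h then - 1 else 1 :: complex)"
    if h: "h \<in> H" "fst h \<in> x" and k: "k \<in> H" "fst k \<notin> x" "vert_of G k = vert_of G h" for h k
  proof -
    define d where "d = (if k = \<rho> h then \<rho> (\<rho> h) else \<rho> h)"
    have kc: "k = \<rho> h \<or> k = \<rho> (\<rho> h)" using rot.same_vert_cases[OF h(1) k(1,3)] h k by auto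
    have d: "d \<in> H" "d \<noteq> h" "vert_of G d = vert_of G h" "k \<noteq> d" "k \<noteq> h"
      using rot.rotation_in[OF h(1)] rot.rotation_distinct[OF h(1)] rot.vert_of_rotation[OF h(1)] kc
      by (auto simp: d_def)
    have dx: "fst d \<in> x" using even_at[OF h(1)] h(2) k(2) kc by (auto simp: d_def)
    note hkd = h(1) k(1) d(1) d(5)[symmetric] d(4) d(2)[symmetric] k(3) d(3)
    have "\<rho> h = (if turns h k d = 1 then k else d)" by (rule rotation_eq[OF hkd])
    then have "turns h k d = (if k = \<rho> h then 1 else 2)"
      using counterclockwise_iff(2)[OF hkd] d(4) by (auto split: if_splits)
    moreover have "exp (pi * \<i> * of_int 1) = (- 1 :: complex)" by simp
    moreover have "exp (pi * \<i> * of_int 2) = (1 :: complex)"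
      using exp_two_pi_i by (simp add: mult_ac)
    ultimately show ?thesis using d dx by (intro exI[of _ d]) auto
  qed
  obtain d where d: "d \<in> H" "fst d \<in> x" "d \<noteq> h" "vert_of G d = vert_of G h"
      and td: "exp (pi * \<i> * of_int (turns h k d)) = (if k = \<rho> h then - 1 else 1 :: complex)"
    using side[OF h k] by blast
  obtain d' where d': "d' \<in> H" "fst d' \<in> x" "d' \<noteq> opposite h" "vert_of G d' = vert_of G (opposite h)"
      and td': "exp (pi * \<i> * of_int (turns (opposite h) k' d')) = (if k' = \<rho> (opposite h) then - 1 else 1 :: complex)"
    using side[OF h'(1,2) k'] by blast
  define \<delta> where "\<delta> = exp ((L h 1 - L (opposite h) 1) / 2)"
  have i': "exp (- ((L h 1 - L (opposite h) 1) / 2)) = inverse \<delta>"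
    unfolding \<delta>_def by (rule exp_minus)
  have i: "exp (- (pi * \<i> / 2)) = - \<i>"
    by (simp add: complex_eq_iff Re_exp Im_exp)
  have "val k = \<psi> h (1/2) * (if k = \<rho> h then - 1 else 1) * exp ((L h 1 - pi * \<i> - L (opposite h) 1) / 2)"
    using val_at_vertex[OF h loop d k] unfolding td .
  also have "(L h 1 - pi * \<i> - L (opposite h) 1) / 2 = (L h 1 - L (opposite h) 1) / 2 + - (pi * \<i> / 2)"
    by (simp add: field_simps)
  finally have v: "val k = \<psi> h (1/2) * (if k = \<rho> h then - 1 else 1) * (\<delta> * - \<i>)"
    unfolding exp_add i \<delta>_def .
  have "val k' = \<psi> (opposite h) (1/2) * (if k' = \<rho> (opposite h) then - 1 else 1) *
      exp ((L (opposite h) 1 - pi * \<i> - L h 1) / 2)"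
    using val_at_vertex[OF h' d' k'] unfolding td' by simp
  also have "(L (opposite h) 1 - pi * \<i> - L h 1) / 2 = - ((L h 1 - L (opposite h) 1) / 2) + - (pi * \<i> / 2)"
    by (simp add: field_simps)
  finally have v': "val k' = \<psi> h (1/2) * (if k' = \<rho> (opposite h) then - 1 else 1) * (inverse \<delta> * - \<i>)"
    unfolding exp_add i i' \<psi>_opposite by simp
  have "exp (L h 1) = - exp (L (opposite h) 1)"
    using L(2)[OF h(1), of 1] L(2)[OF h'(1), of 1] loop h'(3) Z_1[OF h(1)] Z_1[OF h'(1)]
    by (simp add: reach_def)
  then have "exp (L h 1 - L (opposite h) 1) = - 1" by (simp add: exp_diff)
  then have "\<delta> * \<delta> = - 1" by (simp add: \<delta>_def exp_add[symmetric])
  then have "\<delta> \<noteq> 0" "inverse \<delta> = - \<delta>" by (auto simp: \<delta>_def field_simps)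
  then have v': "val k' = - (\<psi> h (1/2) * (if k' = \<rho> (opposite h) then - 1 else 1) * (\<delta> * - \<i>))"
    using v' by simp
  have "val k \<noteq> 0" using \<omega>_along(2)[OF k(1,2), of "1/2"] by auto
  then have "\<psi> h (1/2) \<noteq> 0" using v by auto
  then show ?thesis using v v' \<open>\<delta> \<noteq> 0\<close> by (auto split: if_splits)
qed

lemma face_coloring_exists: "\<exists>f. face_coloring G \<rho> x f"
proof -
  define V where "V k \<longleftrightarrow> val k = 1" for k
  have valV: "val k = (if V k then 1 else - 1)" if "k \<in> H" "fst k \<notin> x" for k
    using \<omega>_along(2)[OF that, of "1/2"] by (auto simp: V_def power2_eq_1_iff)
  \<comment> \<open>A corner takes the sign of an edge off \<open>x\<close> bounding it. If
    \<open>h\<close> and \<open>\<rho> h\<close> are both in \<open>x\<close>, the third half-edge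
    lies across either of them, so its sign is negated.\<close>
  define f where "f h = (if fst h \<notin> x then V h else if fst (\<rho> h) \<notin> x then V (\<rho> h) else \<not> V (\<rho> (\<rho> h)))" for h
  have uncovered: "V (\<rho> h) = V h" if h: "h \<in> H" "fst h \<notin> x" "fst (\<rho> h) \<notin> x" for h
  proof -
    have "fst (\<rho> (\<rho> h)) \<notin> x" using even_at[OF h(1)] h by simp
    then have "vert_of G h \<notin> covered" using covered_iff[OF h(1)] h by simp
    then show ?thesis
      using val_uncovered[OF h(1)] val_uncovered[OF rot.rotation_in(1)[OF h(1)]]
        rot.vert_of_rotation(1)[OF h(1)] by (simp add: V_def)
  qed
  have corner: "(f h \<noteq> f (\<rho> (\<rho> h))) = (fst h \<in> x)" if h: "h \<in> H" for h
    using even_at[OF h] rot.rotation_cubed[OF h] rot.rotation_cubed[OF rot.rotation_in(1)[OF h]]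
      uncovered[OF h] uncovered[OF rot.rotation_in(1)[OF h]] uncovered[OF rot.rotation_in(2)[OF h]]
    by (auto simp: f_def)
  have across: "f h = f (\<rho> (\<rho> (opposite h)))" if h: "h \<in> H" for h
  proof (cases "fst h \<in> x")
    case False
    have "f (opposite h) = f h" using False val_opposite[of h] by (simp add: f_def V_def)
    then show ?thesis using corner[of "opposite h"] h False by simp
  next
    case True
    have h': "opposite h \<in> H" "fst (opposite h) \<in> x" using h True by simp_all
    show ?thesis
    proof (cases "loop_edge h")
      \<comment> \<open>The two half-edges of a loop are neighbors in the rotation, so the two
        corners either coincide or both touch the third half-edge, which is off
        \<open>x\<close>.\<close>
      case loop: True
      then have "opposite h = \<rho> h \<or> opposite h = \<rho> (\<rho> h)"
        using rot.same_vert_cases[OF h h'(1)] by (auto simp: loop_edge_def)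
      then show ?thesis
      proof
        assume "opposite h = \<rho> h"
        then show ?thesis using rot.rotation_cubed[OF h] by simp
      next
        assume o: "opposite h = \<rho> (\<rho> h)"
        have "fst (\<rho> h) \<notin> x" using even_at[OF h] True h'(2) o by simp
        moreover have "\<rho> (\<rho> (opposite h)) = \<rho> h"
          using rot.rotation_cubed[OF rot.rotation_in(1)[OF h]] o by simp
        ultimately show ?thesis using True by (simp add: f_def)
      qed
    next
      case False
      define third where "third h = (if fst (\<rho> h) \<notin> x then \<rho> h else \<rho> (\<rho> h))" for h
      have third: "third h \<in> H" "fst (third h) \<notin> x" "vert_of G (third h) = vert_of G h"
        and f_third: "f h \<longleftrightarrow> (V (third h) = (third h = \<rho> h))"
        if "h \<in> H" "fst h \<in> x" for h
        using rot.rotation_in[OF that(1)] rot.vert_of_rotation[OF that(1)] even_at[OF that(1)] that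
          rot.rotation_distinct(3)[OF that(1)] by (auto simp: third_def f_def)
      note t = third[OF h True] and t' = third[OF h']
      have "val (third h) = val (third (opposite h)) \<longleftrightarrow>
         (third h = \<rho> h) \<noteq> (third (opposite h) = \<rho> (opposite h))"
        by (rule val_across[OF h True False t t'])
      then have "V (third h) = V (third (opposite h)) \<longleftrightarrow>
         (third h = \<rho> h) \<noteq> (third (opposite h) = \<rho> (opposite h))"
        using valV[OF t(1,2)] valV[OF t'(1,2)] by (auto split: if_splits)
      then have "f h \<noteq> f (opposite h)" unfolding f_third[OF h True] f_third[OF h'] by blast
      then show ?thesis using corner[OF h'(1)] h'(2) by blast
    qed
  qed
  have "face_coloring G \<rho> x f"
    unfolding face_coloring_def
  proof (intro conjI ballI)
    fix e assume e: "e \<in> edges G"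
    show "f (e, False) = f (\<rho> (\<rho> (e, True)))" "f (e, True) = f (\<rho> (\<rho> (e, False)))"
      using across[of "(e, False)"] across[of "(e, True)"] e by simp_all
  qed (rule corner)
  then show ?thesis by blast
qed

end

lemma (in plane_cubic) planar_rotation: "planar_rotation G (rotation G \<Gamma>)"
proof -
  \<comment> \<open>A loop is not an arc, but both halves of any edge are.\<close>
  define \<A> where "\<A> = (\<lambda>e. path_image (subpath 0 (1/2) (curve \<Gamma> e))) ` edges G \<union>
     (\<lambda>e. path_image (subpath (1/2) 1 (curve \<Gamma> e))) ` edges G"
  have sp: "simple_path (curve \<Gamma> e)" if "e \<in> edges G" for e
    using plane that by (auto simp: plane_graph_def)
  have "finite \<A>" using fin by (simp add: \<A>_def)
  moreover have "\<exists>g :: real \<Rightarrow> real^3. arc g \<and> A = path_image g" if "A \<in> \<A>" for A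
  proof -
    from that obtain e where e: "e \<in> edges G" and A: "A = path_image (subpath 0 (1/2) (curve \<Gamma> e)) \<or>
        A = path_image (subpath (1/2) 1 (curve \<Gamma> e))"
      unfolding \<A>_def by blast
    have "arc (subpath 0 (1/2) (curve \<Gamma> e))" "arc (subpath (1/2) 1 (curve \<Gamma> e))"
      by (rule arc_simple_path_subpath_interior[OF sp[OF e]]; simp)+
    then show ?thesis using A by blast
  qed
  ultimately obtain N where N: "norm N = 1" "N \<notin> \<Union>\<A>" using sphere_not_covered_by_arcs by blast
  obtain a b where frame: "orthonormal_frame a b N" using orthonormal_frame_exists[OF N(1)] .
  interpret plane_chart G \<Gamma> a b N
  proof (intro plane_chart.intro plane_chart_axioms.intro)
    show "plane_cubic G \<Gamma>" by (rule plane_cubic_axioms)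
    show "orthonormal_frame a b N" by (rule frame)
    fix e assume e: "e \<in> edges G"
    have "path_image (curve \<Gamma> e) = curve \<Gamma> e ` {0..1/2} \<union> curve \<Gamma> e ` {1/2..1}"
      unfolding path_image_def image_Un[symmetric] by (rule arg_cong[of _ _ "(`) (curve \<Gamma> e)"]) auto
    also have "\<dots> = path_image (subpath 0 (1/2) (curve \<Gamma> e)) \<union> path_image (subpath (1/2) 1 (curve \<Gamma> e))"
      by (simp add: path_image_subpath)
    finally show "N \<notin> path_image (curve \<Gamma> e)" using N(2) e by (auto simp: \<A>_def)
  qed
  show ?thesis
  proof
    fix x assume "even_subgraph G x"
    then interpret even_chart G \<Gamma> a b N x by unfold_locales
    show "\<exists>f. face_coloring G (rotation G \<Gamma>) x f" by (rule face_coloring_exists)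
  qed
qed

section \<open>The vertex polynomial\<close>

text \<open>The integer value at q = 1. It is additive and multiplicative, so the bracket can be
  evaluated termwise, with 2 for a circle and -1 for - q^3.\<close>

definition coeff_sum :: "laurent \<Rightarrow> int" where
  "coeff_sum p = (\<Sum>n\<in>Poly_Mapping.keys p. Poly_Mapping.lookup p n)"

lemma coeff_sum_superset:
  "finite S \<Longrightarrow> Poly_Mapping.keys p \<subseteq> S \<Longrightarrow> coeff_sum p = (\<Sum>n\<in>S. Poly_Mapping.lookup p n)"
  unfolding coeff_sum_def by (rule sum.mono_neutral_left) (auto simp: in_keys_iff)

lemma coeff_sum_add: "coeff_sum (p + q) = coeff_sum p + coeff_sum q"
proof -
  let ?S = "Poly_Mapping.keys p \<union> Poly_Mapping.keys q"
  have "coeff_sum (p + q) = (\<Sum>n\<in>?S. Poly_Mapping.lookup (p + q) n)"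
    by (rule coeff_sum_superset) (auto simp: keys_add)
  moreover have "coeff_sum p = (\<Sum>n\<in>?S. Poly_Mapping.lookup p n)"
    "coeff_sum q = (\<Sum>n\<in>?S. Poly_Mapping.lookup q n)"
    by (rule coeff_sum_superset; auto)+
  ultimately show ?thesis by (simp add: lookup_add sum.distrib)
qed

lemma coeff_sum_single [simp]: "coeff_sum (Poly_Mapping.single n c) = c"
  by (simp add: coeff_sum_def)

lemma coeff_sum_0 [simp]: "coeff_sum 0 = 0"
  by (simp add: coeff_sum_def)

lemma coeff_sum_sum: "coeff_sum (sum f A) = (\<Sum>a\<in>A. coeff_sum (f a))"
  by (induction A rule: infinite_finite_induct) (auto simp: coeff_sum_add)

lemma laurent_expansion: "p = (\<Sum>n\<in>Poly_Mapping.keys p. Poly_Mapping.single n (Poly_Mapping.lookup p n))"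
  for p :: laurent
  by (rule poly_mapping_eqI) (auto simp: lookup_sum lookup_single when_def in_keys_iff)

lemma coeff_sum_mult: "coeff_sum (p * q) = coeff_sum p * coeff_sum q"
proof -
  have "coeff_sum (p * q) = coeff_sum
     ((\<Sum>n\<in>Poly_Mapping.keys p. Poly_Mapping.single n (Poly_Mapping.lookup p n)) *
      (\<Sum>n\<in>Poly_Mapping.keys q. Poly_Mapping.single n (Poly_Mapping.lookup q n)))"
    using laurent_expansion[of p] laurent_expansion[of q] by simp
  also have "\<dots> = (\<Sum>n\<in>Poly_Mapping.keys p. \<Sum>m\<in>Poly_Mapping.keys q.
      Poly_Mapping.lookup p n * Poly_Mapping.lookup q m)"
    by (simp add: sum_product coeff_sum_sum mult_single)
  also have "\<dots> = coeff_sum p * coeff_sum q"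
    by (simp add: coeff_sum_def sum_product)
  finally show ?thesis .
qed

lemma coeff_sum_1 [simp]: "coeff_sum 1 = 1"
  using coeff_sum_single[of 0 1] unfolding single_one .

lemma coeff_sum_power: "coeff_sum (p ^ n) = coeff_sum p ^ n"
  by (induction n) (simp_all add: coeff_sum_mult)

lemma coeff_sum_uminus: "coeff_sum (- p) = - coeff_sum p"
  using coeff_sum_add[of p "- p"] by simp

lemma laurent_eval_1: "laurent_eval p 1 = real_of_int (coeff_sum p)"
  by (simp add: laurent_eval_def coeff_sum_def)

context planar_rotation
begin

lemma two_power_state_circles:
  "2 ^ state_circles (blow_up G \<rho>) (blow_up_rotation \<rho>) (Inl ` (edges G \<union> circles G))
     (Inl ` crossed_edges G T) = card (cut_pairs G (crossed_edges G T)) * 4 ^ card (circles G)"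
proof -
  have "crossed_edges G T \<subseteq> edges G" by (auto simp: crossed_edges_def)
  from two_power_blow_up_classes[OF this] show ?thesis
    by (simp add: state_circles_blow_up power_add power_mult)
qed

end

text \<open>A power of 2 determines its exponent, so equal counts of \<open>cut_pairs\<close> give
  equal numbers of circles for every \<open>T\<close>; the brackets then agree term by term as
  Laurent polynomials.\<close>

lemma vertex_bracket_eq:
  assumes "plane_cubic G \<Gamma>" "plane_cubic G \<Gamma>'"
  shows "vertex_bracket G \<Gamma> = vertex_bracket G \<Gamma>'"
proof -
  interpret p: planar_rotation G "rotation G \<Gamma>" by (rule plane_cubic.planar_rotation[OF assms(1)])
  interpret p': planar_rotation G "rotation G \<Gamma>'" by (rule plane_cubic.planar_rotation[OF assms(2)])
  have "state_circles (blow_up G (rotation G \<Gamma>)) (blow_up_rotation (rotation G \<Gamma>))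
      (Inl ` (edges G \<union> circles G)) (Inl ` crossed_edges G T) =
    state_circles (blow_up G (rotation G \<Gamma>')) (blow_up_rotation (rotation G \<Gamma>'))
      (Inl ` (edges G \<union> circles G)) (Inl ` crossed_edges G T)" for T
    using p.two_power_state_circles[of T] p'.two_power_state_circles[of T]
    by (metis power_inject_exp one_less_numeral_iff semiring_norm(76))
  then show ?thesis by (simp only: vertex_bracket_def Let_def)
qed

lemma penrose_bracket_eq:
  assumes "plane_cubic G \<Gamma>" "perfect_matching G M"
  shows "penrose_bracket G \<Gamma> M = int (card (tait_colorings G)) * 3 ^ card (circles G)"
proof -
  interpret planar_rotation G "rotation G \<Gamma>" by (rule plane_cubic.planar_rotation[OF assms(1)])
  show ?thesis unfolding penrose_bracket_def by (rule penrose_state_sum[OF assms(2)])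
qed

lemma penrose_formula_eq:
  assumes "plane_cubic G \<Gamma>"
  shows "penrose_formula G = int (card (tait_colorings G)) * 3 ^ card (circles G)"
proof (cases "\<exists>M. perfect_matching G M")
  case True
  then obtain M where M: "perfect_matching G M" by blast
  have plane: "plane_graph G \<Gamma>" using assms by (simp add: plane_cubic_def)
  define q where "q = (SOME (\<Gamma>, M). plane_graph G \<Gamma> \<and> perfect_matching G M)"
  have "case q of (\<Gamma>, M) \<Rightarrow> plane_graph G \<Gamma> \<and> perfect_matching G M"
    unfolding q_def by (rule someI[of _ "(\<Gamma>, M)"]) (use M plane in simp)
  then obtain \<Gamma>' M' where q: "q = (\<Gamma>', M')" "plane_graph G \<Gamma>'" "perfect_matching G M'"
    by (cases q) auto
  then have "plane_cubic G \<Gamma>'" using assms by (simp add: plane_cubic_def)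
  then show ?thesis
    using penrose_bracket_eq[OF _ q(3)] q(1) True by (simp add: penrose_formula_def q_def[symmetric])
next
  case False
  interpret planar_rotation G "rotation G \<Gamma>" by (rule plane_cubic.planar_rotation[OF assms])
  \<comment> \<open>A color class of a Tait coloring would be a perfect matching, so the default
    value 0 is the correct one.\<close>
  have "tait_colorings G = {}"
    using False tait_color_class_one_factor[of _ 0] one_factor_perfect_matching by blast
  then show ?thesis using False by (simp add: penrose_formula_def)
qed

lemma vertex_bracket_eval_1:
  assumes "plane_cubic G \<Gamma>" "circles G = {}"
  shows "laurent_eval (vertex_bracket G \<Gamma>) 1 = 2 ^ (card (verts G) div 2) * real (card (tait_colorings G))"
proof -
  interpret planar_rotation G "rotation G \<Gamma>" by (rule plane_cubic.planar_rotation[OF assms(1)])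
  have "coeff_sum (vertex_bracket G \<Gamma>) =
      (\<Sum>T\<in>Pow (verts G). (-1) ^ card T * int (card (cut_pairs G (crossed_edges G T))))"
    unfolding vertex_bracket_def Let_def coeff_sum_sum
  proof (rule sum.cong)
    fix T
    have "coeff_sum (q_var + q_inv) = 2" "coeff_sum (- (q_var ^ 3)) = - 1"
      by (simp_all add: q_var_def q_inv_def coeff_sum_add coeff_sum_uminus coeff_sum_power)
    moreover have "int (card (cut_pairs G (crossed_edges G T))) =
        2 ^ state_circles (blow_up G (rotation G \<Gamma>)) (blow_up_rotation (rotation G \<Gamma>))
           (Inl ` (edges G \<union> circles G)) (Inl ` crossed_edges G T)"
      using two_power_state_circles[of T] assms(2) by (simp flip: of_nat_power)
    ultimately show "coeff_sum ((- (q_var ^ 3)) ^ card T * (q_var + q_inv) ^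
         state_circles (blow_up G (rotation G \<Gamma>)) (blow_up_rotation (rotation G \<Gamma>))
           (Inl ` (edges G \<union> circles G)) (Inl ` crossed_edges G T)) =
        (-1) ^ card T * int (card (cut_pairs G (crossed_edges G T)))"
      by (simp add: coeff_sum_mult coeff_sum_power)
  qed simp
  then show ?thesis unfolding laurent_eval_1 signed_sum_cut_pairs by simp
qed

theorem theorem7p5:
  fixes G :: "('v, 'e) mgraph"
  assumes "finite_mgraph G" and "trivalent G" and "planar G"
  shows "(\<forall>\<Gamma>. plane_graph G \<Gamma> \<longrightarrow> vertex_bracket G \<Gamma> = vertex_polynomial G) \<and>
         (\<forall>\<Gamma> M. plane_graph G \<Gamma> \<and> perfect_matching G M \<longrightarrow>
                  penrose_bracket G \<Gamma> M = penrose_formula G) \<and>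
         (circles G = {} \<longrightarrow>
            real_of_int (penrose_formula G) =
              (1/2) powr (1/2 * real (card (verts G))) * laurent_eval (vertex_polynomial G) 1)"
proof -
  have cubic: "plane_cubic G \<Gamma>" if "plane_graph G \<Gamma>" for \<Gamma>
    using that assms by (simp add: plane_cubic_def)
  define \<Gamma>\<^sub>0 where "\<Gamma>\<^sub>0 = (SOME \<Gamma>. plane_graph G \<Gamma>)"
  have "plane_graph G \<Gamma>\<^sub>0" unfolding \<Gamma>\<^sub>0_def using assms(3) by (simp add: planar_def someI_ex)
  then have \<Gamma>\<^sub>0: "plane_cubic G \<Gamma>\<^sub>0" by (rule cubic)
  have poly: "vertex_polynomial G = vertex_bracket G \<Gamma>\<^sub>0" by (simp add: vertex_polynomial_def \<Gamma>\<^sub>0_def)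
  show ?thesis
  proof (intro conjI allI impI)
    fix \<Gamma> assume "plane_graph G \<Gamma>"
    then show "vertex_bracket G \<Gamma> = vertex_polynomial G"
      unfolding poly using vertex_bracket_eq cubic \<Gamma>\<^sub>0 by blast
  next
    fix \<Gamma> M assume "plane_graph G \<Gamma> \<and> perfect_matching G M"
    then show "penrose_bracket G \<Gamma> M = penrose_formula G"
      using penrose_bracket_eq penrose_formula_eq cubic by metis
  next
    assume circ: "circles G = {}"
    interpret planar_rotation G "rotation G \<Gamma>\<^sub>0" by (rule plane_cubic.planar_rotation[OF \<Gamma>\<^sub>0])
    define n where "n = card (verts G)"
    \<comment> \<open>From 3 n = 2 |E|; it turns the real exponent 1/2 * n into the natural number
      \<open>n div 2\<close>.\<close>
    have "even n"
      using card_edges unfolding n_def by (metis dvd_triv_left even_mult_iff odd_numeral)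
    then have "(1/2::real) powr (1/2 * real n) = (1/2) ^ (n div 2)"
      by (simp add: powr_realpow[symmetric] real_of_nat_div)
    then have "(1/2::real) powr (1/2 * real n) * 2 ^ (n div 2) = 1"
      by (simp add: power_mult_distrib[symmetric])
    then show "real_of_int (penrose_formula G) =
        (1/2) powr (1/2 * real (card (verts G))) * laurent_eval (vertex_polynomial G) 1"
      unfolding poly vertex_bracket_eval_1[OF \<Gamma>\<^sub>0 circ] penrose_formula_eq[OF \<Gamma>\<^sub>0] n_def[symmetric]
      using circ by (simp add: mult.assoc[symmetric])
  qed
qed

end
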